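(* Let $n\ge 2$ and $N\ge 2$, and let $f:B_n\to B_N$ be a rational proper holomorphic mapping of degree $d$. Then $$d\le\frac{N(N-1)}{2(2n-3)}.$$
   Context: $B_n$ is the open unit ball in $\mathbb{C}^n$. A rational proper mapping $f:B_n\to B_N$ is a proper holomorphic map that can be written $f=p/q$ with $p:\mathbb{C}^n\to\mathbb{C}^N$ a polynomial map and $q$ a polynomial; its degree is the maximum of the degrees of $p$ and $q$ when $p/q$ is reduced to lowest terms. *)

theory Defs
  imports "HOL-Analysis.Analysis" "HOL-Library.Poly_Mapping"
begin

text \<open>A polynomial in the coordinates of \<open>complex ^ 'n\<close> maps exponent vectors to coefficients;
  the ring structure (hence \<open>dvd\<close>) is that of \<open>Poly_Mapping\<close>.\<close>

type_synonym 'n cpoly = "('n \<Rightarrow>\<^sub>0 nat) \<Rightarrow>\<^sub>0 complex"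

definition cpoly_eval :: "'n::finite cpoly \<Rightarrow> complex ^ 'n \<Rightarrow> complex" where
  "cpoly_eval P z =
     (\<Sum>m\<in>Poly_Mapping.keys P.
        Poly_Mapping.lookup P m * (\<Prod>i\<in>UNIV. (z $ i) ^ Poly_Mapping.lookup m i))"

text \<open>Convention: the zero polynomial has total degree 0.\<close>

definition total_degree :: "'n::finite cpoly \<Rightarrow> nat" where
  "total_degree P =
     Max (insert 0 ((\<lambda>m. \<Sum>i\<in>UNIV. Poly_Mapping.lookup m i) ` Poly_Mapping.keys P))"

text \<open>A polynomial map from \<open>complex ^ 'n\<close> to \<open>complex ^ 'm\<close> is a vector of polynomials.\<close>

definition cpoly_map_eval :: "'n::finite cpoly ^ 'm::finite \<Rightarrow> complex ^ 'n \<Rightarrow> complex ^ 'm" where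
  "cpoly_map_eval p z = (\<chi> j. cpoly_eval (p $ j) z)"

definition map_degree :: "'n::finite cpoly ^ 'm::finite \<Rightarrow> nat" where
  "map_degree p = Max (range (\<lambda>j. total_degree (p $ j)))"

definition holomorphic_map_on ::
    "(complex ^ 'n::finite \<Rightarrow> complex ^ 'm::finite) \<Rightarrow> (complex ^ 'n) set \<Rightarrow> bool" where
  "holomorphic_map_on f S \<longleftrightarrow>
     (\<forall>z\<in>S. \<exists>D. (f has_derivative D) (at z within S) \<and> (\<forall>c v. D (c *s v) = c *s D v))"

text \<open>The quotient is only required to agree with \<open>f\<close> where the denominator does not vanish;
  that the denominator of a reduced quotient has no zeros in a domain where \<open>f\<close> is holomorphic
  is a consequence, not an assumption.\<close>

definition is_quotient_on ::
    "(complex ^ 'n::finite \<Rightarrow> complex ^ 'm::finite) \<Rightarrow> (complex ^ 'n) set \<Rightarrow>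
      'n cpoly ^ 'm \<Rightarrow> 'n cpoly \<Rightarrow> bool" where
  "is_quotient_on f S p q \<longleftrightarrow>
     q \<noteq> 0 \<and>
     (\<forall>z\<in>S. cpoly_eval q z \<noteq> 0 \<longrightarrow> f z = inverse (cpoly_eval q z) *s cpoly_map_eval p z)"

text \<open>No nonconstant polynomial divides \<open>q\<close> and all components of \<open>p\<close> simultaneously.\<close>

definition lowest_terms :: "'n::finite cpoly ^ 'm::finite \<Rightarrow> 'n cpoly \<Rightarrow> bool" where
  "lowest_terms p q \<longleftrightarrow> (\<forall>h. h dvd q \<and> (\<forall>j. h dvd p $ j) \<longrightarrow> h dvd 1)"

definition rational_map_of_degree_on ::
    "(complex ^ 'n::finite \<Rightarrow> complex ^ 'm::finite) \<Rightarrow> (complex ^ 'n) set \<Rightarrow> nat \<Rightarrow> bool" where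
  "rational_map_of_degree_on f S d \<longleftrightarrow>
     (\<exists>p q. is_quotient_on f S p q \<and> lowest_terms p q \<and> d = max (map_degree p) (total_degree q))"

definition proper_holomorphic_map ::
    "(complex ^ 'n::finite \<Rightarrow> complex ^ 'm::finite) \<Rightarrow>
      (complex ^ 'n) set \<Rightarrow> (complex ^ 'm) set \<Rightarrow> bool" where
  "proper_holomorphic_map f S T \<longleftrightarrow>
     holomorphic_map_on f S \<and> proper_map (top_of_set S) (top_of_set T) f"

text \<open>The topological notion of properness used above is the usual one
  (preimages of compact sets are compact).\<close>

lemma proper_map_ball_iff:
  fixes f :: "complex ^ 'n::finite \<Rightarrow> complex ^ 'm::finite"
  shows "proper_map (top_of_set (ball 0 1)) (top_of_set (ball 0 1)) f \<longleftrightarrow>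
    f ` ball 0 1 \<subseteq> ball 0 1 \<and>
    (\<forall>K. compact K \<and> K \<subseteq> ball 0 1 \<longrightarrow> compact {z \<in> ball 0 1. f z \<in> K})"
proof -
  let ?X = "top_of_set (ball 0 1 :: (complex ^ 'n) set)"
  let ?Y = "top_of_set (ball 0 1 :: (complex ^ 'm) set)"
  have "locally_compact_space ?Y"
    by (rule locally_compact_space_open_subset)
       (auto simp: locally_compact_space_euclidean)
  then have "k_space ?Y"
    by (rule locally_compact_imp_k_space)
  moreover have "kc_space ?Y"
    by (intro Hausdorff_imp_kc_space Hausdorff_space_subtopology Hausdorff_space_euclidean)
  moreover have "kc_space ?X"
    by (intro Hausdorff_imp_kc_space Hausdorff_space_subtopology Hausdorff_space_euclidean)
  ultimately show ?thesis
    by (subst proper_eq_compact_map) (auto simp: compactin_subtopology Pi_iff image_subset_iff)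
qed

end

(* A rational proper map p/q of degree d satisfies |p|^2 = |q|^2 on the sphere, so (p, q), homogenized,
   maps null vectors to null vectors. Composing with a unitary map and with the sharp monomial map
   B_2 -> B_n of degree 2n - 3 gives a polynomial sphere map Phi on C^2, homogeneous of degree
   m = d (2n - 3), and it suffices to show m <= N (N - 1) / 2 (Meylan's bound for n = 2).

   Polarization: Phi maps the complex line dual to a point w into the orthogonal complement of Phi(w).
   Let w run through the tangent line at a point of the sphere, with parameter s, and expand Phi on the
   dual line of w, which passes through that point: the j-th Taylor coefficient is a polynomial in s of
   degree at most j. Hence the coordinates of the conjugate of Phi(w), polynomials in s, satisfy linear
   equations whose coefficients have degrees 1, ..., r - 1, where r <= N is the generic dimension of the
   span of Phi on a line. The Lorentz signature of the target makes these equations nondegenerate, and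
   Cramer's rule bounds the degrees by 1 + ... + (r - 1), provided that Phi has full degree and no common
   zeros on the tangent line.

   The unitary map is chosen to ensure this proviso. Since p and q have no common factor, their common
   zeros are avoided by a generic line of a generic direction e. The unitary map places the curve into
   which the tangent line is mapped in an affine hyperplane orthogonal to e, and a rotation in the
   direction e then moves it off the common zeros. *)

theory Submission
  imports Defs "Jordan_Normal_Form.Determinant" "HOL-Computational_Algebra.Field_as_Ring"
    "HOL-Computational_Algebra.Fundamental_Theorem_Algebra"
begin

section \<open>Polynomial functions over a set of generators\<close>

text \<open>The base point is taken on the hypersurface, so its dual line is its tangent line. Both
  sides of the orthogonality relation are then expanded along this line at the same point: if c_0,
  c_1, ... are the Taylor vectors of the map there, the conjugate of Phi(w) has the conjugates of
  the c_j as its coefficients in s, and at s = 0 the equations involve only products of the c_j. All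
  c_j are orthogonal to c_0. Hence they span a space of dimension r <= N and not N + 1, the equation
  from c_0 is trivial, and r - 1 equations remain for r unknown coordinates. At s = 0 the
  coefficients of the last r - 1 unknowns form the Gram matrix of c_1, ..., c_(r-1). It is
  invertible because in Lorentz signature a null vector orthogonal to the null vector c_0 is a
  multiple of it. Asking for a base point on the hypersurface costs no genericity: the hypersurface
  gives a real form of the space of incident pairs of points, and no nonzero polynomial vanishes on
  it, even near a given point. So the base point can be moved from one where the absence of common
  zeros is known to a nearby one where the rank is generic.\<close>

inductive polyfun :: "('a \<Rightarrow> complex) set \<Rightarrow> ('a \<Rightarrow> complex) \<Rightarrow> bool" for G where
  polyfun_const: "polyfun G (\<lambda>_. c)"
| polyfun_gen: "g \<in> G \<Longrightarrow> polyfun G g"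
| polyfun_add: "polyfun G f \<Longrightarrow> polyfun G g \<Longrightarrow> polyfun G (\<lambda>x. f x + g x)"
| polyfun_mult: "polyfun G f \<Longrightarrow> polyfun G g \<Longrightarrow> polyfun G (\<lambda>x. f x * g x)"

lemma polyfun_minus: "polyfun G f \<Longrightarrow> polyfun G (\<lambda>x. - f x)"
  using polyfun_mult[OF polyfun_const[of G "-1"], of f] by simp

lemma polyfun_diff: "polyfun G f \<Longrightarrow> polyfun G g \<Longrightarrow> polyfun G (\<lambda>x. f x - g x)"
  using polyfun_add[OF _ polyfun_minus, of G f g] by simp

lemma polyfun_sum: "(\<And>i. i \<in> I \<Longrightarrow> polyfun G (f i)) \<Longrightarrow> polyfun G (\<lambda>x. \<Sum>i\<in>I. f i x)"
  by (induction I rule: infinite_finite_induct) (auto intro: polyfun_const polyfun_add)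

lemma polyfun_prod: "(\<And>i. i \<in> I \<Longrightarrow> polyfun G (f i)) \<Longrightarrow> polyfun G (\<lambda>x. \<Prod>i\<in>I. f i x)"
  by (induction I rule: infinite_finite_induct) (auto intro: polyfun_const polyfun_mult)

lemma polyfun_power: "polyfun G f \<Longrightarrow> polyfun G (\<lambda>x. f x ^ n)"
  by (induction n) (auto intro: polyfun_const polyfun_mult)

lemmas polyfun_intros = polyfun_const polyfun_add polyfun_mult polyfun_minus polyfun_diff
  polyfun_sum polyfun_prod polyfun_power

lemma polyfun_compose:
  assumes "polyfun G f" and "\<And>g. g \<in> G \<Longrightarrow> polyfun H (\<lambda>x. g (\<phi> x))"
  shows "polyfun H (\<lambda>x. f (\<phi> x))"
  using assms(1) by induction (auto intro: polyfun_intros assms(2))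

lemma polyfun_continuous:
  fixes f :: "'a::topological_space \<Rightarrow> complex"
  assumes "polyfun G f" and "\<And>g. g \<in> G \<Longrightarrow> continuous_on UNIV g"
  shows "continuous_on UNIV f"
  using assms(1) by induction (auto intro: continuous_intros assms(2))

lemma polyfun_univariate:
  assumes "polyfun {\<lambda>t. t} f"
  shows "\<exists>p. f = poly p"
  using assms
proof induction
  case (polyfun_const c)
  have "(\<lambda>_. c) = poly [:c:]" by auto
  then show ?case by blast
next
  case (polyfun_gen g)
  then have "g = poly [:0, 1:]" by auto
  then show ?case by blast
next
  case (polyfun_add f g)
  then show ?case by (metis (no_types) poly_add)
next
  case (polyfun_mult f g)
  then show ?case by (metis (no_types) poly_mult)
qed

lemma polyfun_eq_0_if_infinite_zeros:
  assumes "polyfun {\<lambda>t. t} f" "infinite X" "\<And>t. t \<in> X \<Longrightarrow> f t = 0"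
  shows "f t = 0"
proof -
  obtain p where p: "f = poly p" using polyfun_univariate[OF assms(1)] by blast
  have "X \<subseteq> {x. poly p x = 0}" using assms(3) p by auto
  then have "p = 0" using assms(2) poly_roots_finite[of p] finite_subset by blast
  then show ?thesis using p by simp
qed

text \<open>One new variable, the first component of a pair, is put in front. Two and three
  variables arise by iteration, and \<open>polyfun_coeffs\<close> can single out the new
  one.\<close>

definition ext_gens :: "('a \<Rightarrow> complex) set \<Rightarrow> (complex \<times> 'a \<Rightarrow> complex) set" where
  "ext_gens G = insert fst ((\<lambda>g p. g (snd p)) ` G)"

lemma polyfun_fst: "polyfun (ext_gens G) fst"
  by (rule polyfun_gen) (simp add: ext_gens_def)

lemma polyfun_snd: "polyfun G f \<Longrightarrow> polyfun (ext_gens G) (\<lambda>p. f (snd p))"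
  by (erule polyfun_compose) (auto simp: ext_gens_def intro: polyfun_gen)

text \<open>The degree bound \<open>K\<close> is uniform in \<open>x\<close>. This bounds the size
  of nonvanishing determinants in \<open>degree_bound\<close> and makes \<open>line_poly_ex\<close>
  possible.\<close>

lemma polyfun_coeffs:
  assumes "polyfun (ext_gens G) f"
  shows "\<exists>P K. (\<forall>j. polyfun G (\<lambda>x. coeff (P x) j)) \<and> (\<forall>x. degree (P x) \<le> K) \<and>
    (\<forall>t x. f (t, x) = poly (P x) t)"
  using assms
proof induction
  case (polyfun_const c)
  show ?case
    by (rule exI[of _ "\<lambda>_. [:c:]"], rule exI[of _ 0])
      (auto simp: coeff_pCons intro!: polyfun.polyfun_const)
next
  case (polyfun_gen g)
  then consider "g = fst" | h where "h \<in> G" "g = (\<lambda>p. h (snd p))"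
    by (auto simp: ext_gens_def)
  then show ?case
  proof cases
    case 1
    show ?thesis
      by (rule exI[of _ "\<lambda>_. [:0, 1:]"], rule exI[of _ 1])
        (auto simp: 1 intro!: polyfun.polyfun_const)
  next
    case 2
    have "polyfun G (\<lambda>x. coeff [:h x:] j)" for j
      using 2(1) by (cases j) (auto intro: polyfun.polyfun_const polyfun.polyfun_gen)
    then show ?thesis
      by (intro exI[of _ "\<lambda>x. [:h x:]"] exI[of _ 0]) (auto simp: 2)
  qed
next
  case (polyfun_add f g)
  then obtain P K Q L where
    P: "\<And>j. polyfun G (\<lambda>x. coeff (P x) j)" "\<And>x. degree (P x) \<le> K" "\<And>t x. f (t, x) = poly (P x) t" and
    Q: "\<And>j. polyfun G (\<lambda>x. coeff (Q x) j)" "\<And>x. degree (Q x) \<le> L" "\<And>t x. g (t, x) = poly (Q x) t"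
    by blast
  have "polyfun G (\<lambda>x. coeff (P x + Q x) j)" for j
    using polyfun.polyfun_add[OF P(1) Q(1), of j j] by simp
  moreover have "degree (P x + Q x) \<le> max K L" for x
    using P(2)[of x] Q(2)[of x] by (intro degree_add_le) auto
  ultimately show ?case using P(3) Q(3)
    by (intro exI[of _ "\<lambda>x. P x + Q x"] exI[of _ "max K L"]) auto
next
  case (polyfun_mult f g)
  then obtain P K Q L where
    P: "\<And>j. polyfun G (\<lambda>x. coeff (P x) j)" "\<And>x. degree (P x) \<le> K" "\<And>t x. f (t, x) = poly (P x) t" and
    Q: "\<And>j. polyfun G (\<lambda>x. coeff (Q x) j)" "\<And>x. degree (Q x) \<le> L" "\<And>t x. g (t, x) = poly (Q x) t"
    by blast
  have "polyfun G (\<lambda>x. coeff (P x * Q x) j)" for j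
    unfolding coeff_mult by (intro polyfun_sum polyfun.polyfun_mult P Q)
  moreover have "degree (P x * Q x) \<le> K + L" for x
    using P(2)[of x] Q(2)[of x] degree_mult_le[of "P x" "Q x"] by linarith
  ultimately show ?case using P(3) Q(3)
    by (intro exI[of _ "\<lambda>x. P x * Q x"] exI[of _ "K + L"]) auto
qed

abbreviation gens1 :: "(complex \<Rightarrow> complex) set" where "gens1 \<equiv> {\<lambda>t. t}"
abbreviation gens2 :: "(complex \<times> complex \<Rightarrow> complex) set" where "gens2 \<equiv> ext_gens gens1"
abbreviation gens3 :: "(complex \<times> complex \<times> complex \<Rightarrow> complex) set" where "gens3 \<equiv> ext_gens gens2"

lemma polyfun_gens2: "polyfun gens2 fst" "polyfun gens2 snd"
  by (auto intro: polyfun_gen simp: ext_gens_def)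

lemma polyfun_gens3: "polyfun gens3 fst" "polyfun gens3 (\<lambda>x. fst (snd x))" "polyfun gens3 (\<lambda>x. snd (snd x))"
  by (auto intro!: polyfun_gen simp: ext_gens_def)

lemma polyfun_compose2:
  assumes "polyfun gens2 f" "polyfun G a" "polyfun G b"
  shows "polyfun G (\<lambda>x. f (a x, b x))"
  by (rule polyfun_compose[OF assms(1)]) (use assms in \<open>auto simp: ext_gens_def\<close>)

lemma polyfun_compose3:
  assumes "polyfun gens3 f" "polyfun G a" "polyfun G b" "polyfun G c"
  shows "polyfun G (\<lambda>x. f (a x, b x, c x))"
  by (rule polyfun_compose[OF assms(1)]) (use assms in \<open>auto simp: ext_gens_def\<close>)

text \<open>The variables are freed one at a time, by counting zeros in one variable. It is applied
  to sets of real numbers: an identity on real points extends to all complex points.\<close>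

lemma polyfun3_eq_0:
  assumes f: "polyfun gens3 f" and inf: "infinite X" "infinite Y" "infinite Z"
    and z: "\<And>x y u. x \<in> X \<Longrightarrow> y \<in> Y \<Longrightarrow> u \<in> Z \<Longrightarrow> f (x, y, u) = 0"
  shows "f (x, y, u) = 0"
proof -
  have id: "polyfun gens1 (\<lambda>t. t)" by (rule polyfun_gen) simp
  have 1: "f (x, y, u) = 0" if "y \<in> Y" "u \<in> Z" for x y u
    by (rule polyfun_eq_0_if_infinite_zeros[of "\<lambda>x. f (x, y, u)" X])
      (use that inf z in \<open>auto intro: polyfun_compose3[OF f] id polyfun_const\<close>)
  have 2: "f (x, y, u) = 0" if "u \<in> Z" for x y u
    by (rule polyfun_eq_0_if_infinite_zeros[of "\<lambda>y. f (x, y, u)" Y])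
      (use that inf 1 in \<open>auto intro: polyfun_compose3[OF f] id polyfun_const\<close>)
  show ?thesis
    by (rule polyfun_eq_0_if_infinite_zeros[of "\<lambda>u. f (x, y, u)" Z])
      (use inf 2 in \<open>auto intro: polyfun_compose3[OF f] id polyfun_const\<close>)
qed

lemma polyfun2_cnj:
  assumes "polyfun gens2 f"
  shows "polyfun gens2 (\<lambda>p. cnj (f (cnj (fst p), cnj (snd p))))"
  using assms by induction (auto simp: ext_gens_def intro: polyfun_intros polyfun_gen)

section \<open>Determinants of families\<close>

text \<open>Families indexed by \<open>nat\<close> keep dimensions out of the types and let rows and
  columns be replaced by \<open>if\<close>; entries outside the square of size \<open>n\<close> do
  not matter.\<close>

definition fdet :: "nat \<Rightarrow> (nat \<Rightarrow> nat \<Rightarrow> 'a::comm_ring_1) \<Rightarrow> 'a" where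
  "fdet n M = Determinant.det (Matrix.mat n n (\<lambda>(i, j). M i j))"

lemma fdet_expand:
  "fdet n M = (\<Sum>p | p permutes {0..<n}. signof p * (\<Prod>i=0..<n. M i (p i)))"
proof -
  have "(\<Prod>i=0..<n. Matrix.mat n n (\<lambda>(i, j). M i j) $$ (i, p i)) = (\<Prod>i=0..<n. M i (p i))"
    if "p permutes {0..<n}" for p
    by (intro prod.cong refl) (use permutes_in_image[OF that] in auto)
  then show ?thesis
    unfolding fdet_def by (subst det_def'[where n = n]) auto
qed

lemma fdet_cong:
  assumes "\<And>i j. i < n \<Longrightarrow> j < n \<Longrightarrow> M i j = M' i j"
  shows "fdet n M = fdet n M'"
  unfolding fdet_def by (intro arg_cong[of _ _ Determinant.det] eq_matI) (auto simp: assms)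

lemma fdet_cramer:
  assumes "\<And>i. i < n \<Longrightarrow> (\<Sum>j<n. M i j * x j) = b i" and "k < n"
  shows "fdet n (\<lambda>i j. if j = k then b i else M i j) = x k * fdet n M"
proof -
  let ?M = "Matrix.mat n n (\<lambda>(i, j). M i j)" and ?x = "Matrix.vec n x"
  have "?M *\<^sub>v ?x = Matrix.vec n b"
    using assms(1) by (intro eq_vecI) (auto simp: scalar_prod_def lessThan_atLeast0)
  then have "replace_col ?M (?M *\<^sub>v ?x) k = Matrix.mat n n (\<lambda>(i, j). if j = k then b i else M i j)"
    by (intro eq_matI) (auto simp: replace_col_def)
  then show ?thesis
    using cramer_lemma_mat[of ?M n ?x k] assms(2) by (simp add: fdet_def)
qed

lemma fdet_eq_0_imp_kernel:
  fixes M :: "nat \<Rightarrow> nat \<Rightarrow> 'a::idom"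
  assumes "fdet n M = 0"
  shows "\<exists>x. (\<exists>j<n. x j \<noteq> 0) \<and> (\<forall>i<n. (\<Sum>j<n. M i j * x j) = 0)"
proof -
  let ?M = "Matrix.mat n n (\<lambda>(i, j). M i j)"
  from assms obtain v where v: "v \<in> carrier_vec n" "v \<noteq> 0\<^sub>v n" "?M *\<^sub>v v = 0\<^sub>v n"
    unfolding fdet_def using det_0_iff_vec_prod_zero[of ?M n] by auto
  have "\<exists>j<n. vec_index v j \<noteq> 0" using v(1,2) by (metis carrier_vecD eq_vecI index_zero_vec)
  moreover have "(\<Sum>j<n. M i j * vec_index v j) = 0" if "i < n" for i
  proof -
    have "vec_index (?M *\<^sub>v v) i = 0" using v(3) that by simp
    then show ?thesis using v(1) that by (auto simp: scalar_prod_def lessThan_atLeast0)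
  qed
  ultimately show ?thesis by (intro exI[of _ "vec_index v"]) auto
qed

lemma fdet_nonzero_imp_trivial_kernel:
  fixes M :: "nat \<Rightarrow> nat \<Rightarrow> 'a::idom"
  assumes "fdet n M \<noteq> 0" "\<And>i. i < n \<Longrightarrow> (\<Sum>j<n. M i j * x j) = 0" "k < n"
  shows "x k = 0"
proof -
  have "x k * fdet n M = fdet n (\<lambda>i j. if j = k then 0 else M i j)"
    using fdet_cramer[of n M x "\<lambda>_. 0" k] assms(2,3) by simp
  also have "\<dots> = 0"
  proof -
    have "(\<Prod>i=0..<n. if p i = k then 0 else M i (p i)) = 0" if "p permutes {0..<n}" for p
    proof -
      have "k \<in> p ` {0..<n}" using permutes_image[OF that] assms(3) by simp
      then show ?thesis by (auto intro!: prod_zero)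
    qed
    then show ?thesis unfolding fdet_expand by (auto intro!: sum.neutral)
  qed
  finally show ?thesis using assms(1) by simp
qed

lemma fdet_zero_row:
  assumes "k < n" "\<And>j. j < n \<Longrightarrow> M k j = 0"
  shows "fdet n M = 0"
proof -
  have "(\<Prod>i=0..<n. M i (p i)) = 0" if "p permutes {0..<n}" for p
    using assms permutes_in_image[OF that, of k] by (intro prod_zero bexI[of _ k]) auto
  then show ?thesis unfolding fdet_expand by simp
qed

lemma fdet_zero_col:
  fixes M :: "nat \<Rightarrow> nat \<Rightarrow> 'a::idom"
  assumes "k < n" "\<And>i. i < n \<Longrightarrow> M i k = 0"
  shows "fdet n M = 0"
proof (rule ccontr)
  assume "fdet n M \<noteq> 0"
  then have "(if k = k then 1 else 0 :: 'a) = 0"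
    by (rule fdet_nonzero_imp_trivial_kernel[OF _ _ assms(1), where x = "\<lambda>j. if j = k then 1 else 0"])
      (auto simp: assms if_distrib[of "\<lambda>x. _ * x"] cong: if_cong)
  then show False by simp
qed

lemma fdet_scale_col:
  assumes "k < n"
  shows "fdet n (\<lambda>i j. if j = k then c * b i else M i j) = c * fdet n (\<lambda>i j. if j = k then b i else M i j)"
proof -
  have "(\<Prod>i=0..<n. if p i = k then c * b i else M i (p i)) =
      c * (\<Prod>i=0..<n. if p i = k then b i else M i (p i))" if p: "p permutes {0..<n}" for p
  proof -
    have "(\<Prod>i=0..<n. if p i = k then c * b i else M i (p i)) =
        (\<Prod>i=0..<n. if p i = k then c else 1) * (\<Prod>i=0..<n. if p i = k then b i else M i (p i))"
      unfolding prod.distrib[symmetric] by (intro prod.cong) auto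
    also have "(\<Prod>i=0..<n. if p i = k then c else 1) = (\<Prod>i=0..<n. if i = k then c else 1)"
      using prod.permute[OF p, of "\<lambda>i. if i = k then c else 1"] by (simp add: o_def)
    also have "\<dots> = c" using assms by (simp add: prod.delta)
    finally show ?thesis .
  qed
  then show ?thesis
    unfolding fdet_expand sum_distrib_left by (intro sum.cong) (auto simp: mult_ac)
qed

lemma degree_fdet_le:
  assumes "\<And>i j. i < n \<Longrightarrow> j < n \<Longrightarrow> degree (M i j) \<le> e i"
  shows "degree (fdet n M :: 'a::idom poly) \<le> (\<Sum>i<n. e i)"
  unfolding fdet_expand
proof (rule degree_sum_le)
  fix p assume "p \<in> {p. p permutes {0..<n}}"
  then have p: "p permutes {0..<n}" by simp
  have "degree (signof p * (\<Prod>i=0..<n. M i (p i))) \<le> degree (\<Prod>i=0..<n. M i (p i))"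
    by (auto simp: sign_def)
  also have "\<dots> \<le> (\<Sum>i=0..<n. degree (M i (p i)))"
    by (rule order.trans[OF degree_prod_sum_le]) auto
  also have "\<dots> \<le> (\<Sum>i<n. e i)"
    using assms permutes_in_image[OF p] by (auto simp: lessThan_atLeast0 intro!: sum_mono)
  finally show "degree (signof p * (\<Prod>i=0..<n. M i (p i))) \<le> (\<Sum>i<n. e i)" .
qed (auto intro: finite_permutations)

lemma poly_fdet: "poly (fdet n M) x = fdet n (\<lambda>i j. poly (M i j) x)"
proof -
  have "poly (signof p) x = signof p" for p :: "nat \<Rightarrow> nat" by (auto simp: sign_def)
  then show ?thesis unfolding fdet_expand by (simp add: poly_sum poly_prod)
qed

lemma fdet_transpose: "fdet n (\<lambda>i j. M j i) = fdet n M"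
proof -
  have "Matrix.mat n n (\<lambda>(i, j). M j i) = transpose_mat (Matrix.mat n n (\<lambda>(i, j). M i j))"
    by (intro eq_matI) auto
  then show ?thesis unfolding fdet_def using Determinant.det_transpose by (metis mat_carrier)
qed

lemma polyfun_fdet:
  assumes "\<And>i j. i < n \<Longrightarrow> j < n \<Longrightarrow> polyfun G (\<lambda>x. M x i j)"
  shows "polyfun G (\<lambda>x. fdet n (M x))"
  unfolding fdet_expand
proof (intro polyfun_intros)
  fix p i assume "p \<in> {p. p permutes {0..<n}}" and "i \<in> {0..<n}"
  then show "polyfun G (\<lambda>x. M x i (p i))" using assms permutes_in_image[of p "{0..<n}" i] by auto
qed

section \<open>The degree bound for a nondegenerate frame\<close>

text \<open>Cramer's rule with column 0 on the right-hand side gives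
  \<open>b (Suc \<kappa>) * \<Delta> = b 0 * N \<kappa>\<close>. After cancelling the gcd of
  \<open>b 0\<close> and \<open>\<Delta>\<close>, the remaining factor \<open>b'\<close> of
  \<open>b 0\<close> divides every \<open>b j\<close>, so it is constant. Hence the degrees of
  \<open>b 0\<close> and \<open>b (Suc \<kappa>)\<close> are at most those of
  \<open>\<Delta>\<close> and \<open>N \<kappa>\<close>, which are bounded by the sum of the row
  degrees.\<close>

lemma degree_kernel_le:
  fixes b :: "nat \<Rightarrow> complex poly" and M :: "nat \<Rightarrow> nat \<Rightarrow> complex poly"
  assumes deg: "\<And>i j. i < k \<Longrightarrow> j \<le> k \<Longrightarrow> degree (M i j) \<le> Suc i"
    and ker: "\<And>i. i < k \<Longrightarrow> (\<Sum>j\<le>k. M i j * b j) = 0"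
    and det: "fdet k (\<lambda>i j. M i (Suc j)) \<noteq> 0"
    and coprime: "\<And>s. \<exists>j\<le>k. poly (b j) s \<noteq> 0"
    and l: "l \<le> k"
  shows "degree (b l) \<le> (\<Sum>i<k. Suc i)"
proof -
  let ?E = "\<Sum>i<k. Suc i"
  define \<Delta> where "\<Delta> = fdet k (\<lambda>i j. M i (Suc j))"
  define N where "N \<kappa> = fdet k (\<lambda>i j. if j = \<kappa> then - M i 0 else M i (Suc j))" for \<kappa>
  have \<Delta>: "\<Delta> \<noteq> 0" "degree \<Delta> \<le> ?E"
    unfolding \<Delta>_def using det by (auto intro!: degree_fdet_le deg)
  have N: "degree (N \<kappa>) \<le> ?E" for \<kappa>
    unfolding N_def by (intro degree_fdet_le) (auto intro!: deg)
  have eq: "b (Suc \<kappa>) * \<Delta> = b 0 * N \<kappa>" if "\<kappa> < k" for \<kappa>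
  proof -
    have "(\<Sum>j<k. M i (Suc j) * b (Suc j)) = b 0 * (- M i 0)" if "i < k" for i
    proof -
      have "(\<Sum>j\<le>k. M i j * b j) = M i 0 * b 0 + (\<Sum>j<k. M i (Suc j) * b (Suc j))"
        unfolding lessThan_Suc_atMost[symmetric] by (subst sum.lessThan_Suc_shift) simp
      then show ?thesis using ker[OF that] by (simp add: eq_neg_iff_add_eq_0 add.commute mult.commute)
    qed
    from fdet_cramer[OF this that] show ?thesis
      unfolding \<Delta>_def N_def fdet_scale_col[OF that] by simp
  qed
  have b0: "b 0 \<noteq> 0"
  proof
    assume "b 0 = 0"
    then have "b j = 0" if "j \<le> k" for j
      using eq[of "j - 1"] that \<Delta>(1) by (cases j) auto
    then show False using coprime[of 0] by auto
  qed
  define g where "g = gcd (b 0) \<Delta>"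
  have g: "g \<noteq> 0" using b0 by (simp add: g_def)
  obtain b' \<Delta>' where b': "b 0 = g * b'" and \<Delta>': "\<Delta> = g * \<Delta>'" and cop: "coprime b' \<Delta>'"
    using gcd_coprime_exists[of "b 0" \<Delta>] g unfolding g_def by (metis mult.commute)
  have eq': "b (Suc \<kappa>) * \<Delta>' = b' * N \<kappa>" if "\<kappa> < k" for \<kappa>
    using eq[OF that] g by (simp add: b' \<Delta>')
  have "b' dvd b j" if "j \<le> k" for j
  proof (cases j)
    case 0
    then show ?thesis using b' by simp
  next
    case (Suc \<kappa>)
    then have "b' dvd b j * \<Delta>'" using eq'[of \<kappa>] that by simp
    then show ?thesis using cop by (simp add: coprime_dvd_mult_left_iff)
  qed
  then have "poly b' s \<noteq> 0" for s
    using coprime[of s] by (metis dvdE mult_zero_left poly_mult)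
  then have "degree b' = 0"
    using fundamental_theorem_of_algebra[of b'] by (auto simp: constant_degree)
  then obtain c where c: "b' = [:c:]" by (metis degree_eq_zeroE)
  have "c \<noteq> 0" using c b' b0 by auto
  have "\<Delta>' \<noteq> 0" using \<Delta>' \<Delta>(1) by auto
  show ?thesis
  proof (cases l)
    case 0
    have "degree (b 0) \<le> degree \<Delta>"
      using g \<open>\<Delta>' \<noteq> 0\<close> \<open>c \<noteq> 0\<close> by (simp add: b' c \<Delta>' degree_mult_eq)
    then show ?thesis using \<Delta>(2) 0 by simp
  next
    case (Suc \<kappa>)
    then have e: "b l * \<Delta>' = Polynomial.smult c (N \<kappa>)" using eq'[of \<kappa>] l by (simp add: c)
    show ?thesis
    proof (cases "b l = 0")
      case False
      then have "degree (b l) \<le> degree (b l * \<Delta>')" using \<open>\<Delta>' \<noteq> 0\<close> by (simp add: degree_mult_eq)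
      also have "\<dots> \<le> ?E" unfolding e using N[of \<kappa>] by (auto intro: order.trans[OF degree_smult_le])
      finally show ?thesis .
    qed simp
  qed
qed

text \<open>The combination of \<open>v\<close> and \<open>c\<close> that cancels the
  \<open>None\<close> components has as its Lorentz square a genuine sum of squares; the three
  relations make this sum vanish.\<close>

lemma lorentz_null_parallel:
  fixes v c :: "'m::finite option \<Rightarrow> complex"
  assumes null: "(\<Sum>l\<in>UNIV. c (Some l) * cnj (c (Some l))) = c None * cnj (c None)"
    and v: "(\<Sum>l\<in>UNIV. v (Some l) * cnj (v (Some l))) = v None * cnj (v None)"
    and vc: "(\<Sum>l\<in>UNIV. v (Some l) * cnj (c (Some l))) = v None * cnj (c None)"
  shows "c None * v i = v None * c i"
proof (cases i)
  case (Some k)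
  define w where "w l = c None * v (Some l) - v None * c (Some l)" for l
  have cv: "(\<Sum>l\<in>UNIV. c (Some l) * cnj (v (Some l))) = c None * cnj (v None)"
    using arg_cong[OF vc, of cnj] by (simp add: mult.commute)
  have "(\<Sum>l\<in>UNIV. w l * cnj (w l)) =
      c None * cnj (c None) * (\<Sum>l\<in>UNIV. v (Some l) * cnj (v (Some l)))
      - c None * cnj (v None) * (\<Sum>l\<in>UNIV. v (Some l) * cnj (c (Some l)))
      - v None * cnj (c None) * (\<Sum>l\<in>UNIV. c (Some l) * cnj (v (Some l)))
      + v None * cnj (v None) * (\<Sum>l\<in>UNIV. c (Some l) * cnj (c (Some l)))"
    unfolding w_def sum_distrib_left sum_subtractf[symmetric] sum.distrib[symmetric]
    by (intro sum.cong) (auto simp: algebra_simps)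
  also have "\<dots> = 0" unfolding null v vc cv by (simp add: algebra_simps)
  finally have "(\<Sum>l\<in>UNIV. complex_of_real ((cmod (w l))\<^sup>2)) = 0"
    by (simp add: complex_norm_square del: of_real_power)
  then have "(\<Sum>l\<in>UNIV. (cmod (w l))\<^sup>2) = 0"
    by (simp only: of_real_sum[symmetric] of_real_eq_0_iff)
  then have "w k = 0" by (subst (asm) sum_nonneg_eq_0_iff) auto
  then show ?thesis by (simp add: w_def Some)
qed simp


text \<open>\<open>C j\<close> stands for the j-th Taylor coefficient on the dual line of the moving
  point, \<open>B\<close> for the conjugated map at that point, and \<open>\<psi>\<close> for
  functionals dual to the vectors \<open>c 0\<close>, ..., \<open>c (r - 1)\<close>, which span all
  \<open>c j\<close>.\<close>

lemma frame_degree_bound: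
  fixes C :: "nat \<Rightarrow> 'm::finite option \<Rightarrow> complex poly" and B :: "'m option \<Rightarrow> complex poly"
    and \<psi> :: "nat \<Rightarrow> 'm option \<Rightarrow> complex"
  defines "c \<equiv> \<lambda>j i. poly (C j i) 0"
  assumes deg: "\<And>j i. degree (C j i) \<le> j"
    and B: "\<And>i j. coeff (B i) j = cnj (c j i)"
    and orth: "\<And>j. (\<Sum>l\<in>UNIV. C j (Some l) * B (Some l)) = C j None * B None"
    and prim: "\<And>s. \<exists>i. poly (B i) s \<noteq> 0"
    and top: "coeff (B i0) m \<noteq> 0"
    and dual: "\<And>i j. i < r \<Longrightarrow> j < r \<Longrightarrow> (\<Sum>l\<in>UNIV. \<psi> i l * c j l) = (if i = j then 1 else 0)"
    and span: "\<And>j l. c j l = (\<Sum>i<r. (\<Sum>k\<in>UNIV. \<psi> i k * c j k) * c i l)"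
  shows "r \<le> CARD('m) \<and> m \<le> (\<Sum>i<r - 1. Suc i)"
proof -
  have "r \<noteq> 0"
  proof
    assume "r = 0"
    then have "c j l = 0" for j l using span[of j l] by simp
    then have "B i = 0" for i by (intro poly_eqI) (simp add: B)
    then show False using prim by auto
  qed
  then obtain k where r: "r = Suc k" by (cases r) auto
  \<comment> \<open>The coordinates of \<open>B\<close> with respect to the conjugates of the
    \<open>c j\<close>; see \<open>B_b\<close>.\<close>
  define b where "b i = (\<Sum>l\<in>UNIV. Polynomial.smult (cnj (\<psi> i l)) (B l))" for i
  have coeff_b: "coeff (b i) j = cnj (\<Sum>l\<in>UNIV. \<psi> i l * c j l)" for i j
    by (simp add: b_def coeff_sum B)
  have B_b: "B l = (\<Sum>j\<le>k. Polynomial.smult (cnj (c j l)) (b j))" for l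
  proof (rule poly_eqI)
    fix n
    show "coeff (B l) n = coeff (\<Sum>j\<le>k. Polynomial.smult (cnj (c j l)) (b j)) n"
      unfolding B coeff_sum coeff_smult coeff_b
      by (subst span) (simp add: r lessThan_Suc_atMost mult.commute)
  qed
  \<comment> \<open>\<open>M i j\<close> is the coefficient of \<open>b j\<close> in the equation
    given by \<open>C (Suc i)\<close>. The shift leaves out \<open>C 0\<close>: it is constant,
    equal to \<open>c 0\<close>, and its equation is trivial because \<open>c 0\<close> is
    orthogonal to every \<open>c j\<close>.\<close>
  define M where "M i j = (\<Sum>l\<in>UNIV. Polynomial.smult (cnj (c j (Some l))) (C (Suc i) (Some l)))
    - Polynomial.smult (cnj (c j None)) (C (Suc i) None)" for i j
  have poly_B0: "poly (B i) 0 = cnj (poly (C 0 i) 0)" for i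
    using B[of i 0] by (simp add: poly_0_coeff_0 c_def)
  have orth0: "(\<Sum>l\<in>UNIV. c j (Some l) * cnj (c 0 (Some l))) = c j None * cnj (c 0 None)" for j
    using arg_cong[OF orth[of j], of "\<lambda>p. poly p 0"]
    by (simp add: poly_sum c_def poly_B0)
  have c0None: "c 0 None \<noteq> 0"
  proof
    assume *: "c 0 None = 0"
    have "(\<Sum>l\<in>UNIV. complex_of_real ((cmod (c 0 (Some l)))\<^sup>2)) = 0"
      using orth0[of 0] * by (simp add: complex_norm_square del: of_real_power)
    then have "(\<Sum>l\<in>UNIV. (cmod (c 0 (Some l)))\<^sup>2) = 0"
      by (simp only: of_real_sum[symmetric] of_real_eq_0_iff)
    then have "c 0 (Some l) = 0" for l by (subst (asm) sum_nonneg_eq_0_iff) auto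
    then have "c 0 l = 0" for l using * by (cases l) auto
    then show False using dual[of 0 0] r by simp
  qed
  have indep: "x j = 0" if "\<And>l. (\<Sum>i<r. x i * c i l) = 0" "j < r" for x :: "nat \<Rightarrow> complex" and j
  proof -
    have "0 = (\<Sum>l\<in>UNIV. \<psi> j l * (\<Sum>i<r. x i * c i l))" using that by simp
    also have "\<dots> = (\<Sum>i<r. x i * (\<Sum>l\<in>UNIV. \<psi> j l * c i l))"
      unfolding sum_distrib_left by (subst sum.swap) (simp add: mult_ac)
    also have "\<dots> = (\<Sum>i<r. if i = j then x i else 0)"
      using that(2) by (intro sum.cong) (auto simp: dual)
    finally show ?thesis using that(2) by simp
  qed
  \<comment> \<open>All \<open>c j\<close> are orthogonal to \<open>c 0\<close>, whose
    \<open>None\<close> component is nonzero. A combination of them whose \<open>Some\<close>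
    components vanish is therefore zero.\<close>
  have "r \<le> CARD('m)"
  proof (rule ccontr)
    assume "\<not> r \<le> CARD('m)"
    then have N: "CARD('m) < r" by simp
    obtain f where f: "bij_betw f {0..<CARD('m)} (UNIV :: 'm set)"
      using ex_bij_betw_nat_finite[of "UNIV :: 'm set"] by auto
    define Q where "Q i j = (if i < CARD('m) then c j (Some (f i)) else 0)" for i j
    have "fdet r Q = 0"
      by (rule fdet_zero_row[OF N]) (simp add: Q_def)
    then obtain x where x: "\<exists>j<r. x j \<noteq> 0" and kx: "\<And>i. i < r \<Longrightarrow> (\<Sum>j<r. Q i j * x j) = 0"
      using fdet_eq_0_imp_kernel by blast
    have "(\<Sum>j<r. c j (Some (f i)) * x j) = 0" if "i < CARD('m)" for i
      using kx[of i] that N by (simp add: Q_def)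
    then have xi: "(\<Sum>j<r. x j * c j (Some (f i))) = 0" if "i < CARD('m)" for i
      using that by (simp add: mult.commute)
    have xS: "(\<Sum>j<r. x j * c j (Some l)) = 0" for l
    proof -
      have "l \<in> f ` {0..<CARD('m)}" using bij_betw_imp_surj_on[OF f] by simp
      then show ?thesis using xi by auto
    qed
    have "(\<Sum>j<r. x j * c j None) * cnj (c 0 None) = (\<Sum>j<r. x j * (\<Sum>l\<in>UNIV. c j (Some l) * cnj (c 0 (Some l))))"
      unfolding orth0 sum_distrib_right by (simp add: mult_ac)
    also have "\<dots> = (\<Sum>l\<in>UNIV. (\<Sum>j<r. x j * c j (Some l)) * cnj (c 0 (Some l)))"
      unfolding sum_distrib_left sum_distrib_right by (subst sum.swap) (simp add: mult_ac)
    also have "\<dots> = 0" by (simp add: xS)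
    finally have "(\<Sum>j<r. x j * c j None) = 0" using c0None by simp
    then have "(\<Sum>j<r. x j * c j l) = 0" for l using xS by (cases l) auto
    then show False using indep x by blast
  qed
  moreover have "m \<le> (\<Sum>i<k. Suc i)"
  proof -
    have M0: "poly (M i j) 0 = (\<Sum>l\<in>UNIV. c (Suc i) (Some l) * cnj (c j (Some l))) - c (Suc i) None * cnj (c j None)" for i j
      by (simp add: M_def c_def poly_sum mult.commute)
    have degM: "degree (M i j) \<le> Suc i" for i j
      unfolding M_def
      by (intro degree_diff_le degree_sum_le) (auto intro: deg)
    have kerM: "(\<Sum>j\<le>k. M i j * b j) = 0" for i
    proof -
      have "(\<Sum>j\<le>k. M i j * b j) = (\<Sum>l\<in>UNIV. C (Suc i) (Some l) * (\<Sum>j\<le>k. Polynomial.smult (cnj (c j (Some l))) (b j)))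
          - C (Suc i) None * (\<Sum>j\<le>k. Polynomial.smult (cnj (c j None)) (b j))"
        unfolding M_def sum_distrib_left left_diff_distrib sum_subtractf sum_distrib_right
        by (subst sum.swap) (simp add: mult_ac)
      then show ?thesis unfolding B_b[symmetric] orth by simp
    qed
    \<comment> \<open>At 0 the entries are the Lorentz products of \<open>c 1\<close>, ...,
      \<open>c k\<close>. A kernel vector yields \<open>v\<close> in their span that is orthogonal
      to all of them and to \<open>c 0\<close>, hence null and parallel to \<open>c 0\<close>,
      contradicting linear independence.\<close>
    have "fdet k (\<lambda>i j. M i (Suc j)) \<noteq> 0"
    proof
      assume "fdet k (\<lambda>i j. M i (Suc j)) = 0"
      then have "fdet k (\<lambda>i j. poly (M j (Suc i)) 0) = 0"
        using fdet_transpose[of k "\<lambda>i j. M i (Suc j)"] unfolding poly_fdet[symmetric] by simp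
      then obtain y where y: "\<exists>j<k. y j \<noteq> 0"
        and ky: "\<And>i. i < k \<Longrightarrow> (\<Sum>j<k. poly (M j (Suc i)) 0 * y j) = 0"
        using fdet_eq_0_imp_kernel by blast
      define v where "v l = (\<Sum>j<k. y j * c (Suc j) l)" for l
      define H where "H u w = (\<Sum>l\<in>UNIV. u (Some l) * cnj (w (Some l))) - u None * cnj (w None)"
        for u w :: "'m option \<Rightarrow> complex"
      have Hv: "H v w = (\<Sum>j<k. y j * H (c (Suc j)) w)" for w
        unfolding H_def v_def right_diff_distrib sum_subtractf sum_distrib_left sum_distrib_right
        by (subst sum.swap) (simp add: mult_ac)
      have vc: "H v (c (Suc i)) = 0" if "i < k" for i
      proof -
        have "poly (M j (Suc i)) 0 = H (c (Suc j)) (c (Suc i))" for j by (simp add: M0 H_def)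
        then show ?thesis using ky[OF that] unfolding Hv by (simp add: mult.commute)
      qed
      have v0: "H v (c 0) = 0" unfolding Hv by (simp add: H_def orth0)
      have Hv2: "H u v = (\<Sum>j<k. cnj (y j) * H u (c (Suc j)))" for u
        unfolding H_def v_def right_diff_distrib sum_subtractf sum_distrib_left sum_distrib_right cnj_sum
        by (subst sum.swap) (simp add: mult_ac)
      have vv: "H v v = 0" unfolding Hv2 by (simp add: vc)
      have par: "c 0 None * v i = v None * c 0 i" for i
        by (rule lorentz_null_parallel) (use v0 vv orth0[of 0] in \<open>auto simp: H_def\<close>)
      define z where "z j = (case j of 0 \<Rightarrow> - v None | Suc i \<Rightarrow> c 0 None * y i)" for j
      have "(\<Sum>i<r. z i * c i l) = 0" for l
        unfolding r sum.lessThan_Suc_shift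
        using par[of l] by (simp add: z_def v_def sum_distrib_left mult_ac)
      then have "z (Suc j) = 0" if "j < k" for j using indep[of z "Suc j"] that r by auto
      then show False using y c0None by (auto simp: z_def)
    qed
    moreover have "\<exists>j\<le>k. poly (b j) s \<noteq> 0" for s
    proof (rule ccontr)
      assume "\<not> ?thesis"
      then have "poly (B l) s = 0" for l unfolding B_b poly_sum by simp
      then show False using prim by blast
    qed
    ultimately have bound: "degree (b l) \<le> (\<Sum>i<k. Suc i)" if "l \<le> k" for l
      using degree_kernel_le[of k M b l] degM kerM that by blast
    have "\<exists>j\<le>k. coeff (b j) m \<noteq> 0"
    proof (rule ccontr)
      assume "\<not> ?thesis"
      then have "coeff (B i0) m = 0" unfolding B_b coeff_sum by simp
      then show False using top by blast
    qed
    then show ?thesis using bound by (meson le_degree order.trans)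
  qed
  ultimately show ?thesis using r by simp
qed

text \<open>Bordering \<open>M\<close> by the column \<open>- b\<close> and a zero row gives a
  singular matrix. The last entry of a kernel vector is nonzero, since \<open>M\<close> has trivial
  kernel, and can be scaled to 1.\<close>

lemma fdet_solvable:
  fixes M :: "nat \<Rightarrow> nat \<Rightarrow> 'a::field"
  assumes "fdet n M \<noteq> 0"
  shows "\<exists>x. \<forall>i<n. (\<Sum>j<n. M i j * x j) = b i"
proof -
  define Q where "Q i j = (if i = n then 0 else if j = n then - b i else M i j)" for i j
  have "fdet (Suc n) Q = 0" by (rule fdet_zero_row[of n]) (auto simp: Q_def)
  then obtain x where x: "\<exists>j<Suc n. x j \<noteq> 0" and kx: "\<And>i. i < Suc n \<Longrightarrow> (\<Sum>j<Suc n. Q i j * x j) = 0"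
    using fdet_eq_0_imp_kernel by blast
  have eq: "(\<Sum>j<n. M i j * x j) = b i * x n" if "i < n" for i
    using kx[of i] that by (simp add: Q_def)
  have "x n \<noteq> 0"
  proof
    assume "x n = 0"
    then have "x k = 0" if "k < n" for k
      using fdet_nonzero_imp_trivial_kernel[OF assms, of x k] eq that by simp
    with \<open>x n = 0\<close> x show False by (auto simp: less_Suc_eq)
  qed
  then have "(\<Sum>j<n. M i j * (x j / x n)) = b i" if "i < n" for i
    using eq[OF that] by (simp add: sum_divide_distrib[symmetric])
  then show ?thesis by (intro exI[of _ "\<lambda>j. x j / x n"]) blast
qed

section \<open>Order of vanishing along a line\<close>

definition taylor_coeff :: "complex poly \<Rightarrow> nat \<Rightarrow> complex poly" where
  "taylor_coeff g j = Polynomial.smult (1 / fact j) ((pderiv ^^ j) g)"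

lemma poly_taylor_coeff: "poly (taylor_coeff g j) s = coeff (pcompose g [:s, 1:]) j"
proof -
  have "(pderiv ^^ j) (pcompose g [:s, 1:]) = pcompose ((pderiv ^^ j) g) [:s, 1:]"
    by (induction j) (simp_all add: pderiv_pcompose pderiv_pCons)
  then have "poly ((pderiv ^^ j) g) s = poly ((pderiv ^^ j) (pcompose g [:s, 1:])) 0"
    by (simp add: poly_pcompose)
  also have "\<dots> = fact j * coeff (pcompose g [:s, 1:]) j"
    by (simp add: poly_0_coeff_0 coeff_higher_pderiv pochhammer_fact)
  finally show ?thesis by (simp add: taylor_coeff_def)
qed

lemma coeff_taylor_coeff:
  "coeff (taylor_coeff g j) k = pochhammer (of_nat (Suc k)) j / fact j * coeff g (k + j)"
  by (simp add: taylor_coeff_def coeff_higher_pderiv)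

text \<open>Uniqueness for a linear differential equation of order \<open>r\<close> that is regular
  at 0. If \<open>g\<close> vanished to finite order \<open>n\<close>, then
  \<open>n \<ge> r\<close>, the left side would have order exactly \<open>n - r\<close>, and every
  term on the right a larger order.\<close>

lemma taylor_coeff_recurrence_imp_0:
  assumes eq: "W * taylor_coeff g r = (\<Sum>j<r. A j * taylor_coeff g j)"
    and W: "poly W 0 \<noteq> 0" and low: "\<And>j. j < r \<Longrightarrow> coeff g j = 0"
  shows "g = 0"
proof (rule ccontr)
  assume "g \<noteq> 0"
  then have "\<exists>n. coeff g n \<noteq> 0" by (auto simp: poly_eq_iff)
  define n where "n = (LEAST n. coeff g n \<noteq> 0)"
  have n: "coeff g n \<noteq> 0" "\<And>k. k < n \<Longrightarrow> coeff g k = 0"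
    unfolding n_def using LeastI_ex[OF \<open>\<exists>n. coeff g n \<noteq> 0\<close>] not_less_Least by blast+
  have r: "r \<le> n" using n(1) low not_less by blast
  have "coeff (W * taylor_coeff g r) (n - r) = (\<Sum>i\<le>n - r. coeff W i * coeff (taylor_coeff g r) (n - r - i))"
    by (rule coeff_mult)
  also have "\<dots> = (\<Sum>i\<le>n - r. if i = 0 then coeff W 0 * coeff (taylor_coeff g r) (n - r) else 0)"
    using r by (intro sum.cong refl) (auto simp: coeff_taylor_coeff intro!: n(2))
  also have "\<dots> = coeff W 0 * coeff (taylor_coeff g r) (n - r)" by simp
  finally have lead: "coeff (W * taylor_coeff g r) (n - r) = coeff W 0 * coeff (taylor_coeff g r) (n - r)" .
  have "pochhammer (Suc (n - r)) r \<noteq> 0" using pochhammer_pos[of "Suc (n - r)" r] by simp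
  then have "pochhammer (of_nat (Suc (n - r)) :: complex) r \<noteq> 0"
    unfolding pochhammer_of_nat of_nat_eq_0_iff .
  then have "coeff (W * taylor_coeff g r) (n - r) \<noteq> 0"
    unfolding lead coeff_taylor_coeff using n(1) W r by (simp add: poly_0_coeff_0 del: of_nat_Suc)
  moreover have "coeff (A j * taylor_coeff g j) (n - r) = 0" if "j < r" for j
    using that r unfolding coeff_mult by (intro sum.neutral) (auto simp: coeff_taylor_coeff intro!: n(2))
  ultimately show False unfolding eq by (simp add: coeff_sum)
qed

text \<open>A kernel vector of the large matrix has nonzero last entry because the block of size
  \<open>r\<close> is nonsingular. Cramer's rule for this block clears the denominators with the
  factor \<open>fdet r L\<close> itself, whose value at the base point is known to be nonzero when
  the lemma is applied.\<close>

lemma rank_recurrence: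
  fixes L :: "nat \<Rightarrow> nat \<Rightarrow> complex poly"
  assumes 0: "fdet (Suc r) L = 0" and W: "fdet r L \<noteq> 0"
  shows "\<exists>A. fdet r L * L r r = (\<Sum>j<r. A j * L r j)"
proof -
  obtain x where x: "\<exists>j<Suc r. x j \<noteq> 0" and kx: "\<And>i. i < Suc r \<Longrightarrow> (\<Sum>j<Suc r. L i j * x j) = 0"
    using fdet_eq_0_imp_kernel[OF 0] by blast
  have eq: "(\<Sum>j<r. L i j * x j) = x r * (- L i r)" if "i < Suc r" for i
    using kx[OF that] by (simp add: eq_neg_iff_add_eq_0 mult.commute)
  define A where "A k = fdet r (\<lambda>i j. if j = k then - L i r else L i j)" for k
  have A: "x k * fdet r L = x r * A k" if "k < r" for k
  proof -
    have "fdet r (\<lambda>i j. if j = k then x r * (- L i r) else L i j) = x k * fdet r L"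
      using eq that by (intro fdet_cramer) auto
    then show ?thesis unfolding A_def fdet_scale_col[OF that] by simp
  qed
  have xr: "x r \<noteq> 0"
  proof
    assume "x r = 0"
    then have "x k = 0" if "k < r" for k using A[OF that] W by simp
    with \<open>x r = 0\<close> x show False by (auto simp: less_Suc_eq)
  qed
  have "x r * (fdet r L * (- L r r)) = (\<Sum>j<r. L r j * x j) * fdet r L"
    using eq[of r] by (simp add: mult_ac)
  also have "\<dots> = (\<Sum>j<r. L r j * (x j * fdet r L))"
    unfolding sum_distrib_right by (simp add: mult_ac)
  also have "\<dots> = x r * (\<Sum>j<r. A j * L r j)"
    unfolding sum_distrib_left by (intro sum.cong) (auto simp: A mult_ac)
  finally have "fdet r L * (- L r r) = (\<Sum>j<r. A j * L r j)"
    using xr by (simp only: mult_cancel_left) simp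
  then have "fdet r L * L r r = (\<Sum>j<r. - A j * L r j)"
    unfolding mult_minus_left sum_negf by (metis add.inverse_inverse mult_minus_right)
  then show ?thesis by (intro exI[of _ "\<lambda>j. - A j"])
qed

section \<open>Polynomials on Heisenberg lines\<close>

text \<open>Here \<open>r\<close> is \<open>p\<close> seen in the chart at infinity; the top
  coefficient of \<open>p\<close> is the value of the homogeneous form at the point at
  infinity.\<close>

lemma rev_coeff:
  fixes p r :: "complex poly"
  assumes "\<And>s. s \<noteq> 0 \<Longrightarrow> s ^ m * poly p (1 / s) = poly r s"
  shows "degree p \<le> m \<and> coeff p m = poly r 0"
proof -
  have rev: "poly (reflect_poly p) s = s ^ degree p * poly p (1 / s)" if "s \<noteq> 0" for s
    using poly_reflect_poly_nz[OF that, of p] by (simp add: inverse_eq_divide)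
  have ext: "p = q" if "\<And>s. s \<noteq> 0 \<Longrightarrow> poly p s = poly q s" for p q :: "complex poly"
  proof -
    have "(p - q) * [:0, 1:] = 0"
      using that by (subst poly_all_0_iff_0[symmetric]) auto
    then show ?thesis by simp
  qed
  have deg: "degree p \<le> m"
  proof (rule ccontr)
    assume c: "\<not> degree p \<le> m"
    have "monom 1 (degree p - m) * r = reflect_poly p"
    proof (rule ext)
      fix s :: complex assume s: "s \<noteq> 0"
      have "s ^ (degree p - m) * (s ^ m * poly p (1 / s)) = s ^ degree p * poly p (1 / s)"
        using c by (simp add: power_add[symmetric] flip: mult.assoc)
      then show "poly (monom 1 (degree p - m) * r) s = poly (reflect_poly p) s"
        using assms[OF s] rev[OF s] by (simp add: poly_monom)
    qed
    moreover have "coeff (monom 1 (degree p - m) * r) 0 = 0"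
      using c by (subst coeff_monom_mult) auto
    ultimately have "coeff (reflect_poly p) 0 = 0" by simp
    then have "p = 0" by simp
    then show False using c by simp
  qed
  have "monom 1 (m - degree p) * reflect_poly p = r"
  proof (rule ext)
    fix s :: complex assume s: "s \<noteq> 0"
    have "s ^ (m - degree p) * (s ^ degree p * poly p (1 / s)) = s ^ m * poly p (1 / s)"
      using deg by (simp add: power_add[symmetric] flip: mult.assoc)
    then show "poly (monom 1 (m - degree p) * reflect_poly p) s = poly r s"
      using assms[OF s] rev[OF s] by (simp add: poly_monom)
  qed
  then have "poly r 0 = coeff (monom 1 (m - degree p) * reflect_poly p) 0" by (simp add: poly_0_coeff_0)
  also have "\<dots> = coeff p m"
    using deg by (auto simp: coeff_monom_mult coeff_eq_0)
  finally show ?thesis using deg by simp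
qed

lemma poly_poly_eq_poly_map: "poly (poly P [:\<tau>:]) \<sigma> = poly (map_poly (\<lambda>q. poly q \<sigma>) P) \<tau>"
  by (induction P) (auto simp: map_poly_pCons)

text \<open>A monomial with exponents i and j becomes \<open>\<tau>\<close> to the power i + j times
  \<open>\<sigma>\<close> to the power j. This is the origin of the degrees 1, 2, ... of the linear
  equations.\<close>

lemma polyfun2_blowup:
  assumes "polyfun gens2 f"
  shows "\<exists>P. (\<forall>j. degree (coeff P j) \<le> j) \<and> (\<forall>\<tau> \<sigma>. f (\<tau>, \<tau> * \<sigma>) = poly (poly P [:\<tau>:]) \<sigma>)"
  using assms
proof induction
  case (polyfun_const c)
  show ?case by (intro exI[of _ "[:[:c:]:]"]) (auto simp: coeff_pCons split: nat.splits)
next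
  case (polyfun_gen g)
  then consider "g = fst" | "g = snd" by (auto simp: ext_gens_def)
  then show ?case
  proof cases
    case 1
    then show ?thesis by (intro exI[of _ "[:0, [:1:]:]"]) (auto simp: coeff_pCons split: nat.splits)
  next
    case 2
    then show ?thesis by (intro exI[of _ "[:0, [:0, 1:]:]"]) (auto simp: coeff_pCons split: nat.splits)
  qed
next
  case (polyfun_add f g)
  then obtain P Q where
    "\<And>j. degree (coeff P j) \<le> j" "\<And>j. degree (coeff Q j) \<le> j"
    "\<And>\<tau> \<sigma>. f (\<tau>, \<tau> * \<sigma>) = poly (poly P [:\<tau>:]) \<sigma>" "\<And>\<tau> \<sigma>. g (\<tau>, \<tau> * \<sigma>) = poly (poly Q [:\<tau>:]) \<sigma>"
    by metis
  then show ?case by (intro exI[of _ "P + Q"]) (auto intro: degree_add_le)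
next
  case (polyfun_mult f g)
  then obtain P Q where PQ:
    "\<And>j. degree (coeff P j) \<le> j" "\<And>j. degree (coeff Q j) \<le> j"
    "\<And>\<tau> \<sigma>. f (\<tau>, \<tau> * \<sigma>) = poly (poly P [:\<tau>:]) \<sigma>" "\<And>\<tau> \<sigma>. g (\<tau>, \<tau> * \<sigma>) = poly (poly Q [:\<tau>:]) \<sigma>"
    by metis
  have "degree (coeff (P * Q) j) \<le> j" for j
    unfolding coeff_mult
  proof (rule degree_sum_le)
    fix i assume "i \<in> {..j}"
    then show "degree (coeff P i * coeff Q (j - i)) \<le> j"
      using degree_mult_le[of "coeff P i" "coeff Q (j - i)"] PQ(1)[of i] PQ(2)[of "j - i"] by simp
  qed simp
  then show ?case using PQ(3,4) by (intro exI[of _ "P * Q"]) auto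
qed

section \<open>Polynomial sphere maps in two variables\<close>

text \<open>The numerators sit at \<open>Some\<close> and the denominator at \<open>None\<close>, so
  \<open>null\<close> says that null vectors go to Lorentz null vectors. The points
  \<open>(2 * r, - s, s)\<close> form the projective tangent line at \<open>(0, - 1, 1)\<close>;
  \<open>nz\<close> excludes common zeros there, including the point at infinity
  \<open>s = 0\<close>.\<close>

locale sphere_map =
  fixes \<Phi> :: "complex \<times> complex \<times> complex \<Rightarrow> 'm::finite option \<Rightarrow> complex" and m :: nat
  assumes pf: "polyfun gens3 (\<lambda>x. \<Phi> x i)"
    and hom: "\<Phi> (c * z, c * w, c * t) i = c ^ m * \<Phi> (z, w, t) i"
    and null: "z * cnj z + w * cnj w = t * cnj t \<Longrightarrow>
      (\<Sum>l\<in>UNIV. \<Phi> (z, w, t) (Some l) * cnj (\<Phi> (z, w, t) (Some l))) =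
        \<Phi> (z, w, t) None * cnj (\<Phi> (z, w, t) None)"
    and nz: "(r, s) \<noteq> (0, 0) \<Longrightarrow> \<exists>i. \<Phi> (2 * r, - s, s) i \<noteq> 0"
begin

text \<open>The homogeneous coordinates \<open>(2a, b - 1, b + 1)\<close> turn the sphere into the Heisenberg
  hypersurface \<open>Re b = \<bar>a\<bar>\<^sup>2\<close>.\<close>

definition \<phi> :: "complex \<Rightarrow> complex \<Rightarrow> 'm option \<Rightarrow> complex" where
  "\<phi> a b = \<Phi> (2 * a, b - 1, b + 1)"

lemma polyfun_\<phi>: "polyfun G a \<Longrightarrow> polyfun G b \<Longrightarrow> polyfun G (\<lambda>x. \<phi> (a x) (b x) i)"
  unfolding \<phi>_def by (rule polyfun_compose3[OF pf]) (auto intro: polyfun_intros)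

lemma \<phi>_null:
  assumes "b + cnj b = 2 * a * cnj a"
  shows "(\<Sum>l\<in>UNIV. \<phi> a b (Some l) * cnj (\<phi> a b (Some l))) = \<phi> a b None * cnj (\<phi> a b None)"
  unfolding \<phi>_def
proof (rule null)
  have "(b + 1) * cnj (b + 1) - (b - 1) * cnj (b - 1) = 2 * (b + cnj b)" by (simp add: algebra_simps)
  then show "2 * a * cnj (2 * a) + (b - 1) * cnj (b - 1) = (b + 1) * cnj (b + 1)"
    unfolding assms by (simp add: algebra_simps)
qed

text \<open>The points \<open>(a, b)\<close> and \<open>(\<alpha>, \<beta>)\<close> are incident
  when \<open>b + \<beta> = 2 * a * \<alpha>\<close>; setting \<open>b = a * \<alpha> + v\<close>
  and \<open>\<beta> = a * \<alpha> - v\<close> solves this with free parameters. The case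
  \<open>\<alpha> = cnj a\<close> with imaginary \<open>v\<close> is \<open>\<phi>_null\<close>, and
  both sides are polynomial in the parameters.\<close>

lemma polarization:
  "(\<Sum>l\<in>UNIV. \<phi> a (a * \<alpha> + v) (Some l) * cnj (\<phi> (cnj \<alpha>) (cnj (a * \<alpha> - v)) (Some l))) =
    \<phi> a (a * \<alpha> + v) None * cnj (\<phi> (cnj \<alpha>) (cnj (a * \<alpha> - v)) None)"
proof -
  define h where "h a \<alpha> v i = \<phi> a (a * \<alpha> + v) i * cnj (\<phi> (cnj \<alpha>) (cnj (a * \<alpha> - v)) i)" for a \<alpha> v i
  have h: "polyfun G (\<lambda>x. h (a x) (\<alpha> x) (v x) i)"
    if "polyfun G a" "polyfun G \<alpha>" "polyfun G v" for G :: "('z \<Rightarrow> complex) set" and a \<alpha> v i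
  proof -
    have "polyfun gens2 (\<lambda>p. \<phi> (fst p) (snd p) i)" by (intro polyfun_\<phi> polyfun_gens2)
    from polyfun2_cnj[OF this]
    have "polyfun gens2 (\<lambda>p. cnj (\<phi> (cnj (fst p)) (cnj (snd p)) i))" by simp
    from polyfun_compose2[OF this that(2) polyfun_diff[OF polyfun_mult[OF that(1,2)] that(3)]]
    have "polyfun G (\<lambda>x. cnj (\<phi> (cnj (\<alpha> x)) (cnj (a x * \<alpha> x - v x)) i))"
      by simp
    then show ?thesis unfolding h_def by (intro polyfun_mult polyfun_\<phi> polyfun_add that)
  qed
  \<comment> \<open>In these coordinates the points of the hypersurface are exactly the real
    ones.\<close>
  define f where "f = (\<lambda>(x, y, u). (\<Sum>l\<in>UNIV. h (x + \<i> * y) (x - \<i> * y) (\<i> * u) (Some l))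
    - h (x + \<i> * y) (x - \<i> * y) (\<i> * u) None)"
  have "polyfun gens3 f"
    unfolding f_def case_prod_unfold by (intro polyfun_intros h polyfun_gens3)
  then have f0: "f (x, y, u) = 0" for x y u
  proof (rule polyfun3_eq_0)
    show "infinite (range complex_of_real)" "infinite (range complex_of_real)"
      "infinite (range complex_of_real)"
      by (auto simp: inj_of_real infinite_UNIV_char_0 finite_image_iff)
    fix x y u assume "x \<in> range complex_of_real" "y \<in> range complex_of_real" "u \<in> range complex_of_real"
    then obtain x' y' u' where [simp]: "x = of_real x'" "y = of_real y'" "u = of_real u'" by blast
    define a where "a = x + \<i> * y"
    have \<alpha>: "x - \<i> * y = cnj a" by (simp add: a_def)
    have b: "cnj (a * cnj a - \<i> * u) = a * cnj a + \<i> * u" by (simp add: mult.commute)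
    show "f (x, y, u) = 0"
      using \<phi>_null[of "a * cnj a + \<i> * u" a]
      unfolding f_def prod.case \<alpha> a_def[symmetric] h_def b complex_cnj_cnj
      by (simp add: mult.commute)
  qed
  have "f ((a + \<alpha>) / 2, (a - \<alpha>) / (2 * \<i>), v / \<i>) = 0" by (rule f0)
  moreover have "(a + \<alpha>) / 2 + \<i> * ((a - \<alpha>) / (2 * \<i>)) = a" "(a + \<alpha>) / 2 - \<i> * ((a - \<alpha>) / (2 * \<i>)) = \<alpha>"
    "\<i> * (v / \<i>) = v"
    by (simp_all add: field_simps)
  ultimately have "(\<Sum>l\<in>UNIV. h a \<alpha> v (Some l)) - h a \<alpha> v None = 0"
    unfolding f_def prod.case by (simp only:)
  then show ?thesis by (simp add: h_def)
qed

text \<open>By homogeneity \<open>(r, s)\<close> may be taken on the unit sphere, so compactness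
  carries \<open>nz\<close> over to all lines close to the given one. For \<open>s = 1\<close> the
  argument represents the point of the line with parameter \<open>r\<close>, and
  \<open>s = 0\<close> is its point at infinity.\<close>

lemma nonvanishing_nearby:
  "\<exists>\<delta>>0. \<forall>a \<alpha> v r s. norm (a, \<alpha>, v) < \<delta> \<longrightarrow> (r, s) \<noteq> (0, 0) \<longrightarrow>
    (\<exists>i. \<Phi> (2 * (a * s + r), (a * \<alpha> + v - 1) * s + 2 * \<alpha> * r, (a * \<alpha> + v + 1) * s + 2 * \<alpha> * r) i \<noteq> 0)"
proof -
  define L :: "(complex \<times> complex \<times> complex) \<times> complex \<times> complex \<Rightarrow> complex \<times> complex \<times> complex"
    where "L = (\<lambda>((a, \<alpha>, v), r, s). (2 * (a * s + r), (a * \<alpha> + v - 1) * s + 2 * \<alpha> * r, (a * \<alpha> + v + 1) * s + 2 * \<alpha> * r))"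
  define Z where "Z = (cball 0 1 \<times> sphere 0 1) \<inter> {x. \<forall>i. \<Phi> (L x) i = 0}"
  have cont: "continuous_on UNIV (\<lambda>x. \<Phi> (L x) i)" for i
  proof -
    have "continuous_on UNIV (\<lambda>x. \<Phi> x i)"
      by (rule polyfun_continuous[OF pf]) (auto simp: ext_gens_def intro!: continuous_intros)
    moreover have "continuous_on UNIV L"
      unfolding L_def case_prod_unfold by (intro continuous_intros)
    ultimately show ?thesis by (rule continuous_on_compose2) auto
  qed
  have "closed {x. \<forall>i. \<Phi> (L x) i = 0}"
    by (intro closed_Collect_all closed_Collect_eq cont continuous_on_const)
  then have "compact Z" unfolding Z_def by (intro compact_Int_closed compact_Times) auto
  then have "closed (fst ` Z)"
    by (intro compact_imp_closed compact_continuous_image continuous_on_fst continuous_on_id)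
  moreover have "0 \<notin> fst ` Z"
  proof
    assume "0 \<in> fst ` Z"
    then obtain r s where rs: "((0, 0, 0), r, s) \<in> Z" by (auto simp: zero_prod_def)
    then have "(r, s) \<noteq> (0, 0)" by (auto simp: Z_def zero_prod_def[symmetric])
    then show False using nz[of r s] rs by (auto simp: Z_def L_def)
  qed
  ultimately obtain \<epsilon> where e: "\<epsilon> > 0" "ball 0 \<epsilon> \<subseteq> - (fst ` Z)"
    by (metis open_Compl ComplI open_contains_ball)
  show ?thesis
  proof (intro exI[of _ "min \<epsilon> 1"] conjI allI impI)
    fix a \<alpha> v r s :: complex
    assume n: "norm (a, \<alpha>, v) < min \<epsilon> 1" and rs: "(r, s) \<noteq> (0, 0)"
    define c where "c = complex_of_real (1 / norm (r, s))"
    have "(c * r, c * s) = (1 / norm (r, s)) *\<^sub>R (r, s)"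
      by (simp add: c_def scaleR_conv_of_real)
    then have "norm (c * r, c * s) = 1" using rs by (simp add: zero_prod_def del: scaleR_Pair)
    moreover have "((a, \<alpha>, v), c * r, c * s) \<notin> Z"
      using e(2) n by (force simp: subset_iff)
    ultimately obtain i where "\<Phi> (L ((a, \<alpha>, v), c * r, c * s)) i \<noteq> 0"
      using n by (auto simp: Z_def)
    moreover have "\<Phi> (L ((a, \<alpha>, v), c * r, c * s)) i = c ^ m * \<Phi> (L ((a, \<alpha>, v), r, s)) i"
      unfolding L_def prod.case hom[symmetric] by (simp add: algebra_simps)
    ultimately show "\<exists>i. \<Phi> (2 * (a * s + r), (a * \<alpha> + v - 1) * s + 2 * \<alpha> * r, (a * \<alpha> + v + 1) * s + 2 * \<alpha> * r) i \<noteq> 0"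
      unfolding L_def by auto
  qed (use e in auto)
qed

text \<open>The triple \<open>(a, \<alpha>, v)\<close> encodes the line of slope
  \<open>2 * \<alpha>\<close> through \<open>(a, a * \<alpha> + v)\<close>, that is, the dual line
  of \<open>(cnj \<alpha>, cnj (a * \<alpha> - v))\<close>, together with a base point on
  it.\<close>

lemma line_polys:
  obtains P :: "'m option \<Rightarrow> complex \<times> complex \<times> complex \<Rightarrow> complex poly" and K where
    "\<And>l j. polyfun gens3 (\<lambda>p. coeff (P l p) j)" "\<And>l p. degree (P l p) \<le> K"
    "\<And>l a \<alpha> v \<tau>. poly (P l (a, \<alpha>, v)) \<tau> = \<phi> (a + \<tau>) (a * \<alpha> + v + 2 * \<tau> * \<alpha>) l"
proof -
  have "\<exists>P K. (\<forall>j. polyfun gens3 (\<lambda>p. coeff (P p) j)) \<and> (\<forall>p. degree (P p) \<le> K) \<and>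
      (\<forall>a \<alpha> v \<tau>. poly (P (a, \<alpha>, v)) \<tau> = \<phi> (a + \<tau>) (a * \<alpha> + v + 2 * \<tau> * \<alpha>) l)" for l
  proof -
    have "polyfun (ext_gens gens3) (\<lambda>x. \<phi> (fst (snd x) + fst x)
        (fst (snd x) * fst (snd (snd x)) + snd (snd (snd x)) + 2 * fst x * fst (snd (snd x))) l)"
      by (intro polyfun_\<phi> polyfun_intros polyfun_fst polyfun_snd[OF polyfun_gens3(1)]
        polyfun_snd[OF polyfun_gens3(2)] polyfun_snd[OF polyfun_gens3(3)])
    from polyfun_coeffs[OF this] obtain P K where P: "\<And>j. polyfun gens3 (\<lambda>p. coeff (P p) j)"
      "\<And>p. degree (P p) \<le> K" and
      eq: "\<And>t x. \<phi> (fst (snd (t, x)) + fst (t, x)) (fst (snd (t, x)) * fst (snd (snd (t, x)))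
        + snd (snd (snd (t, x))) + 2 * fst (t, x) * fst (snd (snd (t, x)))) l = poly (P x) t"
      by blast
    show ?thesis
      using P eq[of _ "(a, \<alpha>, v)" for a \<alpha> v] by (intro exI[of _ P] exI[of _ K]) simp
  qed
  then obtain P K where P: "\<And>l j. polyfun gens3 (\<lambda>p. coeff (P l p) j)" "\<And>l p. degree (P l p) \<le> K l"
    "\<And>l a \<alpha> v \<tau>. poly (P l (a, \<alpha>, v)) \<tau> = \<phi> (a + \<tau>) (a * \<alpha> + v + 2 * \<tau> * \<alpha>) l"
    by metis
  have "degree (P l p) \<le> (\<Sum>l\<in>UNIV. K l)" for l p
    using P(2)[of l p] member_le_sum[of l UNIV K] by (auto intro: order.trans)
  with P(1,3) show ?thesis using that by blast
qed


theorem degree_bound: "2 * m \<le> CARD('m) * (CARD('m) - 1)"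
proof -
  obtain P K where pfP: "\<And>l j. polyfun gens3 (\<lambda>p. coeff (P l p) j)" and degP: "\<And>l p. degree (P l p) \<le> K"
    and P: "\<And>l a \<alpha> v \<tau>. poly (P l (a, \<alpha>, v)) \<tau> = \<phi> (a + \<tau>) (a * \<alpha> + v + 2 * \<tau> * \<alpha>) l"
    using line_polys by blast
  \<comment> \<open>For some \<open>\<psi>\<close> this is nonzero iff the first \<open>k\<close>
    Taylor vectors at the base point are linearly independent.\<close>
  define D where "D \<psi> k p = fdet k (\<lambda>i j. \<Sum>l\<in>UNIV. \<psi> i l * coeff (P l p) j)"
    for \<psi> :: "nat \<Rightarrow> 'm option \<Rightarrow> complex" and k p
  have D_bound: "k \<le> Suc K" if "\<exists>\<psi> p. D \<psi> k p \<noteq> 0" for k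
  proof (rule ccontr)
    assume "\<not> k \<le> Suc K"
    moreover have "coeff (P l p) (Suc K) = 0" for l p
      using degP[of l p] by (simp add: coeff_eq_0)
    ultimately have "D \<psi> k p = 0" for \<psi> p
      unfolding D_def by (intro fdet_zero_col[of "Suc K"]) auto
    with that show False by blast
  qed
  \<comment> \<open>\<open>r\<close> is the generic dimension of the span of the map on a line.\<close>
  define r where "r = (GREATEST k. \<exists>\<psi> p. D \<psi> k p \<noteq> 0)"
  have "D (\<lambda>_ _. 0) 0 p \<noteq> 0" for p by (simp add: D_def fdet_def det_dim_zero)
  then have ex: "\<exists>\<psi> p. D \<psi> 0 p \<noteq> 0" by blast
  have "\<exists>\<psi> p. D \<psi> r p \<noteq> 0"
    unfolding r_def by (rule GreatestI_nat[where P = "\<lambda>k. \<exists>\<psi> p. D \<psi> k p \<noteq> 0", OF ex]) (rule D_bound)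
  then obtain \<psi> p1 where p1: "D \<psi> r p1 \<noteq> 0" by blast
  have D0: "D \<psi>' (Suc r) p = 0" for \<psi>' p
  proof (rule ccontr)
    assume "D \<psi>' (Suc r) p \<noteq> 0"
    then have "\<exists>\<psi> p. D \<psi> (Suc r) p \<noteq> 0" by blast
    then have "Suc r \<le> r"
      unfolding r_def by (rule Greatest_le_nat[where P = "\<lambda>k. \<exists>\<psi> p. D \<psi> k p \<noteq> 0"]) (rule D_bound)
    then show False by simp
  qed
  have pfD: "polyfun gens3 (\<lambda>p. D \<psi> r p)"
    unfolding D_def by (intro polyfun_fdet polyfun_intros pfP)
  obtain \<delta> where "\<delta> > 0" and near: "\<And>a \<alpha> v r s. norm (a, \<alpha>, v) < \<delta> \<Longrightarrow> (r, s) \<noteq> (0, 0) \<Longrightarrow>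
    \<exists>i. \<Phi> (2 * (a * s + r), (a * \<alpha> + v - 1) * s + 2 * \<alpha> * r, (a * \<alpha> + v + 1) * s + 2 * \<alpha> * r) i \<noteq> 0"
    using nonvanishing_nearby by metis

  obtain a0 v0 where base: "D \<psi> r (a0, cnj a0, v0) \<noteq> 0" and v0: "cnj v0 = - v0"
    and small: "norm (a0, cnj a0, v0) < \<delta>"
  proof -
    \<comment> \<open>Triples with \<open>\<alpha> = cnj a\<close> and imaginary \<open>v\<close>
      describe tangent lines at points of the hypersurface. They correspond to real
      \<open>x\<close>, \<open>y\<close>, \<open>u\<close>, so a nonzero polynomial does not vanish
      at all of them near 0; the bound \<open>\<delta> / 10\<close> keeps the norm of the triple
      below \<open>\<delta>\<close>.\<close>
    define I where "I = complex_of_real ` {0<..<\<delta> / 10}"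
    have "infinite I" using \<open>\<delta> > 0\<close>
      by (subst I_def, subst finite_image_iff) (auto simp: inj_on_def)
    define f where "f = (\<lambda>(x, y, u). D \<psi> r (x + \<i> * y, x - \<i> * y, \<i> * u))"
    have pff: "polyfun gens3 f"
      unfolding f_def case_prod_unfold
      by (rule polyfun_compose3[OF pfD]) (intro polyfun_intros polyfun_gens3)+
    obtain a \<alpha> v where "p1 = (a, \<alpha>, v)" by (cases p1) auto
    then have "f ((a + \<alpha>) / 2, (a - \<alpha>) / (2 * \<i>), v / \<i>) = D \<psi> r p1"
      unfolding f_def prod.case by (intro arg_cong[of _ _ "D \<psi> r"]) (simp add: field_simps)
    then have "\<exists>x\<in>I. \<exists>y\<in>I. \<exists>u\<in>I. f (x, y, u) \<noteq> 0"
      using p1 polyfun3_eq_0[OF pff \<open>infinite I\<close> \<open>infinite I\<close> \<open>infinite I\<close>] by metis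
    then obtain x y u where xyu: "x \<in> {0<..<\<delta> / 10}" "y \<in> {0<..<\<delta> / 10}" "u \<in> {0<..<\<delta> / 10}"
      and f: "f (complex_of_real x, complex_of_real y, complex_of_real u) \<noteq> 0"
      by (auto simp: I_def)
    define a0 where "a0 = complex_of_real x + \<i> * complex_of_real y"
    have na: "norm a0 \<le> x + y"
      unfolding a0_def using norm_triangle_ineq[of "complex_of_real x" "\<i> * complex_of_real y"] xyu
      by (simp add: norm_mult)
    have "norm (a0, cnj a0, \<i> * complex_of_real u) \<le> norm a0 + (norm (cnj a0) + norm (\<i> * complex_of_real u))"
      by (intro order.trans[OF norm_Pair_le] add_left_mono norm_Pair_le)
    also have "\<dots> < \<delta>" using na xyu by (simp add: norm_mult)
    finally have "norm (a0, cnj a0, \<i> * complex_of_real u) < \<delta>" .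
    moreover have "D \<psi> r (a0, cnj a0, \<i> * complex_of_real u) \<noteq> 0"
      using f by (simp add: f_def a0_def)
    ultimately show ?thesis using that by simp
  qed
  define \<alpha>0 where "\<alpha>0 = cnj a0"
  define p0 where "p0 = (a0, \<alpha>0, v0)"
  \<comment> \<open>The point \<open>(a0, b0)\<close> lies on the hypersurface, and the line encoded
    by \<open>p0\<close> is its own dual line.\<close>
  define b0 where "b0 = a0 * \<alpha>0 + v0"
  define c where "c j l = coeff (P l p0) j" for j l
  have p0: "D \<psi> r p0 \<noteq> 0" using base by (simp add: p0_def \<alpha>0_def)
  have P0: "poly (P l p0) \<tau> = \<phi> (a0 + \<tau>) (b0 + 2 * \<tau> * \<alpha>0) l" for l \<tau>
    by (simp add: p0_def P b0_def)

  \<comment> \<open>Differentiating the vanishing determinants of size \<open>r + 1\<close> along the line is replaced by comparing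
    orders of vanishing at the base point in the recurrence that these determinants give.\<close>
  have kill: "(\<Sum>l\<in>UNIV. \<xi> l * c j l) = 0" if \<xi>: "\<And>j. j < r \<Longrightarrow> (\<Sum>l\<in>UNIV. \<xi> l * c j l) = 0" for \<xi> j
  proof -
    define g where "g \<xi> = (\<Sum>l\<in>UNIV. Polynomial.smult (\<xi> l) (P l p0))" for \<xi>
    have coeff_g: "coeff (g \<xi>) j = (\<Sum>l\<in>UNIV. \<xi> l * c j l)" for \<xi> j
      by (simp add: g_def coeff_sum c_def)
    \<comment> \<open>The functional \<open>\<xi>\<close> becomes row \<open>r\<close>, so the
      recurrence for the rows is a differential equation for \<open>g \<xi>\<close>.\<close>
    define X where "X i = (if i < r then \<psi> i else \<xi>)" for i
    define L where "L i j = taylor_coeff (g (X i)) j" for i j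
    \<comment> \<open>The base point moves along the same line; the third entry compensates so that
      the second coordinate grows by \<open>2 * s * \<alpha>0\<close>.\<close>
    define ps where "ps s = (a0 + s, \<alpha>0, v0 + s * \<alpha>0)" for s
    have Pps: "P l (ps s) = pcompose (P l p0) [:s, 1:]" for l s
      by (subst poly_eq_poly_eq_iff[symmetric], rule ext)
        (simp add: poly_pcompose P0 ps_def P b0_def algebra_simps)
    have L: "poly (L i j) s = (\<Sum>l\<in>UNIV. X i l * coeff (P l (ps s)) j)" for i j s
      by (simp add: L_def poly_taylor_coeff g_def pcompose_sum pcompose_smult coeff_sum Pps)
    have det: "poly (fdet k L) s = D X k (ps s)" for k s
      unfolding poly_fdet D_def L ..
    have "fdet (Suc r) L = 0"
      by (subst poly_all_0_iff_0[symmetric]) (simp add: det D0)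
    moreover have W: "poly (fdet r L) 0 \<noteq> 0"
    proof -
      have "ps 0 = p0" by (simp add: ps_def p0_def)
      moreover have "D X r p0 = D \<psi> r p0" unfolding D_def by (rule fdet_cong) (simp add: X_def)
      ultimately show ?thesis using p0 by (simp add: det)
    qed
    moreover from W have "fdet r L \<noteq> 0" by auto
    ultimately obtain A where "fdet r L * L r r = (\<Sum>j<r. A j * L r j)"
      using rank_recurrence by blast
    then have "g \<xi> = 0"
      unfolding L_def[of r] X_def[of r]
      by (intro taylor_coeff_recurrence_imp_0[OF _ W]) (auto simp: coeff_g \<xi>)
    then show ?thesis using coeff_g[of \<xi> j] by simp
  qed

  have "\<exists>y. \<forall>j<r. (\<Sum>i<r. (\<Sum>l\<in>UNIV. \<psi> i l * c j l) * y i) = (if k = j then 1 else 0)" for k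
    using p0 fdet_transpose[of r "\<lambda>i j. \<Sum>l\<in>UNIV. \<psi> i l * c j l"]
    by (intro fdet_solvable) (simp add: D_def c_def)
  then have "\<forall>k. \<exists>y. \<forall>j<r. (\<Sum>i<r. (\<Sum>l\<in>UNIV. \<psi> i l * c j l) * y i) = (if k = j then 1 else 0)"
    by blast
  from choice[OF this] obtain Y where Y: "\<And>k j. j < r \<Longrightarrow>
      (\<Sum>i<r. (\<Sum>l\<in>UNIV. \<psi> i l * c j l) * Y k i) = (if k = j then 1 else 0)"
    by blast
  define \<psi>' where "\<psi>' k l = (\<Sum>i<r. Y k i * \<psi> i l)" for k l
  have dual: "(\<Sum>l\<in>UNIV. \<psi>' k l * c j l) = (if k = j then 1 else 0)" if "j < r" for k j
    unfolding Y[OF that, symmetric] \<psi>'_def sum_distrib_right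
    by (subst sum.swap) (simp add: mult_ac)
  have span: "c j l = (\<Sum>i<r. (\<Sum>k\<in>UNIV. \<psi>' i k * c j k) * c i l)" for j l
  proof -
    \<comment> \<open>The coordinate functional \<open>l\<close> minus its interpolation at
      \<open>c 0\<close>, ..., \<open>c (r - 1)\<close>. It annihilates these vectors, hence all
      \<open>c j\<close>.\<close>
    define \<xi> where "\<xi> k = (if k = l then 1 else 0) - (\<Sum>i<r. \<psi>' i k * c i l)" for k
    have \<xi>: "(\<Sum>k\<in>UNIV. \<xi> k * c j k) = c j l - (\<Sum>i<r. (\<Sum>k\<in>UNIV. \<psi>' i k * c j k) * c i l)" for j
    proof -
      have "(\<Sum>k\<in>UNIV. \<xi> k * c j k) = (\<Sum>k\<in>UNIV. if k = l then c j k else 0)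
          - (\<Sum>k\<in>UNIV. \<Sum>i<r. \<psi>' i k * c i l * c j k)"
        unfolding sum_subtractf[symmetric] \<xi>_def
        by (intro sum.cong) (auto simp: left_diff_distrib sum_distrib_right)
      also have "(\<Sum>k\<in>UNIV. \<Sum>i<r. \<psi>' i k * c i l * c j k) = (\<Sum>i<r. (\<Sum>k\<in>UNIV. \<psi>' i k * c j k) * c i l)"
        unfolding sum_distrib_right by (subst sum.swap) (simp add: mult_ac)
      finally show ?thesis by simp
    qed
    have "(\<Sum>k\<in>UNIV. \<xi> k * c j k) = 0"
    proof (rule kill)
      fix j assume "j < r"
      then have "(\<Sum>i<r. (\<Sum>k\<in>UNIV. \<psi>' i k * c j k) * c i l) = (\<Sum>i<r. if i = j then c i l else 0)"
        by (intro sum.cong) (auto simp: dual)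
      then show "(\<Sum>k\<in>UNIV. \<xi> k * c j k) = 0" unfolding \<xi> using \<open>j < r\<close> by simp
    qed
    then show ?thesis unfolding \<xi> by simp
  qed

  \<comment> \<open>The line through the base point with slope
    \<open>2 * (\<alpha>0 + \<sigma>)\<close> is the dual line of the point with parameter
    \<open>cnj \<sigma>\<close> on the tangent line.\<close>
  have "\<exists>Q. (\<forall>j. degree (coeff Q j) \<le> j) \<and>
    (\<forall>\<tau> \<sigma>. \<phi> (a0 + \<tau>) (b0 + 2 * \<tau> * \<alpha>0 + 2 * (\<tau> * \<sigma>)) l = poly (poly Q [:\<tau>:]) \<sigma>)" for l
  proof -
    have "polyfun gens2 (\<lambda>p. \<phi> (a0 + fst p) (b0 + 2 * fst p * \<alpha>0 + 2 * snd p) l)"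
      by (intro polyfun_\<phi> polyfun_intros polyfun_gens2)
    from polyfun2_blowup[OF this] show ?thesis by simp
  qed
  then obtain Q where degQ: "\<And>l j. degree (coeff (Q l) j) \<le> j"
    and Q: "\<And>l \<tau> \<sigma>. poly (poly (Q l) [:\<tau>:]) \<sigma> = \<phi> (a0 + \<tau>) (b0 + 2 * \<tau> * \<alpha>0 + 2 * (\<tau> * \<sigma>)) l"
    by metis
  define C where "C j l = coeff (Q l) j" for j l
  define B where "B l = map_poly cnj (P l p0)" for l
  have C0: "poly (C j l) 0 = c j l" for j l
  proof -
    have "map_poly (\<lambda>q. poly q 0) (Q l) = P l p0"
      by (subst poly_eq_poly_eq_iff[symmetric], rule ext)
        (simp add: poly_poly_eq_poly_map[symmetric] Q P0)
    then show ?thesis by (simp add: C_def c_def coeff_map_poly flip: \<open>map_poly _ _ = _\<close>)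
  qed
  have orth: "(\<Sum>l\<in>UNIV. C j (Some l) * B (Some l)) = C j None * B None" for j
  proof -
    define R where "R = (\<Sum>l\<in>UNIV. Q (Some l) * [:B (Some l):]) - Q None * [:B None:]"
    have "poly (poly R [:\<tau>:]) \<sigma> = 0" for \<tau> \<sigma>
    proof -
      \<comment> \<open>The triple is chosen so that the first point of the incident pair runs on
        the dual line with parameter \<open>\<tau>\<close> and the second one on the tangent line
        with parameter \<open>cnj \<sigma>\<close>.\<close>
      let ?a = "a0 + \<tau>" and ?\<alpha> = "\<alpha>0 + \<sigma>" and ?v = "v0 + \<tau> * (\<alpha>0 + \<sigma>) - a0 * \<sigma>"
      have 1: "?a * ?\<alpha> + ?v = b0 + 2 * \<tau> * \<alpha>0 + 2 * (\<tau> * \<sigma>)" by (simp add: b0_def algebra_simps)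
      have 2: "cnj ?\<alpha> = a0 + cnj \<sigma>" by (simp add: \<alpha>0_def)
      have e: "?a * ?\<alpha> - ?v = a0 * \<alpha>0 - v0 + 2 * a0 * \<sigma>" by (simp add: algebra_simps)
      have 3: "cnj (?a * ?\<alpha> - ?v) = b0 + 2 * cnj \<sigma> * \<alpha>0"
        unfolding e by (simp add: b0_def \<alpha>0_def v0 mult_ac)
      show ?thesis
        using polarization[of ?a ?\<alpha> ?v] unfolding 1 2 3
        by (simp add: R_def poly_sum Q B_def P0 mult.commute)
    qed
    then have "map_poly (\<lambda>q. poly q \<sigma>) R = 0" for \<sigma>
      by (subst poly_all_0_iff_0[symmetric]) (simp add: poly_poly_eq_poly_map[symmetric])
    then have "poly (coeff R j) \<sigma> = 0" for \<sigma>
      using coeff_map_poly[of "\<lambda>q. poly q \<sigma>" R j] by simp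
    then have "coeff R j = 0" by (subst poly_all_0_iff_0[symmetric]) simp
    then show ?thesis by (simp add: R_def C_def coeff_sum mult.commute)
  qed
  have prim: "\<exists>l. poly (B l) s \<noteq> 0" for s
  proof -
    obtain i where "\<Phi> (2 * (a0 * 1 + cnj s), (a0 * \<alpha>0 + v0 - 1) * 1 + 2 * \<alpha>0 * cnj s,
        (a0 * \<alpha>0 + v0 + 1) * 1 + 2 * \<alpha>0 * cnj s) i \<noteq> 0"
      using near[of a0 \<alpha>0 v0 "cnj s" 1] small by (auto simp: \<alpha>0_def)
    then have "poly (B i) s \<noteq> 0"
      by (simp add: B_def P0 \<phi>_def b0_def algebra_simps)
    then show ?thesis by blast
  qed
  \<comment> \<open>The coefficient of index \<open>m\<close> is the value at the point at infinity
    of the tangent line.\<close>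
  obtain l0 where l0: "coeff (B l0) m \<noteq> 0"
  proof -
    obtain i where i: "\<Phi> (2, 2 * \<alpha>0, 2 * \<alpha>0) i \<noteq> 0"
      using near[of a0 \<alpha>0 v0 1 0] small by (auto simp: \<alpha>0_def)
    have "polyfun gens1 (\<lambda>s. \<Phi> (2 * (a0 * s + 1), (b0 - 1) * s + 2 * \<alpha>0, (b0 + 1) * s + 2 * \<alpha>0) i)"
      by (intro polyfun_compose3[OF pf] polyfun_intros polyfun_gen) auto
    then obtain q where q: "(\<lambda>s. \<Phi> (2 * (a0 * s + 1), (b0 - 1) * s + 2 * \<alpha>0, (b0 + 1) * s + 2 * \<alpha>0) i) = poly q"
      using polyfun_univariate by blast
    have "s ^ m * poly (P i p0) (1 / s) = poly q s" if s: "s \<noteq> 0" for s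
    proof -
      have "s * (2 * (a0 + 1 / s)) = 2 * (a0 * s + 1)"
        "s * (b0 + 2 * (1 / s) * \<alpha>0 - 1) = (b0 - 1) * s + 2 * \<alpha>0"
        "s * (b0 + 2 * (1 / s) * \<alpha>0 + 1) = (b0 + 1) * s + 2 * \<alpha>0"
        using s by (simp_all add: distrib_left right_diff_distrib left_diff_distrib distrib_right)
      then show ?thesis unfolding q[symmetric] P0 \<phi>_def hom[symmetric] by (simp only:)
    qed
    from rev_coeff[OF this] have "coeff (P i p0) m = poly q 0" by simp
    then have "coeff (P i p0) m \<noteq> 0" using i by (simp flip: q)
    then show ?thesis using that[of i] by (simp add: B_def coeff_map_poly)
  qed
  have "r \<le> CARD('m) \<and> m \<le> (\<Sum>i<r - 1. Suc i)"
  proof (rule frame_degree_bound[of C B l0 m r \<psi>'])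
    show "degree (C j i) \<le> j" for j i by (simp add: C_def degQ)
    show "coeff (B i) j = cnj (poly (C j i) 0)" for i j by (simp add: C0 B_def coeff_map_poly c_def)
    show "(\<Sum>l\<in>UNIV. C j (Some l) * B (Some l)) = C j None * B None" for j by (rule orth)
    show "\<exists>i. poly (B i) s \<noteq> 0" for s by (rule prim)
    show "coeff (B l0) m \<noteq> 0" by (rule l0)
    show "(\<Sum>l\<in>UNIV. \<psi>' i l * poly (C j l) 0) = (if i = j then 1 else 0)" if "i < r" "j < r" for i j
      unfolding C0 by (rule dual[OF that(2)])
    show "poly (C j l) 0 = (\<Sum>i<r. (\<Sum>k\<in>UNIV. \<psi>' i k * poly (C j k) 0) * poly (C i l) 0)" for j l
      unfolding C0 by (rule span)
  qed
  then have r: "r \<le> CARD('m)" and m: "m \<le> (\<Sum>i<r - 1. Suc i)" by auto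
  have tri: "2 * (\<Sum>i<n. Suc i) = Suc n * n" for n by (induction n) auto
  have "2 * m \<le> Suc (r - 1) * (r - 1)" using m tri[of "r - 1"] by linarith
  also have "\<dots> \<le> CARD('m) * (CARD('m) - 1)"
  proof -
    have "0 < CARD('m)" by simp
    then have "Suc (r - 1) \<le> CARD('m)" using r by (cases r) (auto simp: Suc_le_eq)
    then show ?thesis using diff_le_mono[OF r, of 1] by (rule mult_le_mono)
  qed
  finally show ?thesis .
qed

end

section \<open>The ring of polynomial functions\<close>

abbreviation coords :: "(complex ^ 'n::finite \<Rightarrow> complex) set" where
  "coords \<equiv> range (\<lambda>i z. vec_nth z i)"

text \<open>As elements of a ring type, polynomial functions can be coefficients of
  \<open>poly\<close>. Their divisibility is that of formal polynomials, by
  \<open>pfun_of_dvd_iff\<close>.\<close>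

typedef ('n::finite) pfun = "{f :: complex ^ 'n \<Rightarrow> complex. polyfun coords f}"
  morphisms ev Pfun
  by (auto intro: polyfun_const)

lemma polyfun_ev: "polyfun coords (ev f)"
  using ev[of f] by simp

lemma ev_Pfun: "polyfun coords f \<Longrightarrow> ev (Pfun f) = f"
  by (simp add: Pfun_inverse)

lemma pfun_eqI: "(\<And>x. ev f x = ev g x) \<Longrightarrow> f = g"
  by (metis ev_inject ext)

instantiation pfun :: (finite) comm_ring_1
begin

definition "0 = Pfun (\<lambda>_. 0)"
definition "1 = Pfun (\<lambda>_. 1)"
definition "f + g = Pfun (\<lambda>x. ev f x + ev g x)"
definition "f - g = Pfun (\<lambda>x. ev f x - ev g x)"
definition "- f = Pfun (\<lambda>x. - ev f x)"
definition "f * g = Pfun (\<lambda>x. ev f x * ev g x)"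

lemma ev_0 [simp]: "ev 0 x = 0"
  and ev_1 [simp]: "ev 1 x = 1"
  and ev_add [simp]: "ev (f + g) x = ev f x + ev g x"
  and ev_diff [simp]: "ev (f - g) x = ev f x - ev g x"
  and ev_minus [simp]: "ev (- f) x = - ev f x"
  and ev_mult [simp]: "ev (f * g) x = ev f x * ev g x"
  by (simp_all add: zero_pfun_def one_pfun_def plus_pfun_def minus_pfun_def uminus_pfun_def
      times_pfun_def ev_Pfun polyfun_intros polyfun_ev)

instance
proof
  show "(0 :: 'a pfun) \<noteq> 1" by (metis ev_0 ev_1 zero_neq_one)
qed (auto intro!: pfun_eqI simp: algebra_simps)

end

lemma ev_sum [simp]: "ev (\<Sum>i\<in>I. f i) x = (\<Sum>i\<in>I. ev (f i) x)"
  by (induction I rule: infinite_finite_induct) auto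

lemma ev_power [simp]: "ev (f ^ n) x = ev f x ^ n"
  by (induction n) auto

lemma pfun_nonzero: "f \<noteq> 0 \<longleftrightarrow> (\<exists>x. ev f x \<noteq> 0)"
  by (metis ev_0 pfun_eqI)

lemma polyfun_line:
  assumes "polyfun coords f"
  shows "\<exists>p. \<forall>t. poly p t = f (x + t *s e)"
proof -
  have id: "polyfun gens1 (\<lambda>t. t)" by (rule polyfun_gen) simp
  have "polyfun gens1 (\<lambda>t. f (x + t *s e))"
    by (rule polyfun_compose[OF assms]) (auto intro!: polyfun_add polyfun_mult polyfun_const id)
  then show ?thesis using polyfun_univariate by metis
qed

text \<open>On the line joining a nonzero of \<open>f\<close> to a nonzero of \<open>g\<close> both
  restrict to nonzero polynomials in one variable.\<close>

instance pfun :: (finite) idom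
proof
  fix f g :: "'a pfun" assume "f \<noteq> 0" "g \<noteq> 0"
  then obtain x y where x: "ev f x \<noteq> 0" and y: "ev g y \<noteq> 0" by (auto simp: pfun_nonzero)
  obtain p q where p: "\<And>t. poly p t = ev f (x + t *s (y - x))" and q: "\<And>t. poly q t = ev g (x + t *s (y - x))"
    using polyfun_line[OF polyfun_ev] by metis
  have "poly p 0 \<noteq> 0" "poly q 1 \<noteq> 0" using x y by (simp_all add: p q)
  then have "p * q \<noteq> 0" by auto
  then obtain t where "poly (p * q) t \<noteq> 0" using poly_all_0_iff_0 by blast
  then show "f * g \<noteq> 0" by (auto simp: p q pfun_nonzero)
qed

section \<open>Restriction to parallel lines and polynomials in the line parameter\<close>

definition pconst :: "complex \<Rightarrow> 'n::finite pfun" where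
  "pconst c = Pfun (\<lambda>_. c)"

lemma ev_pconst [simp]: "ev (pconst c) x = c"
  by (simp add: pconst_def ev_Pfun polyfun_const)

definition line_restrict :: "complex ^ 'n::finite \<Rightarrow> complex ^ 'n \<Rightarrow> 'n pfun \<Rightarrow> complex poly" where
  "line_restrict e x f = (THE p. \<forall>t. poly p t = ev f (x + t *s e))"

lemma poly_line_restrict: "poly (line_restrict e x f) t = ev f (x + t *s e)"
proof -
  have "\<exists>!p. \<forall>t. poly p t = ev f (x + t *s e)"
    using polyfun_line[OF polyfun_ev] by (metis ext poly_eq_poly_eq_iff)
  from theI'[OF this] show ?thesis unfolding line_restrict_def by blast
qed

lemma line_restrict_unique: "(\<And>t. poly p t = ev f (x + t *s e)) \<Longrightarrow> line_restrict e x f = p"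
  by (metis ext poly_eq_poly_eq_iff poly_line_restrict)

lemma line_restrict_hom [simp]:
  "line_restrict e x 0 = 0"
  "line_restrict e x (f + g) = line_restrict e x f + line_restrict e x g"
  "line_restrict e x (f * g) = line_restrict e x f * line_restrict e x g"
  "line_restrict e x (f ^ n) = line_restrict e x f ^ n"
  "line_restrict e x (pconst c) = [:c:]"
  by (auto intro!: line_restrict_unique simp: poly_line_restrict poly_power)

lemma map_poly_mult_hom:
  fixes h :: "'a::comm_ring_1 \<Rightarrow> 'b::comm_ring_1"
  assumes "h 0 = 0" "\<And>a b. h (a + b) = h a + h b" "\<And>a b. h (a * b) = h a * h b"
  shows "map_poly h (p * q) = map_poly h p * map_poly h q"
proof (rule poly_eqI)
  fix n
  have "h (\<Sum>i\<in>I. f i) = (\<Sum>i\<in>I. h (f i))" for I and f :: "nat \<Rightarrow> 'a"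
    by (induction I rule: infinite_finite_induct) (auto simp: assms)
  then show "coeff (map_poly h (p * q)) n = coeff (map_poly h p * map_poly h q) n"
    by (simp add: coeff_map_poly coeff_mult assms)
qed

lemma map_poly_add_hom:
  assumes "h 0 = 0" "\<And>a b. h (a + b) = h a + h b"
  shows "map_poly h (p + q) = map_poly h p + map_poly h q"
  by (rule poly_eqI) (simp add: coeff_map_poly assms)

abbreviation spec :: "complex ^ 'n::finite \<Rightarrow> 'n pfun poly \<Rightarrow> complex poly" where
  "spec x \<equiv> map_poly (\<lambda>c. ev c x)"

lemma spec_mult [simp]: "spec x (P * Q) = spec x P * spec x Q"
  by (rule map_poly_mult_hom) auto

lemma spec_add [simp]: "spec x (P + Q) = spec x P + spec x Q"
  by (rule map_poly_add_hom) auto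

lemma spec_sum [simp]: "spec x (\<Sum>i\<in>I. P i) = (\<Sum>i\<in>I. spec x (P i))"
  by (induction I rule: infinite_finite_induct) auto

lemma degree_map_poly_lead:
  assumes "h 0 = 0" "h (lead_coeff p) \<noteq> 0"
  shows "degree (map_poly h p) = degree p" "lead_coeff (map_poly h p) = h (lead_coeff p)"
proof -
  show "degree (map_poly h p) = degree p"
    using assms map_poly_degree_eq by blast
  then show "lead_coeff (map_poly h p) = h (lead_coeff p)"
    by (simp add: coeff_map_poly assms)
qed

lemma spec_eq_0_imp: "(\<And>x. spec x P = 0) \<Longrightarrow> P = 0"
proof (rule poly_eqI, rule pfun_eqI)
  fix n x assume "\<And>x. spec x P = 0"
  then show "ev (coeff P n) x = ev (coeff 0 n) x"
    using coeff_map_poly[of "\<lambda>c. ev c x" P n] by simp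
qed

text \<open>All lines of direction \<open>e\<close> are treated at once: \<open>P\<close> is a
  polynomial in the line parameter whose coefficients are functions of the base point, so that
  division with remainder applies to it.\<close>

definition line_poly :: "complex ^ 'n::finite \<Rightarrow> 'n pfun \<Rightarrow> 'n pfun poly \<Rightarrow> bool" where
  "line_poly e f P \<longleftrightarrow> (\<forall>x t. poly (spec x P) t = ev f (x + t *s e))"

lemma line_poly_ex: "\<exists>P. line_poly e f P"
proof -
  have "polyfun (ext_gens coords) (\<lambda>p. ev f (snd p + fst p *s e))"
  proof (rule polyfun_compose[OF polyfun_ev])
    fix g :: "complex ^ 'a \<Rightarrow> complex" assume "g \<in> coords"
    then obtain i where g: "g = (\<lambda>z. vec_nth z i)" by blast
    have "polyfun coords (\<lambda>z :: complex ^ 'a. vec_nth z i)" by (rule polyfun_gen) blast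
    from polyfun_snd[OF this] show "polyfun (ext_gens coords) (\<lambda>x. g (snd x + fst x *s e))"
      unfolding g vector_add_component vector_smult_component
      by (intro polyfun_add polyfun_mult polyfun_const polyfun_fst)
  qed
  from polyfun_coeffs[OF this] obtain P K where
    P: "\<And>j. polyfun coords (\<lambda>x. coeff (P x) j)" "\<And>x. degree (P x) \<le> K"
    "\<And>t x. ev f (x + t *s e) = poly (P x) t"
    by auto
  define Q where "Q = (\<Sum>j\<le>K. monom (Pfun (\<lambda>x. coeff (P x) j)) j)"
  have "spec x Q = P x" for x
  proof (rule poly_eqI)
    fix n
    have "coeff (P x) n = 0" if "n > K" using P(2)[of x] that by (simp add: coeff_eq_0)
    then show "coeff (spec x Q) n = coeff (P x) n"
      by (auto simp: coeff_map_poly Q_def coeff_sum ev_Pfun[OF P(1)] if_distrib[of "\<lambda>f. ev f x"] cong: if_cong)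
  qed
  then have "line_poly e f Q" using P(3) by (simp add: line_poly_def)
  then show ?thesis by blast
qed

lemma line_poly_spec: "line_poly e f P \<Longrightarrow> spec x P = line_restrict e x f"
  by (rule line_restrict_unique[symmetric]) (simp add: line_poly_def)

lemma monic_division:
  fixes F G :: "'a::idom poly"
  assumes "lead_coeff G = 1"
  shows "\<exists>U R. F = G * U + R \<and> (R = 0 \<or> degree R < degree G)"
proof -
  have "G \<noteq> 0" using assms by auto
  then show ?thesis using pseudo_divmod[of G F] assms by (metis (no_types) power_one smult_1_left surj_pair)
qed

section \<open>Evaluation of formal polynomials\<close>

abbreviation monom_fun :: "('n::finite \<Rightarrow>\<^sub>0 nat) \<Rightarrow> complex ^ 'n \<Rightarrow> complex" where
  "monom_fun m z \<equiv> (\<Prod>i\<in>UNIV. vec_nth z i ^ Poly_Mapping.lookup m i)"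

lemma cpoly_eval_superset:
  assumes "finite S" "Poly_Mapping.keys P \<subseteq> S"
  shows "cpoly_eval P z = (\<Sum>m\<in>S. Poly_Mapping.lookup P m * monom_fun m z)"
  unfolding cpoly_eval_def
  by (rule sum.mono_neutral_left) (use assms in \<open>auto simp: in_keys_iff\<close>)

lemma cpoly_eval_0 [simp]: "cpoly_eval 0 z = 0"
  by (simp add: cpoly_eval_def)

lemma cpoly_eval_add [simp]: "cpoly_eval (P + Q) z = cpoly_eval P z + cpoly_eval Q z"
proof -
  let ?S = "Poly_Mapping.keys P \<union> Poly_Mapping.keys Q"
  have "Poly_Mapping.keys (P + Q) \<subseteq> ?S" by (rule Poly_Mapping.keys_add)
  then show ?thesis
    by (subst (1 2 3) cpoly_eval_superset[of ?S])
      (auto simp: lookup_add distrib_right sum.distrib)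
qed

lemma cpoly_eval_single [simp]: "cpoly_eval (Poly_Mapping.single m c) z = c * monom_fun m z"
  by (subst cpoly_eval_superset[of "{m}"]) auto

lemma cpoly_eval_sum [simp]: "cpoly_eval (\<Sum>i\<in>I. P i) z = (\<Sum>i\<in>I. cpoly_eval (P i) z)"
  by (induction I rule: infinite_finite_induct) auto

lemma cpoly_sum_singles:
  "(\<Sum>m\<in>Poly_Mapping.keys P. Poly_Mapping.single m (Poly_Mapping.lookup P m)) = P"
  by (rule poly_mapping_eqI)
    (auto simp: lookup_sum lookup_single when_def in_keys_iff)

lemma cpoly_eval_mult [simp]: "cpoly_eval (P * Q) z = cpoly_eval P z * cpoly_eval Q z"
proof -
  have single: "cpoly_eval (Poly_Mapping.single m a * Poly_Mapping.single k b) z = (a * monom_fun m z) * (b * monom_fun k z)" for m k a b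
    by (simp add: mult_single lookup_add power_add prod.distrib)
  have "cpoly_eval (P * Q) z = cpoly_eval ((\<Sum>m\<in>Poly_Mapping.keys P. Poly_Mapping.single m (Poly_Mapping.lookup P m))
      * (\<Sum>m\<in>Poly_Mapping.keys Q. Poly_Mapping.single m (Poly_Mapping.lookup Q m))) z"
    by (simp only: cpoly_sum_singles)
  also have "\<dots> = cpoly_eval P z * cpoly_eval Q z"
    unfolding sum_product cpoly_eval_sum single unfolding cpoly_eval_def sum_product ..
  finally show ?thesis .
qed

lemma cpoly_eval_1 [simp]: "cpoly_eval 1 z = 1"
  using cpoly_eval_single[of 0 1 z] by (simp add: single_one)

text \<open>Monomials are distinct characters of the multiplicative monoid \<open>complex ^ 'n\<close>, hence linearly
  independent.\<close>

lemma monom_fun_independent: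
  assumes "finite K" "\<And>z. (\<Sum>m\<in>K. c m * monom_fun m z) = 0" "m \<in> K"
  shows "c m = 0"
  using assms
proof (induction K arbitrary: c m rule: finite_induct)
  case (insert k K)
  have mult: "monom_fun m (\<chi> i. vec_nth w i * vec_nth z i) = monom_fun m w * monom_fun m z"
    for m and w z :: "complex ^ 'a"
    by (simp add: power_mult_distrib prod.distrib)
  \<comment> \<open>Replacing \<open>z\<close> by the product of \<open>w\<close> and
    \<open>z\<close> and subtracting \<open>monom_fun k w\<close> times the original relation
    eliminates \<open>k\<close>.\<close>
  have sep: "c m * (monom_fun m w - monom_fun k w) = 0" if m: "m \<in> K" for m w
  proof (rule insert.IH[OF _ m])
    fix z
    have "(\<Sum>m\<in>insert k K. c m * monom_fun m (\<chi> i. vec_nth w i * vec_nth z i)) = 0"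
      "(\<Sum>m\<in>insert k K. c m * monom_fun m z) = 0"
      by (rule insert.prems(1))+
    then have 1: "c k * (monom_fun k w * monom_fun k z) + (\<Sum>m\<in>K. c m * (monom_fun m w * monom_fun m z)) = 0"
      and 2: "c k * monom_fun k z + (\<Sum>m\<in>K. c m * monom_fun m z) = 0"
      unfolding mult using insert.hyps by simp_all
    have "(\<Sum>m\<in>K. c m * (monom_fun m w - monom_fun k w) * monom_fun m z) =
      (\<Sum>m\<in>K. c m * (monom_fun m w * monom_fun m z)) - monom_fun k w * (\<Sum>m\<in>K. c m * monom_fun m z)"
      unfolding sum_distrib_left sum_subtractf[symmetric] by (intro sum.cong) (auto simp: algebra_simps)
    also have "\<dots> = 0"
    proof -
      have "(\<Sum>m\<in>K. c m * (monom_fun m w * monom_fun m z)) = - (c k * (monom_fun k w * monom_fun k z))"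
        using 1 by (simp add: eq_neg_iff_add_eq_0 add.commute)
      moreover have "(\<Sum>m\<in>K. c m * monom_fun m z) = - (c k * monom_fun k z)"
        using 2 by (simp add: eq_neg_iff_add_eq_0 add.commute)
      ultimately show ?thesis by (simp only:) (simp add: mult_ac)
    qed
    finally show "(\<Sum>m\<in>K. c m * (monom_fun m w - monom_fun k w) * monom_fun m z) = 0" .
  qed
  have K0: "c m = 0" if m: "m \<in> K" for m
  proof -
    have "m \<noteq> k" using m insert.hyps by blast
    then obtain i where i: "Poly_Mapping.lookup m i \<noteq> Poly_Mapping.lookup k i"
      by (metis poly_mapping_eqI)
    define w :: "complex ^ 'a" where "w = (\<chi> j. if j = i then 2 else 1)"
    have w: "monom_fun m w = 2 ^ Poly_Mapping.lookup m i" for m :: "'a \<Rightarrow>\<^sub>0 nat"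
    proof -
      have "monom_fun m w = (\<Prod>j\<in>UNIV. if j = i then 2 ^ Poly_Mapping.lookup m i else 1)"
        unfolding w_def by (intro prod.cong) auto
      then show ?thesis by simp
    qed
    have "(2::complex) ^ a \<noteq> 2 ^ b" if "a \<noteq> b" for a b :: nat
    proof
      assume "(2::complex) ^ a = 2 ^ b"
      then have "of_nat (2 ^ a) = (of_nat (2 ^ b) :: complex)" by simp
      then show False using that by (simp only: of_nat_eq_iff) simp
    qed
    then have "monom_fun m w - monom_fun k w \<noteq> 0" using i by (simp add: w)
    then show ?thesis using sep[OF m, of w] by simp
  qed
  moreover have "c k = 0"
  proof -
    have "(\<Sum>m\<in>insert k K. c m * monom_fun m (\<chi> i. 1)) = 0" by (rule insert.prems(1))
    then show ?thesis using insert.hyps K0 by simp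
  qed
  ultimately show ?case using insert.prems(2) by blast
qed simp

lemma cpoly_eq_0_if_eval_0:
  assumes "\<And>z. cpoly_eval P z = 0"
  shows "P = 0"
proof (rule poly_mapping_eqI)
  fix m
  have "Poly_Mapping.lookup P m = 0" if "m \<in> Poly_Mapping.keys P"
    using monom_fun_independent[of "Poly_Mapping.keys P" "Poly_Mapping.lookup P" m] assms that
    by (simp add: cpoly_eval_def)
  then show "Poly_Mapping.lookup P m = Poly_Mapping.lookup 0 m"
    by (cases "m \<in> Poly_Mapping.keys P") (auto simp: in_keys_iff)
qed

lemma cpoly_eval_inject: "(\<And>z. cpoly_eval P z = cpoly_eval Q z) \<Longrightarrow> P = Q"
proof -
  assume eq: "\<And>z. cpoly_eval P z = cpoly_eval Q z"
  have "cpoly_eval (P - Q) z = 0" for z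
    using cpoly_eval_add[of "P - Q" Q z] eq by simp
  then show ?thesis using cpoly_eq_0_if_eval_0 by fastforce
qed

lemma polyfun_monom_fun: "polyfun coords (monom_fun m)"
  by (intro polyfun_prod polyfun_power polyfun_gen) auto

lemma polyfun_cpoly_eval: "polyfun coords (cpoly_eval P)"
  unfolding cpoly_eval_def by (intro polyfun_sum polyfun_mult polyfun_const polyfun_monom_fun)

lemma polyfun_coords_is_cpoly:
  assumes "polyfun coords f"
  shows "\<exists>P. f = cpoly_eval P"
  using assms
proof induction
  case (polyfun_const c)
  have "(\<lambda>_. c) = cpoly_eval (Poly_Mapping.single 0 c)" by (rule ext) simp
  then show ?case by blast
next
  case (polyfun_gen g)
  then obtain i where g: "g = (\<lambda>z. vec_nth z i)" by blast
  have "g = cpoly_eval (Poly_Mapping.single (Poly_Mapping.single i 1) 1)"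
  proof (rule ext)
    fix z
    have "monom_fun (Poly_Mapping.single i 1) z = (\<Prod>j\<in>UNIV. if j = i then vec_nth z i else 1)"
      by (intro prod.cong) (auto simp: lookup_single when_def)
    then show "g z = cpoly_eval (Poly_Mapping.single (Poly_Mapping.single i 1) 1) z"
      by (simp add: g)
  qed
  then show ?case by blast
next
  case (polyfun_add f g)
  then show ?case by (metis (no_types, lifting) ext cpoly_eval_add)
next
  case (polyfun_mult f g)
  then show ?case by (metis (no_types, lifting) ext cpoly_eval_mult)
qed

definition pfun_of :: "'n::finite cpoly \<Rightarrow> 'n pfun" where
  "pfun_of P = Pfun (cpoly_eval P)"

lemma ev_pfun_of [simp]: "ev (pfun_of P) = cpoly_eval P"
  by (simp add: pfun_of_def ev_Pfun polyfun_cpoly_eval)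

lemma pfun_of_surj: "\<exists>P. f = pfun_of P"
  using polyfun_coords_is_cpoly[OF polyfun_ev[of f]] by (metis ev_inject ev_pfun_of)

lemma pfun_of_dvd_iff: "pfun_of P dvd pfun_of Q \<longleftrightarrow> P dvd Q"
proof
  assume "pfun_of P dvd pfun_of Q"
  then obtain f where f: "pfun_of Q = pfun_of P * f" unfolding dvd_def by blast
  obtain R where R: "f = pfun_of R" using pfun_of_surj by blast
  have "Q = P * R"
    by (rule cpoly_eval_inject) (use arg_cong[OF f, of ev] in \<open>simp add: R fun_eq_iff\<close>)
  then show "P dvd Q" by simp
next
  assume "P dvd Q"
  then obtain R where "Q = P * R" unfolding dvd_def by blast
  then have "pfun_of Q = pfun_of P * pfun_of R" by (intro pfun_eqI) simp
  then show "pfun_of P dvd pfun_of Q" by simp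
qed

section \<open>Homogenization\<close>

definition mdeg :: "('n::finite \<Rightarrow>\<^sub>0 nat) \<Rightarrow> nat" where
  "mdeg m = (\<Sum>i\<in>UNIV. Poly_Mapping.lookup m i)"

text \<open>\<open>T\<close> is the homogenizing variable. The exponent is a truncated difference,
  so this is the homogenization only if the total degree is at most \<open>d\<close>; then
  \<open>T = 0\<close> leaves the form of degree \<open>d\<close>.\<close>

definition homogenize :: "nat \<Rightarrow> 'n::finite cpoly \<Rightarrow> complex \<Rightarrow> complex ^ 'n \<Rightarrow> complex" where
  "homogenize d P T z =
     (\<Sum>m\<in>Poly_Mapping.keys P. Poly_Mapping.lookup P m * monom_fun m z * T ^ (d - mdeg m))"

lemma homogenize_1 [simp]: "homogenize d P 1 z = cpoly_eval P z"
  by (simp add: homogenize_def cpoly_eval_def)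

lemma mdeg_le_total_degree: "m \<in> Poly_Mapping.keys P \<Longrightarrow> mdeg m \<le> total_degree P"
  unfolding total_degree_def mdeg_def by (intro Max_ge) auto

lemma monom_fun_scale: "monom_fun m (c *s z) = c ^ mdeg m * monom_fun m z"
  by (simp add: power_mult_distrib prod.distrib mdeg_def power_sum)

lemma homogenize_scale:
  assumes "total_degree P \<le> d"
  shows "homogenize d P (c * T) (c *s z) = c ^ d * homogenize d P T z"
  unfolding homogenize_def sum_distrib_left
proof (rule sum.cong)
  fix m assume "m \<in> Poly_Mapping.keys P"
  then have "mdeg m + (d - mdeg m) = d" using mdeg_le_total_degree[of m P] assms by simp
  then have "c ^ d = c ^ mdeg m * c ^ (d - mdeg m)" by (metis power_add)
  then show "Poly_Mapping.lookup P m * monom_fun m (c *s z) * (c * T) ^ (d - mdeg m) =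
      c ^ d * (Poly_Mapping.lookup P m * monom_fun m z * T ^ (d - mdeg m))"
    unfolding monom_fun_scale power_mult_distrib by (simp only: mult_ac)
qed simp

lemma homogenize_affine:
  assumes "total_degree P \<le> d"
  shows "homogenize d P c (c *s z) = c ^ d * cpoly_eval P z"
  using homogenize_scale[OF assms, of c 1 z] by simp

lemma polyfun_homogenize:
  assumes "polyfun G T" "\<And>i. polyfun G (\<lambda>x. vec_nth (z x) i)"
  shows "polyfun G (\<lambda>x. homogenize d P (T x) (z x))"
  unfolding homogenize_def by (intro polyfun_intros assms)

lemma homogenize_top_nonzero:
  assumes "total_degree P = d" "P \<noteq> 0"
  shows "\<exists>e. homogenize d P 0 e \<noteq> 0"
proof -
  let ?K = "{m \<in> Poly_Mapping.keys P. mdeg m = d}"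
  have "Poly_Mapping.keys P \<noteq> {}" using assms(2) by simp
  have "d \<in> insert 0 (mdeg ` Poly_Mapping.keys P)"
    unfolding assms(1)[symmetric] total_degree_def mdeg_def by (intro Max_in) auto
  then have "\<exists>m\<in>Poly_Mapping.keys P. mdeg m = d"
  proof
    \<comment> \<open>The maximum may be the inserted 0 and not the degree of a monomial.\<close>
    assume "d = 0"
    then show ?thesis
      using \<open>Poly_Mapping.keys P \<noteq> {}\<close> mdeg_le_total_degree[of _ P] assms(1) by fastforce
  qed auto
  then obtain m where m: "m \<in> ?K" by blast
  have top: "homogenize d P 0 z = (\<Sum>m\<in>?K. Poly_Mapping.lookup P m * monom_fun m z)" for z
    unfolding homogenize_def
  proof (rule sum.mono_neutral_cong_right)
    show "\<forall>m\<in>Poly_Mapping.keys P - ?K. Poly_Mapping.lookup P m * monom_fun m z * 0 ^ (d - mdeg m) = 0"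
    proof
      fix m assume m: "m \<in> Poly_Mapping.keys P - ?K"
      then have "mdeg m < d" using mdeg_le_total_degree[of m P] assms(1) by auto
      then show "Poly_Mapping.lookup P m * monom_fun m z * 0 ^ (d - mdeg m) = 0" by simp
    qed
  qed (use mdeg_le_total_degree[of _ P] assms(1) in auto)
  show ?thesis
  proof (rule ccontr)
    assume "\<not> ?thesis"
    then have "Poly_Mapping.lookup P m = 0"
      using monom_fun_independent[of ?K "Poly_Mapping.lookup P" m] m by (simp add: top)
    then show False using m by (simp add: in_keys_iff)
  qed
qed

lemma degree_map_poly_le: "h 0 = 0 \<Longrightarrow> degree (map_poly h p) \<le> degree p"
  by (rule degree_le) (simp add: coeff_map_poly coeff_eq_0)

lemma poly_eq_sum_upto:
  fixes p :: "complex poly"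
  shows "degree p \<le> K \<Longrightarrow> poly p t = (\<Sum>n\<le>K. coeff p n * t ^ n)"
  unfolding poly_altdef by (rule sum.mono_neutral_left) (auto simp: coeff_eq_0)

section \<open>Lines avoiding a common zero set of codimension two\<close>

text \<open>The leading coefficient is read off at infinity, where the line through \<open>x\<close>
  has the point given by its direction \<open>e\<close>, whatever \<open>x\<close> is.\<close>

lemma line_poly_lead:
  assumes P: "line_poly e f P" and f: "f = pfun_of Q" and d: "total_degree Q \<le> d"
    and e: "homogenize d Q 0 e \<noteq> 0"
  shows "lead_coeff P = pconst (homogenize d Q 0 e)"
proof -
  have id: "polyfun gens1 (\<lambda>s. s)" by (rule polyfun_gen) simp
  have spec: "degree (spec x P) \<le> d \<and> coeff (spec x P) d = homogenize d Q 0 e" for x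
  proof -
    have "polyfun gens1 (\<lambda>s. homogenize d Q s (s *s x + e))"
      by (intro polyfun_homogenize id) (auto intro!: polyfun_add polyfun_mult polyfun_const id)
    then obtain r where r: "(\<lambda>s. homogenize d Q s (s *s x + e)) = poly r"
      using polyfun_univariate by blast
    have "s ^ d * poly (spec x P) (1 / s) = poly r s" if "s \<noteq> 0" for s
    proof -
      have "s *s (x + (1 / s) *s e) = s *s x + e"
        using that by (simp add: vector_add_ldistrib vector_smult_assoc)
      then show ?thesis
        using P homogenize_affine[OF d, of s "x + (1 / s) *s e"]
        by (simp add: line_poly_def f flip: r)
    qed
    from rev_coeff[OF this] show ?thesis by (simp flip: r)
  qed
  have coeff_P: "coeff P n = (if n = d then pconst (homogenize d Q 0 e) else 0)" if "n \<ge> d" for n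
  proof (rule pfun_eqI)
    fix x
    have "ev (coeff P n) x = coeff (spec x P) n" by (simp add: coeff_map_poly)
    then show "ev (coeff P n) x = ev (if n = d then pconst (homogenize d Q 0 e) else 0) x"
      using spec[of x] that by (auto intro: coeff_eq_0)
  qed
  have "degree P \<le> d" by (rule degree_le) (simp add: coeff_P)
  moreover have "coeff P d \<noteq> 0" using e coeff_P[of d] by (auto simp: pfun_nonzero)
  ultimately have "degree P = d" by (meson le_antisym le_degree)
  then show ?thesis by (simp add: coeff_P)
qed

text \<open>The normalization step: in a direction where the top form does not vanish, the function
  is monic up to a constant on all lines simultaneously.\<close>

lemma monic_line_ex:
  assumes "f \<noteq> 0"
  shows "\<exists>e P c. line_poly e f P \<and> lead_coeff P = pconst c \<and> c \<noteq> 0"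
proof -
  obtain Q where Q: "f = pfun_of Q" using pfun_of_surj by blast
  have "Q \<noteq> 0" using assms by (auto simp: Q pfun_nonzero)
  then obtain e where "homogenize (total_degree Q) Q 0 e \<noteq> 0"
    using homogenize_top_nonzero by blast
  with line_poly_ex[of e f] line_poly_lead[OF _ Q order_refl] show ?thesis by blast
qed

lemma line_poly_at_0: "line_poly e f P \<Longrightarrow> coeff P 0 = f"
  by (rule pfun_eqI)
    (metis (no_types, lifting) add.right_neutral coeff_map_poly ev_0 line_poly_def poly_0_coeff_0
      vector_smult_lzero)

text \<open>In a normalizing direction \<open>N\<close> can be divided by \<open>a\<close> with
  remainder. On each line the remainder is divisible by a polynomial of larger degree, so it
  vanishes; parameter 0 recovers \<open>a\<close> and \<open>N\<close>.\<close>

lemma dvd_if_dvd_on_lines: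
  assumes "a \<noteq> 0"
  shows "\<exists>e. (\<forall>x. line_restrict e x a \<noteq> 0) \<and>
    (\<forall>N. (\<forall>x. line_restrict e x a dvd line_restrict e x N) \<longrightarrow> a dvd N)"
proof -
  obtain e P c where P: "line_poly e a P" and lead: "lead_coeff P = pconst c" and c: "c \<noteq> 0"
    using monic_line_ex[OF assms] by blast
  have spec_P: "spec x P = line_restrict e x a" for x using P by (rule line_poly_spec)
  have deg: "degree (spec x P) = degree P" and nz: "spec x P \<noteq> 0" for x
  proof -
    show "degree (spec x P) = degree P"
      by (rule degree_map_poly_lead) (simp_all add: lead c)
    have "lead_coeff (spec x P) = c"
      using degree_map_poly_lead(2)[of "\<lambda>c. ev c x" P] by (simp add: lead c)
    then show "spec x P \<noteq> 0" using c by auto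
  qed
  have "a dvd N" if dvd: "\<And>x. line_restrict e x a dvd line_restrict e x N" for N
  proof -
    obtain Q where Q: "line_poly e N Q" using line_poly_ex by blast
    have one: "pconst c * pconst (1 / c) = (1 :: 'a pfun)"
      using c by (intro pfun_eqI) simp
    then have nzc: "pconst (1 / c) \<noteq> (0 :: 'a pfun)" by auto
    have "lead_coeff (Polynomial.smult (pconst (1 / c)) P) = 1"
      using lead one nzc by (simp add: mult.commute)
    from monic_division[OF this, of Q] obtain U R where
      UR: "Q = Polynomial.smult (pconst (1 / c)) P * U + R"
      and R: "R = 0 \<or> degree R < degree P"
      using nzc by auto
    define V where "V = Polynomial.smult (pconst (1 / c)) U"
    have QV: "Q = P * V + R" by (simp add: UR V_def)
    have "R = 0"
    proof (rule spec_eq_0_imp)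
      fix x
      have "spec x P dvd spec x Q"
        using dvd[of x] by (simp add: spec_P line_poly_spec[OF Q])
      then have "spec x P dvd spec x R"
        unfolding QV by (simp add: dvd_add_right_iff)
      moreover have "R = 0 \<or> degree (spec x R) < degree (spec x P)"
        using R degree_map_poly_le[of "\<lambda>c. ev c x" R] unfolding deg by auto
      ultimately show "spec x R = 0"
        using dvd_imp_degree_le[of "spec x P" "spec x R"] by (cases "spec x R = 0") auto
    qed
    then have "coeff Q 0 = coeff P 0 * coeff V 0" unfolding QV by (simp add: coeff_mult)
    then show "a dvd N" using line_poly_at_0[OF P] line_poly_at_0[OF Q] by simp
  qed
  then show ?thesis using nz spec_P by metis
qed

text \<open>Gauss's lemma. \<open>F\<close> is primitive, so the contents of \<open>G\<close> and
  \<open>H\<close> multiply to \<open>a ^ k\<close> up to a unit. Comparing leading coefficients,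
  the content of \<open>H\<close> divides \<open>a ^ (k - 1)\<close> when \<open>k > 0\<close>,
  which leaves a factor \<open>a\<close> for the content of \<open>G\<close>.\<close>

lemma lead_dvd_coeffs:
  fixes F G H :: "complex poly poly"
  assumes eq: "Polynomial.smult (a ^ k) F = G * H" and F: "lead_coeff F dvd 1"
    and a: "lead_coeff G = a" "a \<noteq> 0"
  shows "a dvd coeff G i"
proof -
  have "content F dvd 1" by (rule dvd_trans[OF content_dvd_coeff F])
  then have cF: "content F = 1" by (metis is_unit_content_iff)
  have c: "normalize (a ^ k) = content G * content H"
    using arg_cong[OF eq, of content] by (simp add: content_mult cF)
  have lead: "a ^ k * lead_coeff F = a * lead_coeff H"
    using arg_cong[OF eq, of lead_coeff] a(2) by (simp add: lead_coeff_mult a(1))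
  show ?thesis
  proof (cases k)
    case 0
    then have "a dvd lead_coeff F" using lead by simp
    then have "a dvd 1" using F dvd_trans by blast
    then show ?thesis using dvd_trans one_dvd by blast
  next
    case (Suc k')
    then have "a ^ k' * lead_coeff F = lead_coeff H" using lead a(2) by simp
    then have "content H dvd a ^ k' * lead_coeff F" by (metis content_dvd_coeff)
    then have "content H dvd a ^ k'"
      using F by (simp add: dvd_mult_unit_iff)
    then obtain u where u: "a ^ k' = content H * u" unfolding dvd_def by blast
    have "a ^ k dvd content G * content H" using c by (metis dvd_normalize_iff dvd_refl)
    then have "content H * (a * u) dvd content H * content G"
      using u Suc by (simp add: mult_ac)
    moreover have "content H \<noteq> 0" using u a(2) by auto
    ultimately have "a * u dvd content G" by simp
    then show ?thesis by (meson content_dvd_coeff dvd_mult_left dvd_trans)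
  qed
qed

text \<open>If \<open>P\<close> is the line polynomial of a function, this evaluation returns the
  function itself. It thus turns a factorization of line polynomials into one of functions.\<close>

lemma line_poly_translate:
  "\<exists>h. \<forall>x. ev h x = poly (spec (x - t *s e) P) t"
proof -
  have "polyfun coords (\<lambda>x. ev (coeff P n) (x - t *s e))" for n
    by (rule polyfun_compose[OF polyfun_ev]) (auto intro!: polyfun_diff[OF polyfun_gen polyfun_const])
  then have "polyfun coords (\<lambda>x. \<Sum>n\<le>degree P. ev (coeff P n) (x - t *s e) * t ^ n)"
    by (intro polyfun_sum polyfun_mult polyfun_const) blast
  moreover have "poly (spec y P) t = (\<Sum>n\<le>degree P. ev (coeff P n) y * t ^ n)" for y
    using poly_eq_sum_upto[of "spec y P" "degree P" t] degree_map_poly_le[of "\<lambda>c. ev c y" P]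
    by (simp add: coeff_map_poly)
  ultimately show ?thesis
    by (intro exI[of _ "Pfun (\<lambda>x. \<Sum>n\<le>degree P. ev (coeff P n) (x - t *s e) * t ^ n)"]) (simp add: ev_Pfun)
qed

text \<open>Without a common factor the common zeros have codimension at least two, so the lines of
  direction \<open>e\<close> that meet them stay inside a proper algebraic subset.\<close>

lemma line_avoiding_common_zeros:
  fixes F :: "'k::finite \<Rightarrow> 'n::finite pfun"
  assumes coprime: "\<And>h. (\<And>j. h dvd F j) \<Longrightarrow> h dvd 1"
    and P0: "line_poly e (F j0) P0" "lead_coeff P0 = pconst c" "c \<noteq> 0"
  shows "\<exists>s. s \<noteq> 0 \<and> (\<forall>x. ev s x \<noteq> 0 \<longrightarrow> (\<forall>t. \<exists>j. ev (F j) (x + t *s e) \<noteq> 0))"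
proof -
  have "\<forall>j. \<exists>P. line_poly e (F j) P" using line_poly_ex by blast
  from choice[OF this] obtain P where P: "\<And>j. line_poly e (F j) (P j)" by blast
  have PP: "P j0 = P0"
  proof -
    have "spec x (P j0 - P0) = 0" for x
    proof -
      have "spec x P0 + spec x (P j0 - P0) = spec x P0"
        unfolding spec_add[symmetric] using line_poly_spec[OF P[of j0]] line_poly_spec[OF P0(1)] by simp
      then show ?thesis by simp
    qed
    from spec_eq_0_imp[OF this] show ?thesis by simp
  qed
  \<comment> \<open>An element of minimal degree in the ideal of the \<open>P j\<close>: if it is constant in the line parameter,
    it is the required \<open>s\<close>; otherwise, divided by its leading coefficient, it is a common divisor.\<close>
  define J where "J = {G. G \<noteq> 0 \<and> (\<exists>U. G = (\<Sum>j\<in>UNIV. U j * P j))}"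
  have JI: "G \<in> J" if "G \<noteq> 0" "G = (\<Sum>j\<in>UNIV. U j * P j)" for G U
    unfolding J_def using that by blast
  have combI: "U * (\<Sum>j\<in>UNIV. V j * P j) - W * P i = (\<Sum>j\<in>UNIV. (U * V j - (if j = i then W else 0)) * P j)" for U V W i
    by (simp add: left_diff_distrib sum_subtractf sum_distrib_left mult.assoc if_distrib[of "\<lambda>x. x * _"] cong: if_cong)
  have "P j0 \<in> J"
  proof -
    have "P j0 \<noteq> 0" using P0(2,3) PP by (auto simp: pfun_nonzero dest!: arg_cong[of _ _ "\<lambda>f. ev f 0"])
    moreover have "P j0 = (\<Sum>j\<in>UNIV. (if j = j0 then 1 else 0) * P j)"
      by (simp add: if_distrib[of "\<lambda>x. x * _"] cong: if_cong)
    ultimately show ?thesis by (rule JI)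
  qed
  then obtain G where GJ: "G \<in> J" and Gmin: "\<And>H. H \<in> J \<Longrightarrow> degree G \<le> degree H"
    using ex_has_least_nat[of "\<lambda>G. G \<in> J" "P j0" degree] by blast
  obtain U where U: "G = (\<Sum>j\<in>UNIV. U j * P j)" and "G \<noteq> 0" using GJ by (auto simp: J_def)
  define a where "a = lead_coeff G"
  have "a \<noteq> 0" using \<open>G \<noteq> 0\<close> by (simp add: a_def)
  have div: "\<exists>k H. Polynomial.smult (a ^ k) (P j) = G * H" for j
  proof -
    obtain H R where "pseudo_divmod (P j) G = (H, R)" by fastforce
    from pseudo_divmod[OF \<open>G \<noteq> 0\<close> this] obtain k where
      k: "Polynomial.smult (a ^ k) (P j) = G * H + R" and R: "R = 0 \<or> degree R < degree G"
      unfolding a_def by blast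
    have "R = 0"
    proof (rule ccontr)
      assume "R \<noteq> 0"
      have "- R = H * G - [:a ^ k:] * P j" using k by (simp add: algebra_simps)
      then have "- R = (\<Sum>i\<in>UNIV. (H * U i - (if i = j then [:a ^ k:] else 0)) * P i)"
        unfolding U combI .
      then have "- R \<in> J" by (rule JI[rotated]) (simp add: \<open>R \<noteq> 0\<close>)
      then show False using Gmin[of "- R"] R \<open>R \<noteq> 0\<close> by simp
    qed
    then show ?thesis using k by auto
  qed
  show ?thesis
  proof (cases "degree G = 0")
    case True
    then have G: "G = [:a:]" unfolding a_def by (metis degree_eq_zeroE lead_coeff_pCons(2) pCons_0_0)
    have "\<exists>j. ev (F j) (x + t *s e) \<noteq> 0" if "ev a x \<noteq> 0" for x t
    proof (rule ccontr)
      assume "\<not> ?thesis"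
      then have "poly (spec x (P j)) t = 0" for j using P[of j] by (simp add: line_poly_def)
      then have "poly (spec x G) t = 0" unfolding U by (simp add: poly_sum)
      then show False using that by (simp add: G map_poly_pCons)
    qed
    then show ?thesis using \<open>a \<noteq> 0\<close> by blast
  next
    case False
    obtain e2 where e2: "\<And>x. line_restrict e2 x a \<noteq> 0"
      and dvdI: "\<And>N. (\<And>x. line_restrict e2 x a dvd line_restrict e2 x N) \<Longrightarrow> a dvd N"
      using dvd_if_dvd_on_lines[OF \<open>a \<noteq> 0\<close>] by blast
    obtain k H where kH: "Polynomial.smult (a ^ k) (P j0) = G * H" using div by blast
    \<comment> \<open>On lines of direction \<open>e2\<close> the coefficients become polynomials in
      one variable, where Gauss's lemma is available; \<open>dvdI\<close> transfers the result
      back.\<close>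
    have "a dvd coeff G i" for i
    proof (rule dvdI)
      fix x
      let ?\<rho> = "line_restrict e2 x"
      have "map_poly ?\<rho> (Polynomial.smult (a ^ k) (P j0)) = Polynomial.smult (?\<rho> a ^ k) (map_poly ?\<rho> (P j0))"
        by (rule poly_eqI) (simp add: coeff_map_poly)
      then have "Polynomial.smult (?\<rho> a ^ k) (map_poly ?\<rho> (P j0)) = map_poly ?\<rho> G * map_poly ?\<rho> H"
        unfolding kH by (simp add: map_poly_mult_hom)
      moreover have "lead_coeff (map_poly ?\<rho> (P j0)) = [:c:]"
        using degree_map_poly_lead(2)[of ?\<rho> "P j0"] P0(2,3) by (simp add: PP)
      moreover have "lead_coeff (map_poly ?\<rho> G) = ?\<rho> a"
        using degree_map_poly_lead(2)[of ?\<rho> G] e2[of x] by (simp add: a_def)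
      ultimately have "?\<rho> a dvd coeff (map_poly ?\<rho> G) i"
        using P0(3) e2[of x] by (intro lead_dvd_coeffs) (auto simp: is_unit_pCons_iff)
      then show "?\<rho> a dvd ?\<rho> (coeff G i)" by (simp add: coeff_map_poly)
    qed
    then obtain G' where G': "G = Polynomial.smult a G'"
      by (metis const_poly_dvd_iff dvdE mult_pCons_left mult_zero_left pCons_0_0 add.right_neutral)
    have lead: "lead_coeff G' = 1"
    proof -
      have "a * lead_coeff G' = a * 1" using a_def \<open>a \<noteq> 0\<close> by (simp add: G')
      then show ?thesis using \<open>a \<noteq> 0\<close> mult_left_cancel by blast
    qed
    have degG': "degree G' > 0" using False \<open>a \<noteq> 0\<close> by (simp add: G')
    have dvd: "\<exists>V. P j = G' * V" for j
    proof -
      obtain k H where kH: "Polynomial.smult (a ^ k) (P j) = G * H" using div by blast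
      obtain V R where VR: "P j = G' * V + R" and R: "R = 0 \<or> degree R < degree G'"
        using monic_division[OF lead] by blast
      have "Polynomial.smult (a ^ k) R = G' * (Polynomial.smult a H - Polynomial.smult (a ^ k) V)"
        using kH unfolding VR G' by (simp add: algebra_simps smult_add_right)
      then have "G' dvd Polynomial.smult (a ^ k) R" by simp
      have "R = 0"
      proof (rule ccontr)
        assume "R \<noteq> 0"
        with \<open>a \<noteq> 0\<close> have "degree G' \<le> degree R"
          using dvd_imp_degree_le[OF \<open>G' dvd Polynomial.smult (a ^ k) R\<close>] by simp
        then show False using R \<open>R \<noteq> 0\<close> by simp
      qed
      then show ?thesis using VR by auto
    qed
    have "degree (spec 0 G') > 0"
      using degree_map_poly_lead(1)[of "\<lambda>c. ev c 0" G'] lead degG' by simp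
    \<comment> \<open>A zero of \<open>G'\<close> over the base point 0. It makes the common divisor
      \<open>h\<close> built from \<open>G'\<close> vanish at \<open>t *s e\<close>, so
      \<open>h\<close> is not a unit.\<close>
    then obtain t where t: "poly (spec 0 G') t = 0"
      using fundamental_theorem_of_algebra[of "spec 0 G'"] by (auto simp: constant_degree)
    obtain h where h: "\<And>x. ev h x = poly (spec (x - t *s e) G') t" using line_poly_translate by blast
    have "h dvd F j" for j
    proof -
      obtain V where V: "P j = G' * V" using dvd by blast
      obtain h' where h': "\<And>x. ev h' x = poly (spec (x - t *s e) V) t" using line_poly_translate by blast
      have "F j = h * h'"
      proof (rule pfun_eqI)
        fix x
        have "ev (F j) x = poly (spec (x - t *s e) (P j)) t" using P[of j] by (simp add: line_poly_def)
        then show "ev (F j) x = ev (h * h') x" by (simp add: V h h')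
      qed
      then show ?thesis by simp
    qed
    then have "h dvd 1" by (rule coprime)
    then obtain g where "1 = h * g" unfolding dvd_def by blast
    from arg_cong[OF this, of "\<lambda>f. ev f (t *s e)"] have False using t by (simp add: h)
    then show ?thesis ..
  qed
qed

section \<open>The sharp monomial map\<close>

text \<open>Coefficients of the Lucas polynomials \<open>\<alpha>\<^sup>m + \<beta>\<^sup>m\<close> in \<open>\<alpha> + \<beta>\<close> and \<open>- \<alpha> \<beta>\<close>.\<close>

fun lucas_coeff :: "nat \<Rightarrow> nat \<Rightarrow> real" where
  "lucas_coeff 0 s = (if s = 0 then 2 else 0)"
| "lucas_coeff (Suc 0) s = (if s = 0 then 1 else 0)"
| "lucas_coeff (Suc (Suc m)) 0 = lucas_coeff (Suc m) 0"
| "lucas_coeff (Suc (Suc m)) (Suc s) = lucas_coeff (Suc m) (Suc s) + lucas_coeff m s"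

lemma lucas_coeff_nonneg: "lucas_coeff m s \<ge> 0"
  by (induction m s rule: lucas_coeff.induct) auto

lemma lucas_coeff_eq_0: "m < 2 * s \<Longrightarrow> lucas_coeff m s = 0"
  by (induction m s rule: lucas_coeff.induct) auto

lemma lucas_coeff_Suc_0: "lucas_coeff (Suc m) 0 = 1"
  by (induction m) auto

text \<open>With \<open>\<alpha> = T\<close> and \<open>\<beta> = - y\<close> one has
  \<open>\<alpha> + \<beta> = x\<close> and \<open>- \<alpha> * \<beta> = y * T\<close>, and both
  sides satisfy the recurrence with these coefficients. The bound on \<open>m\<close> makes the sum
  contain all nonzero terms.\<close>

lemma lucas_identity:
  fixes x y T :: complex
  assumes "x + y = T"
  shows "m \<le> 2 * S + 1 \<Longrightarrow> (\<Sum>s\<le>S. of_real (lucas_coeff m s) * x ^ (m - 2 * s) * (y * T) ^ s) = T ^ m + (- y) ^ m"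
proof (induction m arbitrary: S rule: less_induct)
  case (less m)
  consider "m = 0" | "m = 1" | k where "m = Suc (Suc k)" by (metis One_nat_def not0_implies_Suc)
  then show ?case
  proof cases
    case 1
    have "(\<Sum>s\<le>S. of_real (lucas_coeff m s) * x ^ (m - 2 * s) * (y * T) ^ s) = (\<Sum>s\<le>S. if s = 0 then 2 else 0)"
      unfolding 1 by (intro sum.cong) auto
    then show ?thesis by (simp add: 1)
  next
    case 2
    have "(\<Sum>s\<le>S. of_real (lucas_coeff m s) * x ^ (m - 2 * s) * (y * T) ^ s) = (\<Sum>s\<le>S. if s = 0 then x else 0)"
      unfolding 2 by (intro sum.cong) auto
    then show ?thesis using assms by (simp add: 2 algebra_simps)
  next
    case (3 k)
    obtain S' where S: "S = Suc S'" using less.prems 3 by (cases S) auto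
    \<comment> \<open>Because of truncated subtraction the exponents do not match when
      \<open>2 * Suc s > Suc k\<close>, but then the coefficient is 0.\<close>
    have a: "of_real (lucas_coeff (Suc k) (Suc s)) * x ^ (k - 2 * s) = x * (of_real (lucas_coeff (Suc k) (Suc s)) * x ^ (Suc k - 2 * Suc s))" for s
    proof (cases "2 * Suc s \<le> Suc k")
      case True
      then have "k - 2 * s = Suc (Suc k - 2 * Suc s)" by simp
      then show ?thesis by simp
    next
      case False
      then show ?thesis by (simp add: lucas_coeff_eq_0)
    qed
    have "(\<Sum>s\<le>S. of_real (lucas_coeff m s) * x ^ (m - 2 * s) * (y * T) ^ s) =
      of_real (lucas_coeff (Suc k) 0) * x ^ Suc (Suc k) +
        (\<Sum>s\<le>S'. of_real (lucas_coeff (Suc k) (Suc s) + lucas_coeff k s) * x ^ (k - 2 * s) * (y * T) ^ Suc s)"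
      unfolding 3 S by (subst sum.atMost_Suc_shift) simp
    also have "\<dots> = x * (of_real (lucas_coeff (Suc k) 0) * x ^ Suc k +
        (\<Sum>s\<le>S'. of_real (lucas_coeff (Suc k) (Suc s)) * x ^ (Suc k - 2 * Suc s) * (y * T) ^ Suc s))
      + y * T * (\<Sum>s\<le>S'. of_real (lucas_coeff k s) * x ^ (k - 2 * s) * (y * T) ^ s)"
    proof -
      have "of_real (lucas_coeff (Suc k) (Suc s) + lucas_coeff k s) * x ^ (k - 2 * s) * (y * T) ^ Suc s =
        x * (of_real (lucas_coeff (Suc k) (Suc s)) * x ^ (Suc k - 2 * Suc s) * (y * T) ^ Suc s)
        + y * T * (of_real (lucas_coeff k s) * x ^ (k - 2 * s) * (y * T) ^ s)" for s
      proof -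
        have "of_real (lucas_coeff (Suc k) (Suc s) + lucas_coeff k s) * x ^ (k - 2 * s) * (y * T) ^ Suc s =
          (of_real (lucas_coeff (Suc k) (Suc s)) * x ^ (k - 2 * s)) * (y * T) ^ Suc s
          + y * T * (of_real (lucas_coeff k s) * x ^ (k - 2 * s) * (y * T) ^ s)"
          by (simp add: algebra_simps)
        then show ?thesis unfolding a by (simp only: mult.assoc)
      qed
      then show ?thesis
        by (simp add: sum.distrib distrib_left sum_distrib_left del: power_Suc of_real_add) (simp add: mult_ac)
    qed
    also have "of_real (lucas_coeff (Suc k) 0) * x ^ Suc k +
        (\<Sum>s\<le>S'. of_real (lucas_coeff (Suc k) (Suc s)) * x ^ (Suc k - 2 * Suc s) * (y * T) ^ Suc s) =
        (\<Sum>s\<le>S. of_real (lucas_coeff (Suc k) s) * x ^ (Suc k - 2 * s) * (y * T) ^ s)"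
      unfolding S by (subst sum.atMost_Suc_shift) simp
    also have "\<dots> = T ^ Suc k + (- y) ^ Suc k"
      using less.prems 3 by (intro less.IH) auto
    also have "(\<Sum>s\<le>S'. of_real (lucas_coeff k s) * x ^ (k - 2 * s) * (y * T) ^ s) = T ^ k + (- y) ^ k"
      using less.prems 3 S by (intro less.IH) auto
    also have "x * (T ^ Suc k + (- y) ^ Suc k) + y * T * (T ^ k + (- y) ^ k) = T ^ m + (- y) ^ m"
    proof -
      have x: "x = T - y" using assms by (simp add: eq_diff_eq)
      show ?thesis unfolding 3 x by (simp add: algebra_simps)
    qed
    finally show ?thesis .
  qed
qed

text \<open>Put the squared moduli of \<open>z\<close>, \<open>w\<close>, \<open>t\<close> for
  \<open>x\<close>, \<open>y\<close>, \<open>T\<close> in \<open>lucas_identity\<close>. For odd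
  \<open>D\<close> the term \<open>(- y) ^ D\<close> moves to the other side as the squared modulus
  of \<open>w ^ D\<close>. The \<open>r + 1\<close> Lucas terms and \<open>w ^ D\<close> make
  \<open>r + 2\<close> components for \<open>D = 2 * r + 1\<close>. The last component is constant
  where \<open>w\<close> is, and the first one gives the direction at infinity; both facts serve to
  position the curve.\<close>

lemma sharp_map_ex:
  assumes n: "CARD('n::finite) \<ge> 2"
  defines "D \<equiv> 2 * CARD('n) - 3"
  shows "\<exists>(h :: complex \<times> complex \<times> complex \<Rightarrow> complex ^ 'n) first last. first \<noteq> last \<and>
    (\<forall>i. polyfun gens3 (\<lambda>x. vec_nth (h x) i)) \<and>
    (\<forall>c z w t. h (c * z, c * w, c * t) = c ^ D *s h (z, w, t)) \<and>
    (\<forall>z w t. z * cnj z + w * cnj w = t * cnj t \<longrightarrow>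
      (\<Sum>i\<in>UNIV. vec_nth (h (z, w, t)) i * cnj (vec_nth (h (z, w, t)) i)) = (t * cnj t) ^ D) \<and>
    (\<forall>z w t. vec_nth (h (z, w, t)) last = w ^ D) \<and>
    (\<forall>z. h (z, 0, 0) = z ^ D *s axis first 1)"
proof -
  define r where "r = CARD('n) - 2"
  have card: "CARD('n) = Suc (Suc r)" using n by (simp add: r_def)
  have D: "D = 2 * r + 1" using n by (simp add: D_def r_def)
  obtain idx where idx: "bij_betw idx (UNIV :: 'n set) {0..<Suc (Suc r)}"
    using ex_bij_betw_finite_nat[of "UNIV :: 'n set"] card by auto
  define comp where "comp s x = (case x of (z, w, t) \<Rightarrow> if s = Suc r then w ^ D
      else complex_of_real (sqrt (lucas_coeff D s)) * z ^ (D - 2 * s) * (w * t) ^ s)" for s x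
  define h :: "complex \<times> complex \<times> complex \<Rightarrow> complex ^ 'n" where "h x = (\<chi> i. comp (idx i) x)" for x
  have h: "vec_nth (h x) i = comp (idx i) x" for x i by (simp add: h_def)
  have idx_le: "idx i \<le> Suc r" for i using bij_betwE[OF idx] by (force simp: less_Suc_eq_le)
  obtain first last where fl: "idx first = 0" "idx last = Suc r"
    using bij_betw_imp_surj_on[OF idx] by (metis (no_types, lifting) atLeastLessThan_iff imageE lessI zero_le zero_less_Suc)
  have idx_eq: "idx i = idx j \<longleftrightarrow> i = j" for i j using bij_betw_imp_inj_on[OF idx] by (auto dest: injD)
  show ?thesis
  proof (rule exI[of _ h], rule exI[of _ first], rule exI[of _ last], intro conjI allI impI)
    show "first \<noteq> last" using fl by auto
    show "polyfun gens3 (\<lambda>x. vec_nth (h x) i)" for i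
    proof (cases "idx i = Suc r")
      case True
      then show ?thesis
        unfolding h comp_def case_prod_unfold by (simp add: polyfun_power polyfun_gens3)
    next
      case False
      then show ?thesis
        unfolding h comp_def case_prod_unfold
        by simp (intro polyfun_power polyfun_mult polyfun_const polyfun_gens3)
    qed
    show "h (c * z, c * w, c * t) = c ^ D *s h (z, w, t)" for c z w t
    proof -
      have "comp s (c * z, c * w, c * t) = c ^ D * comp s (z, w, t)" if "s \<le> Suc r" for s
      proof (cases "s = Suc r")
        case False
        then have "c ^ D = c ^ (D - 2 * s) * (c ^ s * c ^ s)"
          using that D by (simp flip: power_add)
        then show ?thesis using False by (simp add: comp_def power_mult_distrib mult_ac)
      qed (simp add: comp_def power_mult_distrib)
      then show ?thesis by (simp add: Finite_Cartesian_Product.vec_eq_iff h idx_le)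
    qed
    show "vec_nth (h (z, w, t)) last = w ^ D" for z w t by (simp add: h fl comp_def)
    show "h (z, 0, 0) = z ^ D *s axis first 1" for z
    proof -
      have "comp (idx i) (z, 0, 0) = z ^ D * (if i = first then 1 else 0)" for i
        using fl(1) idx_eq[of i first] D by (auto simp: comp_def lucas_coeff_Suc_0)
      then show ?thesis by (simp add: Finite_Cartesian_Product.vec_eq_iff h axis_def)
    qed
    show "(\<Sum>i\<in>UNIV. vec_nth (h (z, w, t)) i * cnj (vec_nth (h (z, w, t)) i)) = (t * cnj t) ^ D"
      if eq: "z * cnj z + w * cnj w = t * cnj t" for z w t
    proof -
      define c where "c s = comp s (z, w, t) * cnj (comp s (z, w, t))" for s
      have "(\<Sum>i\<in>UNIV. c (idx i)) = (\<Sum>s\<in>{0..<Suc (Suc r)}. c s)"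
        by (rule sum.reindex_bij_betw[OF idx])
      also have "\<dots> = (\<Sum>s\<le>r. c s) + c (Suc r)"
        by (simp add: atLeast0LessThan lessThan_Suc_atMost)
      also have "(\<Sum>s\<le>r. c s) = (\<Sum>s\<le>r. of_real (lucas_coeff D s) * (z * cnj z) ^ (D - 2 * s) * (w * cnj w * (t * cnj t)) ^ s)"
      proof (rule sum.cong)
        fix s assume s: "s \<in> {..r}"
        define k where "k = complex_of_real (sqrt (lucas_coeff D s))"
        have k: "cnj k = k" by (simp add: k_def)
        have kk: "k * k = of_real (lucas_coeff D s)"
          unfolding k_def of_real_mult[symmetric] using lucas_coeff_nonneg by simp
        have "c s = (k * k) * (z * cnj z) ^ (D - 2 * s) * (w * cnj w * (t * cnj t)) ^ s"
          using s by (simp add: c_def comp_def k_def[symmetric] k power_mult_distrib mult_ac)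
        then show "c s = of_real (lucas_coeff D s) * (z * cnj z) ^ (D - 2 * s) * (w * cnj w * (t * cnj t)) ^ s"
          unfolding kk .
      qed simp
      also have "\<dots> = (t * cnj t) ^ D + (- (w * cnj w)) ^ D"
        by (rule lucas_identity) (use eq D in auto)
      also have "c (Suc r) = (w * cnj w) ^ D" by (simp add: c_def comp_def power_mult_distrib)
      finally show ?thesis using D by (simp add: h c_def)
    qed
  qed
qed

section \<open>Unitary maps\<close>

definition hip :: "complex ^ 'n::finite \<Rightarrow> complex ^ 'n \<Rightarrow> complex" where
  "hip x y = (\<Sum>i\<in>UNIV. vec_nth x i * cnj (vec_nth y i))"

lemma hip_linear [simp]:
  "hip (x + y) z = hip x z + hip y z" "hip (x - y) z = hip x z - hip y z" "hip (c *s x) z = c * hip x z"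
  "hip z (x + y) = hip z x + hip z y" "hip z (x - y) = hip z x - hip z y" "hip z (c *s x) = cnj c * hip z x"
  by (simp_all add: hip_def algebra_simps sum.distrib sum_subtractf sum_distrib_left)

lemma hip_cnj: "cnj (hip x y) = hip y x"
  by (simp add: hip_def mult.commute)

lemma hip_self: "hip x x = complex_of_real ((norm x)\<^sup>2)"
proof -
  have "hip x x = complex_of_real (\<Sum>i\<in>UNIV. (cmod (vec_nth x i))\<^sup>2)"
    by (simp only: hip_def of_real_sum complex_norm_square)
  also have "(\<Sum>i\<in>UNIV. (cmod (vec_nth x i))\<^sup>2) = (norm x)\<^sup>2"
    by (simp add: norm_vec_def L2_set_def sum_nonneg)
  finally show ?thesis .
qed

lemma hip_self_eq_0: "hip x x = 0 \<longleftrightarrow> x = 0"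
  by (simp add: hip_self)

lemma hip_normalize:
  assumes "x \<noteq> 0"
  obtains c where "c \<noteq> 0" "hip (c *s x) (c *s x) = 1"
proof
  show "complex_of_real (1 / norm x) \<noteq> 0" using assms by simp
  show "hip (complex_of_real (1 / norm x) *s x) (complex_of_real (1 / norm x) *s x) = 1"
    unfolding hip_linear(3,6) unfolding hip_self using assms by (simp add: power2_eq_square)
qed

definition unitary_map :: "(complex ^ 'n::finite \<Rightarrow> complex ^ 'n) \<Rightarrow> bool" where
  "unitary_map A \<longleftrightarrow> (\<forall>x y. A (x + y) = A x + A y) \<and> (\<forall>c x. A (c *s x) = c *s A x) \<and>
    (\<forall>x y. hip (A x) (A y) = hip x y)"

lemma unitary_map_compose: "unitary_map A \<Longrightarrow> unitary_map B \<Longrightarrow> unitary_map (\<lambda>x. A (B x))"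
  by (simp add: unitary_map_def)

lemma unitary_map_polyfun:
  assumes A: "unitary_map A" and z: "\<And>i. polyfun G (\<lambda>x. vec_nth (z x) i)"
  shows "polyfun G (\<lambda>x. vec_nth (A (z x)) j)"
proof -
  have "A 0 = 0 *s A 0" using A unfolding unitary_map_def by (metis vector_smult_lzero)
  then have A0: "A 0 = 0" by simp
  have sum: "A (\<Sum>i\<in>I. f i) = (\<Sum>i\<in>I. A (f i))" for I and f :: "'a \<Rightarrow> complex ^ 'a"
    using A by (induction I rule: infinite_finite_induct) (auto simp: A0 unitary_map_def)
  have comp: "vec_nth (A x) j = (\<Sum>i\<in>UNIV. vec_nth x i * vec_nth (A (axis i 1)) j)" for x
  proof -
    have "A x = A (\<Sum>i\<in>UNIV. vec_nth x i *s axis i 1)" by (simp only: basis_expansion)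
    also have "\<dots> = (\<Sum>i\<in>UNIV. vec_nth x i *s A (axis i 1))"
      unfolding sum using A by (simp add: unitary_map_def)
    finally show ?thesis by simp
  qed
  have eq: "(\<lambda>x. vec_nth (A (z x)) j) = (\<lambda>x. \<Sum>i\<in>UNIV. vec_nth (z x) i * vec_nth (A (axis i 1)) j)"
    by (rule ext) (rule comp)
  show ?thesis unfolding eq by (intro polyfun_sum polyfun_mult polyfun_const z)
qed

text \<open>A complex reflection along \<open>u - v\<close>. Dividing by \<open>\<kappa>\<close>,
  which need not be real, makes \<open>u\<close> go exactly to \<open>v\<close>; the map is unitary
  because \<open>hip w w = \<kappa> + cnj \<kappa>\<close>.\<close>

lemma unitary_reflection:
  assumes u: "hip u u = 1" and v: "hip v v = 1"
  shows "\<exists>A. unitary_map A \<and> A u = v \<and> (\<forall>x. hip x u = 0 \<longrightarrow> hip x v = 0 \<longrightarrow> A x = x)"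
proof (cases "u = v")
  case True
  then show ?thesis by (intro exI[of _ "\<lambda>x. x"]) (simp add: unitary_map_def)
next
  case False
  define w where "w = u - v"
  define \<kappa> where "\<kappa> = hip u w"
  have ww: "hip w w = \<kappa> + cnj \<kappa>" by (simp add: \<kappa>_def w_def u v hip_cnj)
  have "\<kappa> \<noteq> 0"
  proof
    assume "\<kappa> = 0"
    then have "w = 0" using ww by (simp add: hip_self_eq_0)
    then show False using False by (simp add: w_def)
  qed
  define A where "A x = x - (hip x w / \<kappa>) *s w" for x
  have "hip (A x) (A y) = hip x y" for x y
  proof -
    define \<alpha> \<beta> where "\<alpha> = hip x w / \<kappa>" and "\<beta> = hip y w / \<kappa>"
    have x: "hip x w = \<alpha> * \<kappa>" and y: "hip w y = cnj (\<beta> * \<kappa>)"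
      using \<open>\<kappa> \<noteq> 0\<close> by (simp_all add: \<alpha>_def \<beta>_def hip_cnj)
    show ?thesis
      unfolding A_def \<alpha>_def[symmetric] \<beta>_def[symmetric] hip_linear x y ww by (simp add: algebra_simps)
  qed
  then have "unitary_map A"
    unfolding unitary_map_def
    by (auto simp: A_def Finite_Cartesian_Product.vec_eq_iff algebra_simps add_divide_distrib)
  moreover have "A u = v" using \<open>\<kappa> \<noteq> 0\<close> by (simp add: A_def \<kappa>_def[symmetric]) (simp add: w_def)
  moreover have "A x = x" if "hip x u = 0" "hip x v = 0" for x using that by (simp add: A_def w_def)
  ultimately show ?thesis by blast
qed

text \<open>Two reflections suffice: the second one fixes \<open>u\<close>, which is orthogonal to
  both \<open>A b\<close> and \<open>v\<close>.\<close>

lemma unitary_pair: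
  assumes "hip a a = 1" "hip b b = 1" "hip a b = 0" "hip u u = 1" "hip v v = 1" "hip u v = 0"
  shows "\<exists>A. unitary_map A \<and> A a = u \<and> A b = v"
proof -
  obtain A where A: "unitary_map A" "A a = u" using unitary_reflection[of a u] assms by blast
  have "hip (A b) (A b) = 1" "hip u (A b) = 0"
    using A assms by (auto simp: unitary_map_def)
  then obtain B where B: "unitary_map B" "B (A b) = v" "B u = u"
    using unitary_reflection[of "A b" v] assms by blast
  show ?thesis
    using A B by (intro exI[of _ "\<lambda>x. B (A x)"]) (simp add: unitary_map_compose)
qed

lemma unitary_rotation:
  assumes e: "hip e e = 1" and l: "cmod l = 1"
  shows "unitary_map (\<lambda>x. x + ((l - 1) * hip x e) *s e)"
proof -
  have ll: "l * cnj l = 1" using l complex_norm_square[of l] by simp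
  have "hip (x + ((l - 1) * hip x e) *s e) (y + ((l - 1) * hip y e) *s e) = hip x y" for x y
  proof -
    have ye: "hip e y = cnj (hip y e)" by (simp add: hip_cnj)
    have "hip (x + ((l - 1) * hip x e) *s e) (y + ((l - 1) * hip y e) *s e)
      = hip x y + hip x e * cnj (hip y e) * (l * cnj l - 1)"
      unfolding hip_linear ye e by (simp add: algebra_simps)
    then show ?thesis by (simp add: ll)
  qed
  then show ?thesis by (simp add: unitary_map_def Finite_Cartesian_Product.vec_eq_iff algebra_simps)
qed

lemma hip_orthogonal_ex:
  fixes e :: "complex ^ 'n::finite"
  assumes n: "CARD('n) \<ge> 2" and e: "e \<noteq> 0"
  shows "\<exists>u. hip u u = 1 \<and> hip u e = 0"
proof -
  have "\<exists>i. vec_nth e i \<noteq> 0" using e by (auto simp: Finite_Cartesian_Product.vec_eq_iff)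
  then obtain i where i: "vec_nth e i \<noteq> 0" ..
  have "UNIV \<noteq> {i}"
  proof
    assume "UNIV = {i}"
    then have "CARD('n) = card {i}" by (simp only:)
    then show False using n by simp
  qed
  then obtain j where j: "j \<noteq> i" by blast
  define u :: "complex ^ 'n" where "u = cnj (vec_nth e i) *s axis j 1 - cnj (vec_nth e j) *s axis i 1"
  have ax: "hip (axis k 1) e = cnj (vec_nth e k)" for k
    by (simp add: hip_def axis_def if_distrib[of "\<lambda>x. x * _"] cong: if_cong)
  have "vec_nth u j \<noteq> 0" using i j by (simp add: u_def axis_def)
  then have "u \<noteq> 0" by auto
  moreover have "hip u e = 0" by (simp add: u_def ax)
  ultimately show ?thesis by (metis hip_normalize hip_linear(3) mult_zero_right)
qed

section \<open>Choice of the unitary map\<close>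

lemma polyfun_vec_nth: "polyfun coords (\<lambda>x. vec_nth x i)"
  by (rule polyfun_gen) blast

lemma polyfun_hip: "(\<And>i. polyfun G (\<lambda>x. vec_nth (z x) i)) \<Longrightarrow> polyfun G (\<lambda>x. hip (z x) e)"
  unfolding hip_def by (intro polyfun_sum polyfun_mult polyfun_const) blast

lemma polyfun_id1: "polyfun gens1 (\<lambda>t. t)"
  by (rule polyfun_gen) simp

lemma polyfun_nonzero_common:
  assumes "polyfun coords f" "polyfun coords g" "f x \<noteq> 0" "g y \<noteq> 0"
  shows "\<exists>z. f z \<noteq> 0 \<and> g z \<noteq> 0"
proof -
  have "Pfun f \<noteq> 0" "Pfun g \<noteq> 0" using assms by (auto simp: pfun_nonzero ev_Pfun)
  then have "Pfun f * Pfun g \<noteq> 0" by simp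
  then obtain z where "ev (Pfun f * Pfun g) z \<noteq> 0" unfolding pfun_nonzero[of "Pfun f * Pfun g"] by blast
  then show ?thesis using assms by (auto simp: ev_Pfun)
qed

lemma finite_zeros_on_curve:
  assumes "polyfun gens1 g" "g t0 \<noteq> 0"
  shows "finite {t. g t = 0}"
proof -
  obtain p where p: "g = poly p" using polyfun_univariate[OF assms(1)] by blast
  then have "p \<noteq> 0" using assms(2) by auto
  then show ?thesis unfolding p by (rule poly_roots_finite)
qed

lemma infinite_unit_circle: "infinite {l::complex. cmod l = 1}"
proof
  assume fin: "finite {l::complex. cmod l = 1}"
  have "inj_on cis {0<..<1}"
  proof (rule inj_onI)
    fix x y :: real assume "x \<in> {0<..<1}" "y \<in> {0<..<1}" "cis x = cis y"
    then have "cos x = cos y" by (metis cis.simps(1))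
    then show "x = y" using cos_inj_pi[of x y] \<open>x \<in> _\<close> \<open>y \<in> _\<close> pi_gt3 by simp
  qed
  moreover have "finite (cis ` {0<..<1})" by (rule finite_subset[OF _ fin]) auto
  ultimately have "finite {0<..<1::real}" by (simp add: finite_image_iff)
  then show False using infinite_Ioo[of 0 "1 :: real"] by simp
qed

text \<open>An orthonormal pair \<open>e'\<close>, \<open>u\<close> with \<open>e'\<close> off the
  cone is rotated in its plane; only finitely many slopes put one of the two vectors on the
  cone.\<close>

lemma orthonormal_pair_off_cone:
  fixes top :: "complex ^ 'n::finite \<Rightarrow> complex"
  assumes n: "CARD('n) \<ge> 2" and pf: "polyfun coords top"
    and hom: "\<And>c x. top (c *s x) = c ^ d * top x" and x0: "top x0 \<noteq> 0"
  shows "\<exists>e e1. hip e e = 1 \<and> hip e1 e1 = 1 \<and> hip e1 e = 0 \<and> top e \<noteq> 0 \<and> top e1 \<noteq> 0"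
proof -
  fix i :: 'n
  obtain x where x: "top x \<noteq> 0" "vec_nth x i \<noteq> 0"
    using polyfun_nonzero_common[OF pf polyfun_vec_nth x0, of "axis i 1" i] by (auto simp: axis_def)
  then have "x \<noteq> 0" by auto
  then obtain c where c: "c \<noteq> 0" "hip (c *s x) (c *s x) = 1" using hip_normalize by blast
  define e' where "e' = c *s x"
  have e': "hip e' e' = 1" "top e' \<noteq> 0" using c x by (auto simp: e'_def hom)
  have "e' \<noteq> 0" using e' by (auto simp: hip_self)
  then obtain u where u: "hip u u = 1" "hip u e' = 0" using hip_orthogonal_ex[OF n] by blast
  have eu: "hip e' u = 0" using u(2) hip_cnj[of u e'] by simp
  define g where "g t = top (e' + t *s u)" for t
  have "polyfun gens1 g"
    unfolding g_def by (rule polyfun_compose[OF pf]) (auto intro!: polyfun_add polyfun_mult polyfun_const polyfun_id1)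
  moreover have "g 0 \<noteq> 0" using e' by (simp add: g_def)
  ultimately have fin: "finite {t. g t = 0}" by (rule finite_zeros_on_curve)
  \<comment> \<open>Both \<open>y\<close> and \<open>- 1 / y\<close> have to avoid the zeros of
    \<open>g\<close>, since \<open>b\<close> is proportional to \<open>e' - (1 / y) *s u\<close>.
    The slope is taken real to keep \<open>a\<close> and \<open>b\<close> orthogonal.\<close>
  define bad where "bad = insert 0 ({t. g t = 0} \<union> (\<lambda>t. - 1 / t) ` {t. g t = 0})"
  have "finite bad" using fin by (simp add: bad_def)
  moreover have "infinite (range complex_of_real)"
    by (simp add: infinite_UNIV_char_0 finite_image_iff inj_of_real)
  ultimately obtain y where y: "complex_of_real y \<notin> bad"
    by (metis (no_types, lifting) finite_subset image_subsetI)
  define a b where "a = e' + complex_of_real y *s u" and "b = u - complex_of_real y *s e'"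
  have y0: "complex_of_real y \<noteq> 0" using y by (auto simp: bad_def)
  have a: "top a \<noteq> 0" using y by (auto simp: bad_def g_def a_def)
  have b: "top b \<noteq> 0"
  proof -
    have "g (- 1 / complex_of_real y) \<noteq> 0"
    proof
      assume "g (- 1 / complex_of_real y) = 0"
      then have "- 1 / (- 1 / complex_of_real y) \<in> bad" unfolding bad_def by blast
      then show False using y y0 by simp
    qed
    moreover have b_eq: "b = (- complex_of_real y) *s (e' + (- 1 / complex_of_real y) *s u)"
      using y0 by (simp add: b_def Finite_Cartesian_Product.vec_eq_iff algebra_simps)
    ultimately have "(- complex_of_real y) ^ d * g (- 1 / complex_of_real y) \<noteq> 0" using y0 by simp
    then show ?thesis unfolding b_eq hom g_def .
  qed
  have ba: "hip b a = 0" by (simp add: a_def b_def u e' eu)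
  have "hip a a \<noteq> 0" "hip b b \<noteq> 0"
  proof -
    have "hip a a = complex_of_real (1 + y\<^sup>2)" "hip b b = complex_of_real (1 + y\<^sup>2)"
      by (simp_all add: a_def b_def u e' eu power2_eq_square)
    moreover have "1 + y\<^sup>2 \<noteq> 0" by (metis add_nonneg_pos power_one sum_power2_eq_zero_iff zero_le_power2 zero_neq_one)
    ultimately show "hip a a \<noteq> 0" "hip b b \<noteq> 0" by (simp_all only: of_real_eq_0_iff not_False_eq_True)
  qed
  then have "a \<noteq> 0" "b \<noteq> 0" by (auto simp: hip_self_eq_0)
  obtain ca where ca: "ca \<noteq> 0" "hip (ca *s a) (ca *s a) = 1" using \<open>a \<noteq> 0\<close> using hip_normalize by blast
  obtain cb where cb: "cb \<noteq> 0" "hip (cb *s b) (cb *s b) = 1" using \<open>b \<noteq> 0\<close> using hip_normalize by blast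
  have "hip (cb *s b) (ca *s a) = 0" "top (ca *s a) \<noteq> 0" "top (cb *s b) \<noteq> 0"
    unfolding hip_linear hom using ba a b ca cb by simp_all
  with ca(2) cb(2) show ?thesis by blast
qed

text \<open>Coordinate \<open>i1\<close> is sent to the direction \<open>e\<close> of the avoiding
  lines, and \<open>i0\<close>, the direction of the curve at infinity, to a vector
  \<open>e'\<close> orthogonal to \<open>e\<close>. At \<open>e'\<close> two top forms must be
  nonzero: that of \<open>Fc j0\<close>, for the point at infinity, and that of \<open>S\<close>, so
  that the curve is not inside the zeros of \<open>S\<close>.\<close>

lemma good_unitary:
  fixes Fc :: "'k::finite \<Rightarrow> 'n::finite cpoly"
    and h :: "complex \<times> complex \<times> complex \<Rightarrow> complex ^ 'n"
  assumes n: "CARD('n) \<ge> 2"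
    and deg: "\<And>j. total_degree (Fc j) \<le> d"
    and j0: "total_degree (Fc j0) = d" "Fc j0 \<noteq> 0"
    and coprime: "\<And>g. (\<And>j. g dvd Fc j) \<Longrightarrow> g dvd 1"
    and fl: "i0 \<noteq> i1" and D: "odd D"
    and h_pf: "\<And>i. polyfun gens3 (\<lambda>x. vec_nth (h x) i)"
    and h_hom: "\<And>c z w t. h (c * z, c * w, c * t) = c ^ D *s h (z, w, t)"
    and h_last: "\<And>z w t. vec_nth (h (z, w, t)) i1 = w ^ D"
    and h_axis: "\<And>z. h (z, 0, 0) = z ^ D *s axis i0 1"
  shows "\<exists>A. unitary_map A \<and> (\<forall>r s. (r, s) \<noteq> (0, 0) \<longrightarrow>
    (\<exists>j. homogenize d (Fc j) (s ^ D) (A (h (2 * r, - s, s))) \<noteq> 0))"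
proof -
  have D0: "D > 0" using D by (cases D) auto
  \<comment> \<open>At \<open>T = 0\<close> the homogenization is the form of degree \<open>d\<close>.\<close>
  define top where "top = homogenize d (Fc j0) 0"
  have pf_top: "polyfun coords top"
    unfolding top_def by (intro polyfun_homogenize polyfun_const polyfun_vec_nth)
  have hom_top: "top (c *s x) = c ^ d * top x" for c x
    unfolding top_def using homogenize_scale[OF deg[of j0], of c 0 x] by simp
  obtain x0 where x0: "top x0 \<noteq> 0"
    using homogenize_top_nonzero[OF j0] unfolding top_def by blast
  obtain e e1 where e: "hip e e = 1" and e1: "hip e1 e1 = 1" "hip e1 e = 0" and te: "top e \<noteq> 0" "top e1 \<noteq> 0"
    using orthonormal_pair_off_cone[OF n pf_top hom_top x0] by blast
  obtain P0 where P0: "line_poly e (pfun_of (Fc j0)) P0" using line_poly_ex by blast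
  have lead: "lead_coeff P0 = pconst (top e)"
    unfolding top_def by (rule line_poly_lead[OF P0 refl deg]) (use te(1) in \<open>simp add: top_def\<close>)
  have cop: "g dvd 1" if "\<And>j. g dvd pfun_of (Fc j)" for g
  proof -
    obtain Q where Q: "g = pfun_of Q" using pfun_of_surj by blast
    have one: "pfun_of 1 = (1 :: 'n pfun)" by (rule pfun_eqI) simp
    have "Q dvd 1" using that by (intro coprime) (simp add: Q pfun_of_dvd_iff)
    then show ?thesis unfolding Q one[symmetric] pfun_of_dvd_iff .
  qed
  obtain s where s0: "s \<noteq> 0" and s: "\<And>x t. ev s x \<noteq> 0 \<Longrightarrow> \<exists>j. cpoly_eval (Fc j) (x + t *s e) \<noteq> 0"
    using line_avoiding_common_zeros[where F = "\<lambda>j. pfun_of (Fc j)", OF cop P0 lead te(1)]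
    by auto
  obtain xs where xs: "ev s xs \<noteq> 0" using s0 by (auto simp: pfun_nonzero)
  \<comment> \<open>\<open>s\<close> need not be constant along \<open>e\<close>; \<open>S\<close> is, and has the same property.\<close>
  define pr where "pr x = x - hip x e *s e" for x
  have pr_pf: "polyfun coords (\<lambda>x. vec_nth (pr x) i)" for i
    unfolding pr_def vector_minus_component vector_smult_component
    by (intro polyfun_diff polyfun_mult polyfun_const polyfun_hip polyfun_vec_nth)
  have pr_e: "pr (x + t *s e) = pr x" for x t
    by (simp add: pr_def e Finite_Cartesian_Product.vec_eq_iff algebra_simps)
  have pr_hip: "hip (pr x) e = 0" for x by (simp add: pr_def e)
  have pr_id: "pr x = x" if "hip x e = 0" for x using that by (simp add: pr_def)
  define S where "S = Pfun (\<lambda>x. ev s (pr x + hip xs e *s e))"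
  have pfS: "polyfun coords (\<lambda>x. ev s (pr x + hip xs e *s e))"
    by (rule polyfun_compose[OF polyfun_ev]) (auto intro!: polyfun_add polyfun_const pr_pf)
  have S: "ev S x = ev s (pr x + hip xs e *s e)" for x
    by (simp add: S_def ev_Pfun[OF pfS])
  have "ev S xs \<noteq> 0" using xs by (simp add: S pr_def)
  then have S0: "S \<noteq> 0" by (auto simp: pfun_nonzero)
  have Sline: "\<exists>j. cpoly_eval (Fc j) (x + t *s e) \<noteq> 0" if "ev S x \<noteq> 0" for x t
  proof -
    have eq: "(pr x + hip xs e *s e) + (t + hip x e - hip xs e) *s e = x + t *s e"
      by (simp add: pr_def Finite_Cartesian_Product.vec_eq_iff algebra_simps)
    show ?thesis
      using that s[of "pr x + hip xs e *s e" "t + hip x e - hip xs e"] unfolding S eq by blast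
  qed
  have S_e: "ev S (x + t *s e) = ev S x" for x t by (simp add: S pr_e)

  obtain Q where Q: "S = pfun_of Q" using pfun_of_surj by blast
  define k where "k = total_degree Q"
  have degQ: "total_degree Q \<le> k" by (simp add: k_def)
  have evS: "cpoly_eval Q = ev S" by (simp add: Q)
  have "Q \<noteq> 0" using S0 by (auto simp: Q pfun_nonzero)
  then obtain x1 where x1: "homogenize k Q 0 x1 \<noteq> 0"
    using homogenize_top_nonzero unfolding k_def by blast
  have topS_e: "homogenize k Q 0 (x + t *s e) = homogenize k Q 0 x" for x t
  proof -
    have pfT: "polyfun gens1 (\<lambda>T. homogenize k Q T (x + t *s e) - homogenize k Q T x)"
      by (intro polyfun_diff polyfun_homogenize polyfun_id1 polyfun_const)
    have zero: "homogenize k Q T (x + t *s e) - homogenize k Q T x = 0" if "T \<in> UNIV - {0}" for T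
    proof -
      have T: "T \<noteq> 0" using that by simp
      define x' where "x' = (1 / T) *s x"
      have 1: "x = T *s x'" using T by (simp add: x'_def vector_smult_assoc)
      have 2: "x + t *s e = T *s (x' + (t / T) *s e)"
        using T by (simp add: 1 vector_add_ldistrib vector_smult_assoc)
      show ?thesis unfolding 2 unfolding 1 homogenize_affine[OF degQ] evS S_e by simp
    qed
    have "infinite (UNIV - {0 :: complex})" by (simp add: infinite_UNIV_char_0)
    from polyfun_eq_0_if_infinite_zeros[OF pfT this zero]
    have "homogenize k Q 0 (x + t *s e) - homogenize k Q 0 x = 0" .
    then show ?thesis by simp
  qed
  have pr_topS: "homogenize k Q 0 (pr x) = homogenize k Q 0 x" for x
    using topS_e[of x "- hip x e"] by (simp add: pr_def)
  have comp_pf: "polyfun coords (\<lambda>x. f (pr x))" if "polyfun coords f" for f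
    by (rule polyfun_compose[OF that]) (auto intro: pr_pf)
  have pf_topS: "polyfun coords (\<lambda>x. homogenize k Q 0 (pr x))"
    by (intro polyfun_homogenize polyfun_const pr_pf)
  \<comment> \<open>The vector \<open>e1\<close> shows that \<open>top\<close> is not identically
    zero on the orthogonal complement of \<open>e\<close>.\<close>
  obtain x2 where x2: "top (pr x2) \<noteq> 0" "homogenize k Q 0 (pr x2) \<noteq> 0"
    using polyfun_nonzero_common[OF comp_pf[OF pf_top] pf_topS, of e1 x1] te(2) x1
    by (auto simp: pr_id e1 pr_topS)
  \<comment> \<open>The extra condition on \<open>hip\<close> ensures
    \<open>pr x3 \<noteq> 0\<close>, so that it can be normalized.\<close>
  obtain x3 where x3: "top (pr x3) * homogenize k Q 0 (pr x3) \<noteq> 0" "hip (pr x3) e1 \<noteq> 0"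
    using polyfun_nonzero_common[OF polyfun_mult[OF comp_pf[OF pf_top] pf_topS] polyfun_hip[OF pr_pf], of x2 e1 e1] x2
    by (auto simp: pr_id e1)
  have "pr x3 \<noteq> 0" using x3(2) by (auto simp: hip_def)
  then obtain c where c: "c \<noteq> 0" "hip (c *s pr x3) (c *s pr x3) = 1" using hip_normalize by blast
  define e' where "e' = c *s pr x3"
  have e': "hip e' e' = 1" "hip e' e = 0" "top e' \<noteq> 0" "homogenize k Q 0 e' \<noteq> 0"
    using c x3 homogenize_scale[OF degQ, of c 0 "pr x3"] by (simp_all add: e'_def pr_hip hom_top)

  have ax: "hip (axis i 1) (axis j 1) = (if i = j then 1 else 0 :: complex)" for i j :: 'n
    by (simp add: hip_def axis_def if_distrib[of "\<lambda>x. x * _"] cong: if_cong)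
  have ee': "hip e e' = 0" using hip_cnj[of e' e] e'(2) by simp
  obtain A1 where A1: "unitary_map A1" "A1 (axis i1 1) = e" "A1 (axis i0 1) = e'"
    using unitary_pair[of "axis i1 1 :: complex ^ 'n" "axis i0 1" e e'] fl e e'(1) ee' by (auto simp: ax)
  \<comment> \<open>The component along \<open>e\<close> is \<open>(- 1) ^ D = - 1\<close> for odd
    \<open>D\<close>, so adding \<open>e\<close> projects the curve to the orthogonal complement of
    \<open>e\<close>.\<close>
  define \<rho> where "\<rho> \<tau> = A1 (h (2 * \<tau>, - 1, 1)) + e" for \<tau>
  have \<rho>_e: "hip (\<rho> \<tau>) e = 0" for \<tau>
  proof -
    have "hip (A1 (h (2 * \<tau>, - 1, 1))) (A1 (axis i1 1)) = hip (h (2 * \<tau>, - 1, 1)) (axis i1 1)"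
      using A1(1) by (simp add: unitary_map_def)
    also have "\<dots> = - 1"
      using D by (simp add: hip_def axis_def h_last if_distrib[of "\<lambda>x. _ * x"] if_distrib[of cnj] cong: if_cong)
    finally show ?thesis by (simp add: \<rho>_def A1(2) e)
  qed
  have \<rho>_pf: "polyfun gens1 (\<lambda>\<tau>. vec_nth (\<rho> \<tau>) i)" for i
    unfolding \<rho>_def vector_add_component
    by (intro polyfun_add polyfun_const unitary_map_polyfun[OF A1(1)] polyfun_compose3[OF h_pf]
      polyfun_mult polyfun_id1)
  have "\<exists>\<tau>. ev S (\<rho> \<tau>) \<noteq> 0"
  proof -
    \<comment> \<open>The curve near infinity, with \<open>\<sigma> = 1 / \<tau>\<close>: the value
      at \<open>\<sigma> = 0\<close> is a nonzero multiple of the top form of \<open>S\<close> at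
      \<open>e'\<close>.\<close>
    define g where "g \<sigma> = homogenize k Q (\<sigma> ^ D) (A1 (h (2, - \<sigma>, \<sigma>)))" for \<sigma>
    have "polyfun gens1 g"
      unfolding g_def
      by (intro polyfun_homogenize polyfun_power polyfun_id1 unitary_map_polyfun[OF A1(1)]
        polyfun_compose3[OF h_pf] polyfun_minus polyfun_const)
    moreover have "g 0 \<noteq> 0"
    proof -
      have "A1 (h (2, - 0, 0)) = 2 ^ D *s e'"
        using A1 by (simp add: h_axis unitary_map_def)
      then show ?thesis
        using D0 e'(4) homogenize_scale[OF degQ, of "2 ^ D" 0 e'] by (simp add: g_def zero_power)
    qed
    ultimately have "finite {\<sigma>. g \<sigma> = 0}" by (rule finite_zeros_on_curve)
    then have "finite (insert 0 {\<sigma>. g \<sigma> = 0})" by simp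
    then obtain \<sigma> where "\<sigma> \<notin> insert 0 {\<sigma>. g \<sigma> = 0}"
      using ex_new_if_finite[OF infinite_UNIV_char_0[where 'a = complex]] by blast
    then have \<sigma>: "\<sigma> \<noteq> 0" "g \<sigma> \<noteq> 0" by auto
    have "h (2, - \<sigma>, \<sigma>) = \<sigma> ^ D *s h (2 * (1 / \<sigma>), - 1, 1)"
      using h_hom[of \<sigma> "2 * (1 / \<sigma>)" "- 1" 1] \<sigma>(1) by simp
    then have "A1 (h (2, - \<sigma>, \<sigma>)) = \<sigma> ^ D *s A1 (h (2 * (1 / \<sigma>), - 1, 1))"
      using A1(1) by (simp add: unitary_map_def)
    also have "A1 (h (2 * (1 / \<sigma>), - 1, 1)) = \<rho> (1 / \<sigma>) + (- 1) *s e"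
      by (simp add: \<rho>_def Finite_Cartesian_Product.vec_eq_iff)
    finally have "g \<sigma> = (\<sigma> ^ D) ^ k * ev S (\<rho> (1 / \<sigma>))"
      unfolding g_def by (simp only: homogenize_affine[OF degQ] evS S_e)
    then show ?thesis using \<sigma>(2) by auto
  qed
  then obtain \<tau>0 where \<tau>0: "ev S (\<rho> \<tau>0) \<noteq> 0" ..
  \<comment> \<open>Outside this finite set the whole line of direction \<open>e\<close> avoids the
    common zeros, whatever the rotation. For each remaining \<open>\<tau>\<close> only finitely many
    \<open>l\<close> are bad, since \<open>Fc j0\<close> is monic up to a constant along
    \<open>e\<close>.\<close>
  define T1 where "T1 = {\<tau>. ev S (\<rho> \<tau>) = 0}"
  have "polyfun gens1 (\<lambda>\<tau>. ev S (\<rho> \<tau>))"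
    by (rule polyfun_compose[OF polyfun_ev]) (auto intro: \<rho>_pf)
  then have "finite T1" unfolding T1_def using \<tau>0 by (rule finite_zeros_on_curve)
  moreover have "finite {l. cpoly_eval (Fc j0) (\<rho> \<tau> + (- l) *s e) = 0}" for \<tau>
  proof -
    have "spec (\<rho> \<tau>) P0 \<noteq> 0"
      using degree_map_poly_lead(2)[of "\<lambda>c. ev c (\<rho> \<tau>)" P0] lead te(1) by auto
    then have "finite {t. poly (spec (\<rho> \<tau>) P0) t = 0}" by (rule poly_roots_finite)
    then have "finite (uminus -` {t. cpoly_eval (Fc j0) (\<rho> \<tau> + t *s e) = 0})"
      using P0 by (intro finite_vimageI) (auto simp: line_poly_def inj_on_def)
    then show ?thesis by (simp add: vimage_def)
  qed
  ultimately have fin: "finite (\<Union>\<tau>\<in>T1. {l. cpoly_eval (Fc j0) (\<rho> \<tau> + (- l) *s e) = 0})" by blast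
  have "\<not> {l. cmod l = 1} \<subseteq> (\<Union>\<tau>\<in>T1. {l. cpoly_eval (Fc j0) (\<rho> \<tau> + (- l) *s e) = 0})"
    using infinite_unit_circle finite_subset[OF _ fin] by blast
  then obtain l where l: "cmod l = 1" "\<And>\<tau>. \<tau> \<in> T1 \<Longrightarrow> cpoly_eval (Fc j0) (\<rho> \<tau> + (- l) *s e) \<noteq> 0"
    by blast
  define A where "A x = A1 x + ((l - 1) * hip (A1 x) e) *s e" for x
  have A: "unitary_map A"
    unfolding A_def by (rule unitary_map_compose[OF unitary_rotation[OF e l(1)] A1(1)])
  have A_h: "A (h (2 * \<tau>, - 1, 1)) = \<rho> \<tau> + (- l) *s e" for \<tau>
  proof -
    have h: "A1 (h (2 * \<tau>, - 1, 1)) = \<rho> \<tau> - e" by (simp add: \<rho>_def)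
    show ?thesis unfolding A_def h by (simp add: \<rho>_e e Finite_Cartesian_Product.vec_eq_iff algebra_simps)
  qed
  have nz: "\<exists>j. cpoly_eval (Fc j) (A (h (2 * \<tau>, - 1, 1))) \<noteq> 0" for \<tau>
    unfolding A_h using l(2)[of \<tau>] Sline[of "\<rho> \<tau>" "- l"] by (cases "\<tau> \<in> T1") (auto simp: T1_def)
  have "\<exists>j. homogenize d (Fc j) (s ^ D) (A (h (2 * r, - s, s))) \<noteq> 0" if "(r, s) \<noteq> (0, 0)" for r s
  proof (cases "s = 0")
    \<comment> \<open>The point at infinity: the rotation fixes \<open>e'\<close>, which is
      orthogonal to \<open>e\<close>, and \<open>top e' \<noteq> 0\<close>.\<close>
    case True
    then have r: "r \<noteq> 0" using that by simp
    have "A (h (2 * r, 0, 0)) = (2 * r) ^ D *s A (axis i0 1)"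
      using A by (simp add: h_axis unitary_map_def)
    also have "A (axis i0 1) = e'" by (simp add: A_def A1 e')
    finally have "homogenize d (Fc j0) (s ^ D) (A (h (2 * r, - s, s))) = ((2 * r) ^ D) ^ d * top e'"
      using True D0 homogenize_scale[OF deg[of j0], of "(2 * r) ^ D" 0 e'] by (simp add: top_def zero_power)
    then show ?thesis using r e'(3) by (intro exI[of _ j0]) simp
  next
    case False
    obtain j where j: "cpoly_eval (Fc j) (A (h (2 * (r / s), - 1, 1))) \<noteq> 0" using nz by blast
    have "h (2 * r, - s, s) = s ^ D *s h (2 * (r / s), - 1, 1)"
      using h_hom[of s "2 * (r / s)" "- 1" 1] False by simp
    then have "A (h (2 * r, - s, s)) = s ^ D *s A (h (2 * (r / s), - 1, 1))"
      using A by (simp add: unitary_map_def)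
    then have "homogenize d (Fc j) (s ^ D) (A (h (2 * r, - s, s))) =
        (s ^ D) ^ d * cpoly_eval (Fc j) (A (h (2 * (r / s), - 1, 1)))"
      by (simp only: homogenize_affine[OF deg])
    then show ?thesis using j False by (intro exI[of _ j]) simp
  qed
  then show ?thesis using A by blast
qed

section \<open>Proper rational maps\<close>

lemma cpoly_eval_continuous: "continuous_on UNIV (cpoly_eval P)"
  by (rule polyfun_continuous[OF polyfun_cpoly_eval]) (auto intro: continuous_intros)

lemma cpoly_nonzero_dense:
  fixes q :: "'n::finite cpoly"
  assumes "q \<noteq> 0"
  shows "closure {z. cpoly_eval q z \<noteq> 0} = UNIV"
proof -
  obtain y where y: "cpoly_eval q y \<noteq> 0" using cpoly_eq_0_if_eval_0 assms by blast
  have "z \<in> closure {z. cpoly_eval q z \<noteq> 0}" for z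
    unfolding closure_approachable
  proof (intro allI impI)
    fix e :: real assume "e > 0"
    define g where "g t = cpoly_eval q (z + t *s (y - z))" for t
    have "polyfun gens1 g"
      unfolding g_def
      by (rule polyfun_compose[OF polyfun_cpoly_eval]) (auto intro!: polyfun_add polyfun_diff polyfun_mult polyfun_const polyfun_id1)
    moreover have "g 1 \<noteq> 0" using y by (simp add: g_def)
    ultimately have fin: "finite {t. g t = 0}" by (rule finite_zeros_on_curve)
    define \<delta> where "\<delta> = e / (norm (y - z) + 1)"
    have "\<delta> > 0" using \<open>e > 0\<close> by (simp add: \<delta>_def add_nonneg_pos)
    then have "infinite (complex_of_real ` {0<..<\<delta>})"
      by (subst finite_image_iff) (auto simp: inj_on_def)
    then have "\<not> complex_of_real ` {0<..<\<delta>} \<subseteq> {t. g t = 0}" using fin finite_subset by blast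
    then obtain t' where "t' \<in> complex_of_real ` {0<..<\<delta>}" "g t' \<noteq> 0" by blast
    then obtain t where t: "0 < t" "t < \<delta>" "g (complex_of_real t) \<noteq> 0" by auto
    have "vec_nth (complex_of_real t *s (y - z)) i = vec_nth (t *\<^sub>R (y - z)) i" for i
      unfolding vector_scaleR_component vector_smult_component by (rule scaleR_conv_of_real[symmetric])
    then have "complex_of_real t *s (y - z) = t *\<^sub>R (y - z)"
      unfolding Finite_Cartesian_Product.vec_eq_iff by blast
    then have "dist (z + complex_of_real t *s (y - z)) z = t * norm (y - z)"
      using t(1) by (simp add: dist_norm)
    also have "\<dots> \<le> t * (norm (y - z) + 1)" using t(1) by simp
    also have "\<dots> < \<delta> * (norm (y - z) + 1)" using t(2) by (intro mult_strict_right_mono) (auto simp: add_nonneg_pos)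
    also have "\<dots> = e"
      using norm_ge_zero[of "y - z"] unfolding \<delta>_def by (simp add: add_nonneg_eq_0_iff)
    finally show "\<exists>y\<in>{z. cpoly_eval q z \<noteq> 0}. dist y z < e" using t(3) by (auto simp: g_def)
  qed
  then show ?thesis by blast
qed

text \<open>Properness makes the norm of \<open>f z\<close> tend to 1 at the boundary. Since
  \<open>f\<close> equals \<open>p / q\<close> only off the zeros of \<open>q\<close>, the estimate
  is made there and extended to \<open>x\<close> by density and continuity, which also covers zeros
  of \<open>q\<close> on the sphere.\<close>

lemma proper_quotient_on_sphere:
  fixes f :: "complex ^ 'n::finite \<Rightarrow> complex ^ 'm::finite"
  assumes proper: "proper_holomorphic_map f (ball 0 1) (ball 0 1)"
    and quot: "is_quotient_on f (ball 0 1) p q" and x: "norm x = 1"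
  shows "(\<Sum>j\<in>UNIV. (cmod (cpoly_eval (vec_nth p j) x))\<^sup>2) = (cmod (cpoly_eval q x))\<^sup>2"
proof -
  have q0: "q \<noteq> 0" and fz: "\<And>z. norm z < 1 \<Longrightarrow> cpoly_eval q z \<noteq> 0 \<Longrightarrow>
      f z = inverse (cpoly_eval q z) *s cpoly_map_eval p z"
    using quot by (auto simp: is_quotient_on_def)
  have pm: "proper_map (top_of_set (ball 0 1)) (top_of_set (ball 0 1)) f"
    using proper by (simp add: proper_holomorphic_map_def)
  have ball: "norm (f z) < 1" if "norm z < 1" for z
    using pm that unfolding proper_map_ball_iff image_subset_iff by auto
  have comp: "compact {z \<in> ball 0 1. f z \<in> K}" if "compact K" "K \<subseteq> ball 0 1" for K
    using pm that unfolding proper_map_ball_iff by blast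
  define g where "g z = (\<Sum>j\<in>UNIV. (cmod (cpoly_eval (vec_nth p j) z))\<^sup>2) - (cmod (cpoly_eval q z))\<^sup>2" for z
  have g_f: "g z = (cmod (cpoly_eval q z))\<^sup>2 * ((norm (f z))\<^sup>2 - 1)"
    if z: "norm z < 1" "cpoly_eval q z \<noteq> 0" for z
  proof -
    have "cpoly_eval (vec_nth p j) z = cpoly_eval q z * vec_nth (f z) j" for j
      using fz[OF z] z(2) by (simp add: cpoly_map_eval_def)
    then have "(\<Sum>j\<in>UNIV. (cmod (cpoly_eval (vec_nth p j) z))\<^sup>2)
        = (cmod (cpoly_eval q z))\<^sup>2 * (\<Sum>j\<in>UNIV. (cmod (vec_nth (f z) j))\<^sup>2)"
      by (simp add: norm_mult power_mult_distrib sum_distrib_left)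
    also have "(\<Sum>j\<in>UNIV. (cmod (vec_nth (f z) j))\<^sup>2) = (norm (f z))\<^sup>2"
      by (simp add: norm_vec_def L2_set_def sum_nonneg)
    finally show ?thesis by (simp add: g_def algebra_simps)
  qed
  have bound: "\<bar>g x\<bar> \<le> (cmod (cpoly_eval q x))\<^sup>2 * (1 - (1 - \<eta>)\<^sup>2)" if \<eta>: "0 < \<eta>" "\<eta> < 1" for \<eta>
  proof -
    have "compact {z \<in> ball 0 1. f z \<in> cball 0 (1 - \<eta>)}"
      by (rule comp) (use \<eta> in auto)
    \<comment> \<open>The inserted 0 keeps the set nonempty, so that its maximum exists.\<close>
    define R where "R = insert 0 (norm ` {z \<in> ball 0 1. f z \<in> cball 0 (1 - \<eta>)})"
    have "compact R"
      unfolding R_def using \<open>compact _\<close>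
      by (intro compact_insert compact_continuous_image continuous_on_norm continuous_on_id)
    moreover have "R \<noteq> {}" by (simp add: R_def)
    ultimately obtain \<rho> where \<rho>: "\<rho> \<in> R" "\<And>y. y \<in> R \<Longrightarrow> y \<le> \<rho>"
      using compact_attains_sup[of R] by blast
    have \<rho>1: "0 \<le> \<rho>" "\<rho> < 1" using \<rho>(1) by (auto simp: R_def)
    define W where "W = ball 0 1 - cball (0 :: complex ^ 'n) \<rho>"
    have "open W" by (simp add: W_def open_Diff)
    have "x \<in> closure W"
      unfolding closure_approachable
    proof (intro allI impI)
      fix e :: real assume "e > 0"
      define t where "t = min (e / 2) ((1 - \<rho>) / 2)"
      have t1: "t \<le> e / 2" and t2: "t \<le> (1 - \<rho>) / 2" by (simp_all only: t_def min.cobounded1 min.cobounded2)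
      have t0: "0 < t" using \<open>e > 0\<close> \<rho>1 by (simp add: t_def)
      have t: "t < e" "t < 1 - \<rho>" using t0 t1 t2 \<rho>1 by simp_all
      have "norm ((1 - t) *\<^sub>R x) = 1 - t" using t0 t \<rho>1 x by simp
      then have "(1 - t) *\<^sub>R x \<in> W" using t0 t by (simp add: W_def)
      moreover have "dist ((1 - t) *\<^sub>R x) x = t"
      proof -
        have "(1 - t) *\<^sub>R x - x = (- t) *\<^sub>R x" by (simp add: scaleR_left_diff_distrib)
        then show ?thesis unfolding dist_norm using t0 x by simp
      qed
      then have "dist ((1 - t) *\<^sub>R x) x < e" using t by simp
      ultimately show "\<exists>y\<in>W. dist y x < e" by blast
    qed
    also have "closure W = closure (W \<inter> {z. cpoly_eval q z \<noteq> 0})"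
      using closure_open_Int_superset[OF \<open>open W\<close>, of "{z. cpoly_eval q z \<noteq> 0}"] cpoly_nonzero_dense[OF q0]
      by simp
    finally have "x \<in> closure (W \<inter> {z. cpoly_eval q z \<noteq> 0})" .
    moreover have "W \<inter> {z. cpoly_eval q z \<noteq> 0} \<subseteq> {z. \<bar>g z\<bar> \<le> (cmod (cpoly_eval q z))\<^sup>2 * (1 - (1 - \<eta>)\<^sup>2)}"
    proof
      fix z assume z: "z \<in> W \<inter> {z. cpoly_eval q z \<noteq> 0}"
      then have z1: "norm z < 1" "cpoly_eval q z \<noteq> 0" "\<rho> < norm z" by (auto simp: W_def)
      have "f z \<notin> cball 0 (1 - \<eta>)"
        using \<rho>(2)[of "norm z"] z1 by (auto simp: R_def)
      then have "1 - \<eta> \<le> norm (f z)" by simp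
      then have "(1 - \<eta>)\<^sup>2 \<le> (norm (f z))\<^sup>2" using \<eta> by (intro power_mono) auto
      moreover have "(norm (f z))\<^sup>2 \<le> 1" using ball[OF z1(1)] by (simp add: power_le_one)
      ultimately have "\<bar>(norm (f z))\<^sup>2 - 1\<bar> \<le> 1 - (1 - \<eta>)\<^sup>2" by simp
      then show "z \<in> {z. \<bar>g z\<bar> \<le> (cmod (cpoly_eval q z))\<^sup>2 * (1 - (1 - \<eta>)\<^sup>2)}"
        using g_f[OF z1(1,2)] by (simp add: abs_mult mult_left_mono)
    qed
    moreover have "closed {z. \<bar>g z\<bar> \<le> (cmod (cpoly_eval q z))\<^sup>2 * (1 - (1 - \<eta>)\<^sup>2)}"
      unfolding g_def
      by (intro closed_Collect_le continuous_intros cpoly_eval_continuous)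
    ultimately show ?thesis using closure_minimal by blast
  qed
  have "((\<lambda>\<eta>. (cmod (cpoly_eval q x))\<^sup>2 * (1 - (1 - \<eta>)\<^sup>2)) \<longlongrightarrow> (cmod (cpoly_eval q x))\<^sup>2 * (1 - (1 - 0)\<^sup>2)) (at_right 0)"
    by (intro tendsto_intros)
  moreover have "\<forall>\<^sub>F \<eta> in at_right 0. \<bar>g x\<bar> \<le> (cmod (cpoly_eval q x))\<^sup>2 * (1 - (1 - \<eta>)\<^sup>2)"
    unfolding eventually_at_right_field using bound by (intro exI[of _ 1]) auto
  ultimately have "\<bar>g x\<bar> \<le> (cmod (cpoly_eval q x))\<^sup>2 * (1 - (1 - 0)\<^sup>2)"
    by (intro tendsto_lowerbound) auto
  then show ?thesis by (simp add: g_def)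
qed

theorem corollary2:
  fixes f :: "complex ^ 'n::finite \<Rightarrow> complex ^ 'm::finite" and d :: nat
  assumes "CARD('n) \<ge> 2" and "CARD('m) \<ge> 2"
    and "proper_holomorphic_map f (ball 0 1) (ball 0 1)"
    and "rational_map_of_degree_on f (ball 0 1) d"
  shows "real d \<le> real CARD('m) * (real CARD('m) - 1) / (2 * (2 * real CARD('n) - 3))"
proof (cases "d = 0")
  case True
  then show ?thesis using assms(1,2) by simp
next
  \<comment> \<open>Positive \<open>d\<close> is used twice: a component of degree \<open>d\<close>
    cannot be the zero polynomial, and the homogenized map vanishes at the origin.\<close>
  case False
  obtain p q where quot: "is_quotient_on f (ball 0 1) p q" and low: "lowest_terms p q"
    and d: "d = max (map_degree p) (total_degree q)"
    using assms(4) by (auto simp: rational_map_of_degree_on_def)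
  define Fc where "Fc j = (case j of None \<Rightarrow> q | Some j \<Rightarrow> vec_nth p j)" for j
  have Fc [simp]: "Fc None = q" "Fc (Some j) = vec_nth p j" for j by (simp_all add: Fc_def)
  have deg: "total_degree (Fc j) \<le> d" for j
  proof (cases j)
    case (Some i)
    have "total_degree (vec_nth p i) \<le> map_degree p" unfolding map_degree_def by (intro Max_ge) auto
    then show ?thesis using Some d by simp
  qed (simp add: d)
  obtain j0 where j0: "total_degree (Fc j0) = d" "Fc j0 \<noteq> 0"
  proof (cases "total_degree q = d")
    case True
    then show ?thesis using that[of None] quot by (simp add: is_quotient_on_def)
  next
    case ne: False
    then have "map_degree p = d" using d by (auto simp: max_def split: if_splits)
    moreover have "map_degree p \<in> range (\<lambda>j. total_degree (vec_nth p j))"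
      unfolding map_degree_def by (intro Max_in) auto
    ultimately obtain j where j: "total_degree (vec_nth p j) = d" by auto
    have "total_degree (0 :: 'n cpoly) = 0" by (simp add: total_degree_def)
    then have "vec_nth p j \<noteq> 0" using j False by auto
    then show ?thesis using that[of "Some j"] j by simp
  qed
  have coprime: "g dvd 1" if "\<And>j. g dvd Fc j" for g
    using low that[of None] that[of "Some j" for j] by (auto simp: lowest_terms_def)
  define D where "D = 2 * CARD('n) - 3"
  have D: "odd D" "D > 0" using assms(1) by (auto simp: D_def)
  obtain h :: "complex \<times> complex \<times> complex \<Rightarrow> complex ^ 'n" and i0 i1 where
    ne: "i0 \<noteq> i1" and h_pf: "\<And>i. polyfun gens3 (\<lambda>x. vec_nth (h x) i)"
    and h_hom: "\<And>c z w t. h (c * z, c * w, c * t) = c ^ D *s h (z, w, t)"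
    and h_null: "\<And>z w t. z * cnj z + w * cnj w = t * cnj t \<Longrightarrow>
      (\<Sum>i\<in>UNIV. vec_nth (h (z, w, t)) i * cnj (vec_nth (h (z, w, t)) i)) = (t * cnj t) ^ D"
    and h_last: "\<And>z w t. vec_nth (h (z, w, t)) i1 = w ^ D"
    and h_axis: "\<And>z. h (z, 0, 0) = z ^ D *s axis i0 1"
    using sharp_map_ex[OF assms(1)] unfolding D_def by blast
  obtain A where A: "unitary_map A" and A_nz: "\<And>r s. (r, s) \<noteq> (0, 0) \<Longrightarrow>
      \<exists>j. homogenize d (Fc j) (s ^ D) (A (h (2 * r, - s, s))) \<noteq> 0"
    using good_unitary[where Fc = Fc and h = h and D = D, OF assms(1) deg j0 coprime ne D(1) h_pf h_hom h_last h_axis] by blast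
  have A_scale: "A (c *s x) = c *s A x" for c x using A by (simp add: unitary_map_def)
  have sphere: "(\<Sum>l\<in>UNIV. cpoly_eval (Fc (Some l)) x * cnj (cpoly_eval (Fc (Some l)) x)) =
      cpoly_eval (Fc None) x * cnj (cpoly_eval (Fc None) x)" if "norm x = 1" for x
    using proper_quotient_on_sphere[OF assms(3) quot that]
    unfolding complex_norm_square[symmetric] of_real_power[symmetric] of_real_sum[symmetric] of_real_eq_iff Fc .
  define \<Phi> where "\<Phi> x i = homogenize d (Fc i) (snd (snd x) ^ D) (A (h x))" for x i
  interpret sphere_map \<Phi> "D * d"
  proof
    show "polyfun gens3 (\<lambda>x. \<Phi> x i)" for i
      unfolding \<Phi>_def
      by (intro polyfun_homogenize polyfun_power polyfun_gens3 unitary_map_polyfun[OF A] h_pf)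
    show "\<Phi> (c * z, c * w, c * t) i = c ^ (D * d) * \<Phi> (z, w, t) i" for c z w t i
      using homogenize_scale[OF deg[of i], of "c ^ D" "t ^ D" "A (h (z, w, t))"]
      by (simp add: \<Phi>_def h_hom A_scale power_mult_distrib power_mult)
    show "\<exists>i. \<Phi> (2 * r, - s, s) i \<noteq> 0" if "(r, s) \<noteq> (0, 0)" for r s
      using A_nz[OF that] by (simp add: \<Phi>_def)
    show "(\<Sum>l\<in>UNIV. \<Phi> (z, w, t) (Some l) * cnj (\<Phi> (z, w, t) (Some l))) =
        \<Phi> (z, w, t) None * cnj (\<Phi> (z, w, t) None)"
      if eq: "z * cnj z + w * cnj w = t * cnj t" for z w t
    proof (cases "t = 0")
      \<comment> \<open>The origin is the only null vector with \<open>t = 0\<close>, where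
        dehomogenizing is impossible.\<close>
      case True
      then have "complex_of_real ((cmod z)\<^sup>2 + (cmod w)\<^sup>2) = 0"
        using eq by (simp add: complex_norm_square del: of_real_power)
      then have "(cmod z)\<^sup>2 + (cmod w)\<^sup>2 = 0" by (simp only: of_real_eq_0_iff)
      then have "z = 0" "w = 0" by (simp_all add: sum_power2_eq_zero_iff)
      then have "h (z, w, t) = 0 *s axis i0 1" using True h_axis[of 0] D(2) by (simp add: zero_power)
      then have "\<Phi> (z, w, t) i = 0" for i
        using True D(2) False homogenize_scale[OF deg[of i], of 0 0 "A (axis i0 1)"] A_scale[of 0 "axis i0 1"]
        by (simp add: \<Phi>_def zero_power)
      then show ?thesis by simp
    next
      case t: False
      define x where "x = (1 / t ^ D) *s A (h (z, w, t))"
      have xt: "A (h (z, w, t)) = t ^ D *s x" using t by (simp add: x_def vector_smult_assoc)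
      have "hip (h (z, w, t)) (h (z, w, t)) = (t * cnj t) ^ D"
        using h_null[OF eq] by (simp add: hip_def)
      then have "hip (A (h (z, w, t))) (A (h (z, w, t))) = (t * cnj t) ^ D"
        using A by (simp add: unitary_map_def)
      then have "hip x x = 1" using t by (simp add: x_def power_mult_distrib)
      then have "norm x = 1" unfolding hip_self of_real_eq_1_iff 
        using power2_eq_iff_nonneg[of "norm x" 1] by simp
      have \<Phi>: "\<Phi> (z, w, t) i = (t ^ D) ^ d * cpoly_eval (Fc i) x" for i
        unfolding \<Phi>_def xt snd_conv homogenize_affine[OF deg] ..
      have "(\<Sum>l\<in>UNIV. \<Phi> (z, w, t) (Some l) * cnj (\<Phi> (z, w, t) (Some l))) =
          ((t ^ D) ^ d * cnj ((t ^ D) ^ d)) * (\<Sum>l\<in>UNIV. cpoly_eval (Fc (Some l)) x * cnj (cpoly_eval (Fc (Some l)) x))"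
        unfolding \<Phi> sum_distrib_left by (intro sum.cong) (simp_all add: mult_ac)
      also have "\<dots> = \<Phi> (z, w, t) None * cnj (\<Phi> (z, w, t) None)"
        unfolding sphere[OF \<open>norm x = 1\<close>] \<Phi> by (simp add: mult_ac)
      finally show ?thesis .
    qed
  qed
  have "real (2 * (D * d)) \<le> real (CARD('m) * (CARD('m) - 1))"
    using degree_bound by (simp only: of_nat_le_iff)
  moreover have "real D = 2 * real CARD('n) - 3" using assms(1) by (simp add: D_def of_nat_diff)
  moreover have "real (CARD('m) - 1) = real CARD('m) - 1" using assms(2) by (simp add: of_nat_diff)
  ultimately have "real d * (2 * (2 * real CARD('n) - 3)) \<le> real CARD('m) * (real CARD('m) - 1)"
    by (simp add: mult_ac)
  then show ?thesis using assms(1) by (subst pos_le_divide_eq) auto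
qed

end
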